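(* Let $N\ge1$ and let $X_N=\{x_1,\dots,x_N\}\subset\mathbb S^2$ be the images under the stereographic projection of the $N$ zeros of the random elliptic polynomial $P_N(z)=\sum_{n=0}^N a_n\sqrt{\binom{N}{n}}\,z^n$, where $a_0,\dots,a_N$ are i.i.d. standard complex Gaussian random variables. For $t\ge0$ let $G(t,X_N)=\#\{i<j:\ |x_i-x_j|\le t\}$. Then for every $0<t<2$, $$ \mathbb{E}[G(t,X_N)]=\frac{t^2 N^2 }{8}-\frac{N}{2}+\frac{t^2 N^2}{8(4-t^2)\left(\left(\frac{4}{4-t^2}\right)^N-1\right)}\left[8-t^2-t^2N-\frac{t^2N}{\left(\frac{4}{4-t^2}\right)^N-1}\right]. $$ Consequently, $\mathbb{E}[G(t,X_N)]=\frac{N^3 t^4}{128}(1+o(1))$ as $N\to\infty$ whenever $t=t_N=o(N^{-1/2})$, and moreover $\mathbb{E}[G(t,X_N)]\leq \frac{N^3 t^4}{128}$ for all $t\le 2$.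
   Context: The stereographic projection identifies $z\in\mathbb C$ with a point $x(z)$ of the unit sphere $\mathbb S^2\subset\mathbb R^3$ in such a way that the Euclidean (chordal) distance satisfies $|x(z)-x(w)|=\frac{2|z-w|}{\sqrt{1+|z|^2}\sqrt{1+|w|^2}}$; $|\cdot|$ denotes Euclidean distance in $\mathbb R^3$. *)

theory Defs
  imports "HOL-Probability.Probability"
          "HOL-Computational_Algebra.Fundamental_Theorem_Algebra"
          "HOL-Library.Landau_Symbols"
begin

text \<open>Stereographic projection onto the unit sphere in R^3 (coordinates as a triple;
  the product norm on real * real * real is the Euclidean norm).\<close>
definition stereo :: "complex \<Rightarrow> real \<times> real \<times> real" where
  "stereo z = (2 * Re z / (1 + (cmod z)^2), 2 * Im z / (1 + (cmod z)^2),
               ((cmod z)^2 - 1) / (1 + (cmod z)^2))"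

definition std_cgauss :: "complex measure" where
  "std_cgauss = density lborel (\<lambda>z. ennreal (exp (- ((cmod z)\<^sup>2)) / Transcendental.pi))"

definition coef_measure :: "nat \<Rightarrow> (nat \<Rightarrow> complex) measure" where
  "coef_measure N = PiM {..N} (\<lambda>_. std_cgauss)"

definition elliptic_poly :: "nat \<Rightarrow> (nat \<Rightarrow> complex) \<Rightarrow> complex poly" where
  "elliptic_poly N a = (\<Sum>n\<le>N. monom (a n * complex_of_real (sqrt (real (N choose n)))) n)"

definition pair_count :: "real \<Rightarrow> complex list \<Rightarrow> nat" where
  "pair_count t xs = card {(i, j). i < j \<and> j < length xs \<and>
      dist (stereo (xs ! i)) (stereo (xs ! j)) \<le> t}"

definition G_zeros :: "nat \<Rightarrow> real \<Rightarrow> (nat \<Rightarrow> complex) \<Rightarrow> nat" where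
  "G_zeros N t a = pair_count t (SOME xs. mset xs = proots (elliptic_poly N a))"

definition EG :: "nat \<Rightarrow> real \<Rightarrow> real" where
  "EG N t = (\<integral>a. real (G_zeros N t a) \<partial>coef_measure N)"

end

theory Submission
  imports Defs "HOL-Complex_Analysis.Complex_Analysis"
begin

text \<open>The expected number of ordered pairs of roots at distance at most \<open>t\<close> is an expectation of a
  sum over the roots \<open>w\<close> of \<open>P\<close>. For fixed higher coefficients the constant coefficient is a
  polynomial function of the root, so the area formula turns this expectation into an integral over
  \<open>w\<close> and over the Gaussian law of \<open>P\<close> conditioned on \<open>P w = 0\<close>, weighted by
  \<open>(cmod (P' w))^2\<close>. Rotations of the sphere act unitarily on the coefficients, hence the
  inner integral is the one for \<open>w = 0\<close>. There \<open>P z / z\<close> is again a Gaussian polynomial with constant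
  coefficient \<open>b 1\<close>, and the same elimination of \<open>b 1\<close> leaves the integral over a disc of
  an explicit radial density, which is the derivative of an elementary function.\<close>

section \<open>The area formula for complex polynomials\<close>

text \<open>Counting ordered index pairs, diagonal included, gives
  \<open>N + 2 * G_zeros N t a\<close>, a sum over the roots \<open>w\<close> of the number of roots
  in the chordal disc about \<open>w\<close>. Rotated to the origin this disc is
  \<open>(cmod u)^2 \<le> x\<close> with \<open>x = t^2 / (4 - t^2)\<close>; since
  \<open>1 + x = 4 / (4 - t^2)\<close>, the quantity \<open>q\<close> of the closed form is
  \<open>(1 + x) ^ N - 1\<close>. After the rotation the Jacobian is a multiple of
  \<open>(cmod (b 1))^2\<close>, so the later root counts carry this weight. Two obstacles shape the
  preparation. Roots are not given as measurable functions of the coefficients, so measurability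
  goes through the continuous map from roots to coefficients. And no determinant on the coefficient
  space is computed: the unknown constant in a linear change of variables is cancelled against an
  integral of known value. The outcome is \<open>EG N t = N / 2 * conditional_count N x\<close>. The
  bound \<open>conditional_count N x \<le> N^2 / 4 * (x / (1 + x))^2\<close> and
  \<open>x / (1 + x) = t^2 / 4\<close> produce the constant 128 as
  \<open>2 * 4 * 16\<close>.\<close>

definition complex_of_vec :: "real^2 \<Rightarrow> complex" where
  "complex_of_vec v = Complex (v $ 1) (v $ 2)"

definition vec_of_complex :: "complex \<Rightarrow> real^2" where
  "vec_of_complex z = (\<chi> i. if i = 1 then Re z else Im z)"

lemma complex_of_vec_inverse [simp]: "complex_of_vec (vec_of_complex z) = z"
  by (simp add: complex_of_vec_def vec_of_complex_def)

lemma vec_of_complex_inverse [simp]: "vec_of_complex (complex_of_vec v) = v"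
  by (simp add: complex_of_vec_def vec_of_complex_def vec_eq_iff forall_2)

lemma bounded_linear_complex_of_vec: "bounded_linear complex_of_vec"
  unfolding linear_conv_bounded_linear[symmetric]
  by (rule linearI) (auto simp: complex_of_vec_def complex_eq_iff)

lemma bounded_linear_vec_of_complex: "bounded_linear vec_of_complex"
  unfolding linear_conv_bounded_linear[symmetric]
  by (rule linearI) (auto simp: vec_of_complex_def vec_eq_iff)

lemma complex_of_vec_measurable [measurable]: "complex_of_vec \<in> borel_measurable borel"
  by (intro borel_measurable_continuous_onI linear_continuous_on bounded_linear_complex_of_vec)

lemma lborel_distr_complex_of_vec: "distr lborel borel complex_of_vec = lborel"
proof (rule sym, rule lborel_eqI)
  fix l u :: complex
  assume le: "\<And>b. b \<in> Basis \<Longrightarrow> l \<bullet> b \<le> u \<bullet> b"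
  have *: "complex_of_vec -` box l u = box (vec_of_complex l) (vec_of_complex u)"
    by (auto simp: box_def Basis_complex_def complex_of_vec_def vec_of_complex_def
        Basis_vec_def inner_axis forall_2)
  have "emeasure (distr lborel borel complex_of_vec) (box l u)
      = emeasure lborel (box (vec_of_complex l) (vec_of_complex u))"
    by (subst emeasure_distr) (auto simp: *)
  also have "\<dots> = (\<Prod>b\<in>Basis. (vec_of_complex u - vec_of_complex l) \<bullet> b)"
    by (intro emeasure_lborel_box)
      (use le[of 1] le[of "\<i>"] in \<open>auto simp: Basis_vec_def inner_axis vec_of_complex_def Basis_complex_def\<close>)
  also have "(\<Prod>b\<in>Basis. (vec_of_complex u - vec_of_complex l) \<bullet> b) = (\<Prod>b\<in>Basis. (u - l) \<bullet> b)"
  proof -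
    have B: "(Basis :: (real^2) set) = {axis 1 1, axis 2 1}"
      by (auto simp: Basis_vec_def UNIV_2)
    have "axis (1::2) (1::real) \<noteq> axis 2 1" by (simp add: axis_eq_axis)
    then show ?thesis
      by (simp add: B Basis_complex_def inner_axis vec_of_complex_def complex_eq_iff)
  qed
  finally show "emeasure (distr lborel borel complex_of_vec) (box l u) = ennreal (\<Prod>b\<in>Basis. (u - l) \<bullet> b)" .
qed simp

text \<open>Multiplication by \<open>a + b * \<i>\<close> has the real matrix with rows
  \<open>(a, -b)\<close> and \<open>(b, a)\<close>. This is why the real Jacobian of a holomorphic
  map is the squared modulus of its derivative.\<close>

lemma det_complex_mult:
  "det (matrix (\<lambda>h. vec_of_complex (c * complex_of_vec h))) = (cmod c)^2"
  unfolding cmod_power2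
  by (simp add: det_2 matrix_def complex_of_vec_def vec_of_complex_def axis_def power2_eq_square)

text \<open>The real change of variables theorem is phrased with \<open>det (matrix _)\<close> on
  \<open>real^2\<close>, so the statement is carried over by the measure-preserving map
  \<open>complex_of_vec\<close>. Boundedness of \<open>A\<close> makes the continuous Jacobian
  integrable on it.\<close>

lemma emeasure_poly_image:
  fixes p :: "complex poly"
  assumes A: "A \<in> sets borel" "bounded A" and inj: "inj_on (poly p) A"
    and im: "poly p ` A \<in> sets borel"
  shows "emeasure lborel (poly p ` A)
    = (\<integral>\<^sup>+w. indicator A w * ennreal ((cmod (poly (pderiv p) w))^2) \<partial>lborel)"
proof -
  define S where "S = complex_of_vec -` A"
  define F where "F = (\<lambda>v. vec_of_complex (poly p (complex_of_vec v)))"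
  define F' where "F' = (\<lambda>v h. vec_of_complex (poly (pderiv p) (complex_of_vec v) * complex_of_vec h))"
  define J where "J = (\<lambda>v. (cmod (poly (pderiv p) (complex_of_vec v)))^2)"
  have S: "S \<in> sets borel"
    unfolding S_def using measurable_sets[OF complex_of_vec_measurable A(1)] by simp
  have Seq: "S = vec_of_complex ` A"
    unfolding S_def by (auto simp: image_iff) (metis vec_of_complex_inverse)
  have Sb: "bounded S"
    unfolding Seq using A(2) bounded_linear_vec_of_complex by (rule bounded_linear_image)
  have der: "(F has_derivative F' x) (at x within S)" for x
  proof -
    have 1: "(complex_of_vec has_derivative complex_of_vec) (at x within S)"
      by (rule bounded_linear_imp_has_derivative[OF bounded_linear_complex_of_vec])
    have 2: "(poly p has_derivative (\<lambda>h. poly (pderiv p) (complex_of_vec x) * h)) (at (complex_of_vec x))"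
      using poly_DERIV[of p "complex_of_vec x"] by (simp add: has_field_derivative_def)
    have 3: "((\<lambda>v. poly p (complex_of_vec v)) has_derivative
        (\<lambda>h. poly (pderiv p) (complex_of_vec x) * complex_of_vec h)) (at x within S)"
      by (rule has_derivative_compose[OF 1 2])
    show ?thesis unfolding F_def F'_def
      by (rule bounded_linear.has_derivative[OF bounded_linear_vec_of_complex 3])
  qed
  have injF: "inj_on F S"
    unfolding F_def S_def
    by (rule inj_onI) (metis complex_of_vec_inverse inj inj_onD vec_of_complex_inverse vimageD)
  have det: "\<bar>det (matrix (F' x))\<bar> = J x" for x
    unfolding F'_def det_complex_mult J_def by simp
  have contJ: "continuous_on T J" for T
    unfolding J_def
    by (intro continuous_intros continuous_on_compose2[of UNIV "poly (pderiv p)" T complex_of_vec]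
        linear_continuous_on bounded_linear_complex_of_vec) auto
  obtain a b where ab: "S \<subseteq> cbox a b" using Sb bounded_subset_cbox_symmetric by metis
  have "J absolutely_integrable_on cbox a b"
    by (rule absolutely_integrable_continuous[OF contJ])
  then have "J absolutely_integrable_on S"
    using S ab by (auto intro: set_integrable_subset)
  then have intJ: "J integrable_on S" by (rule set_lebesgue_integral_eq_integral(1))
  have imF: "F ` S = vec_of_complex ` (poly p ` A)"
    unfolding F_def Seq by (force simp: image_iff)
  have imF': "F ` S = complex_of_vec -` (poly p ` A)"
    unfolding imF by (auto simp: image_iff) (metis vec_of_complex_inverse)
  have FS: "F ` S \<in> sets borel"
    unfolding imF' using measurable_sets[OF complex_of_vec_measurable im] by simp
  have m: "F ` S \<in> lmeasurable \<and> measure lebesgue (F ` S) = integral S J"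
    using has_measure_differentiable_image[of S F F' "integral S J"] S der injF intJ det
    by (auto simp: integrable_integral)
  have "emeasure lborel (poly p ` A) = emeasure (distr lborel borel complex_of_vec) (poly p ` A)"
    by (simp add: lborel_distr_complex_of_vec)
  also have "\<dots> = emeasure lborel (F ` S)"
    using im by (subst emeasure_distr) (auto simp: imF')
  also have "\<dots> = emeasure lebesgue (F ` S)" using FS by simp
  also have "\<dots> = ennreal (integral S J)"
    using m by (subst emeasure_eq_measure2) (auto simp: fmeasurable_def)
  also have "\<dots> = (\<integral>\<^sup>+v. indicator S v * ennreal (J v) \<partial>lborel)"
  proof -
    have "(\<integral>\<^sup>+v. ennreal (indicator S v * J v) \<partial>lborel) = ennreal (integral S J)"
      using nn_integral_has_integral_lebesgue[of S J "integral S J"] intJ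
      by (auto simp: J_def integrable_integral)
    moreover have "ennreal (indicator S v * J v) = indicator S v * ennreal (J v)" for v
      by (simp split: split_indicator)
    ultimately show ?thesis by simp
  qed
  also have "\<dots> = (\<integral>\<^sup>+w. indicator A w * ennreal ((cmod (poly (pderiv p) w))^2)
      \<partial>distr lborel borel complex_of_vec)"
  proof -
    have [measurable]: "(\<lambda>w. ennreal ((cmod (poly (pderiv p) w))^2)) \<in> borel_measurable borel"
      by (intro measurable_compose[OF _ measurable_ennreal] borel_measurable_continuous_onI continuous_intros)
    have "(\<lambda>w. indicator A w * ennreal ((cmod (poly (pderiv p) w))^2)) \<in> borel_measurable borel"
      using A(1) by measurable
    then show ?thesis
      by (subst nn_integral_distr) (auto simp: S_def J_def indicator_def intro!: nn_integral_cong)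
  qed
  also have "\<dots> = (\<integral>\<^sup>+w. indicator A w * ennreal ((cmod (poly (pderiv p) w))^2) \<partial>lborel)"
    by (simp only: lborel_distr_complex_of_vec)
  finally show ?thesis .
qed


text \<open>Where \<open>poly p\<close> is injective each fibre has at most one point, so
  \<open>G\<close> is \<open>g\<close> composed with the inverse branch, cut off to the image of
  \<open>B\<close>. Taking \<open>B\<close> smaller than the open chart \<open>U\<close> leaves room
  for the disjoint Borel pieces used later.\<close>

lemma nn_integral_poly_chart:
  fixes p :: "complex poly"
  assumes U: "open U" "bounded U" and inj: "inj_on (poly p) U"
    and B: "B \<in> sets borel" "B \<subseteq> U" and g [measurable]: "g \<in> borel_measurable borel"
  defines "G \<equiv> \<lambda>y. \<Sum>w\<in>{w\<in>B. poly p w = y}. (g w :: ennreal)"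
  shows "G \<in> borel_measurable borel"
    and "(\<integral>\<^sup>+y. G y \<partial>lborel)
      = (\<integral>\<^sup>+w. indicator B w * (g w * ennreal ((cmod (poly (pderiv p) w))^2)) \<partial>lborel)"
proof -
  have hol: "poly p holomorphic_on U" by (intro holomorphic_intros)
  obtain h where h: "h holomorphic_on (poly p ` U)" "\<And>z. z \<in> U \<Longrightarrow> h (poly p z) = z"
    using holomorphic_has_inverse[OF hol U(1) inj] by metis
  have opU: "open (poly p ` U)"
    using open_mapping_thm3[OF hol U(1) inj] .
  \<comment> \<open>The inverse branch, extended by 0 to a total Borel function; images under
    \<open>poly p\<close> are then preimages under \<open>k\<close>, hence Borel.\<close>
  define k where "k y = (if y \<in> poly p ` U then h y else 0)" for y
  have k [measurable]: "k \<in> borel_measurable borel"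
    unfolding k_def
    using borel_measurable_continuous_on_if[of "poly p ` U" h "\<lambda>_. 0"] opU
      holomorphic_on_imp_continuous_on[OF h(1)] by auto
  have im: "poly p ` A = poly p ` U \<inter> k -` A" if "A \<subseteq> U" for A
    using that h(2) by (auto simp: k_def image_iff subset_iff) (metis)+
  have imb: "poly p ` A \<in> sets borel" if "A \<subseteq> U" "A \<in> sets borel" for A
    unfolding im[OF that(1)] using opU measurable_sets[OF k that(2)] by auto
  have Geq: "G y = indicator (poly p ` B) y * g (k y)" for y
  proof (cases "y \<in> poly p ` B")
    case True
    then obtain w where w: "w \<in> B" "y = poly p w" by auto
    have "{w\<in>B. poly p w = y} = {w}"
      using w B(2) inj by (auto dest: inj_onD)
    moreover have "k y = w" using w B(2) h(2) by (auto simp: k_def)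
    ultimately show ?thesis using True by (simp add: G_def)
  next
    case False
    then have e: "{w\<in>B. poly p w = y} = {}" by auto
    show ?thesis unfolding G_def e using False by simp
  qed
  have [measurable]: "poly p ` B \<in> sets borel" "B \<in> sets borel" using imb B by auto
  show "G \<in> borel_measurable borel"
    unfolding Geq[abs_def] by measurable
  have [measurable]: "(\<lambda>w. ennreal ((cmod (poly (pderiv p) w))^2)) \<in> borel_measurable borel"
    by (intro measurable_compose[OF _ measurable_ennreal] borel_measurable_continuous_onI continuous_intros)
  \<comment> \<open>Comparing the two measures on sets, where \<open>emeasure_poly_image\<close>
    applies, settles the integral for all \<open>g\<close> at once.\<close>
  have "distr (density lborel (indicator (poly p ` B))) borel k
      = density lborel (\<lambda>w. indicator B w * ennreal ((cmod (poly (pderiv p) w))^2))"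
    (is "?M1 = ?M2")
  proof (rule measure_eqI)
    fix A assume "A \<in> sets ?M1"
    then have A [measurable]: "A \<in> sets borel" by simp
    have e: "poly p ` B \<inter> k -` A = poly p ` (B \<inter> A)"
      using im[of B] im[of "B \<inter> A"] B(2) by auto
    have [measurable]: "k -` A \<in> sets borel" using measurable_sets[OF k A] by simp
    have "emeasure ?M1 A = emeasure (density lborel (indicator (poly p ` B))) (k -` A)"
      by (subst emeasure_distr) auto
    also have "\<dots> = (\<integral>\<^sup>+y. indicator (poly p ` B) y * indicator (k -` A) y \<partial>lborel)"
      by (subst emeasure_density) auto
    also have "\<dots> = (\<integral>\<^sup>+y. indicator (poly p ` (B \<inter> A)) y \<partial>lborel)"
      unfolding e[symmetric] indicator_inter_arith by simp
    also have "\<dots> = emeasure lborel (poly p ` (B \<inter> A))"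
      using imb[of "B \<inter> A"] B by (intro nn_integral_indicator) auto
    also have "\<dots> = (\<integral>\<^sup>+w. indicator (B \<inter> A) w * ennreal ((cmod (poly (pderiv p) w))^2) \<partial>lborel)"
      using B inj imb[of "B \<inter> A"] U(2)
      by (intro emeasure_poly_image) (auto intro: bounded_subset inj_on_subset)
    also have "\<dots> = emeasure ?M2 A"
      by (subst emeasure_density) (auto simp: indicator_inter_arith ac_simps intro!: nn_integral_cong)
    finally show "emeasure ?M1 A = emeasure ?M2 A" .
  qed simp
  then have "(\<integral>\<^sup>+w. g w \<partial>?M1) = (\<integral>\<^sup>+w. g w \<partial>?M2)" by simp
  then show "(\<integral>\<^sup>+y. G y \<partial>lborel)
      = (\<integral>\<^sup>+w. indicator B w * (g w * ennreal ((cmod (poly (pderiv p) w))^2)) \<partial>lborel)"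
    by (simp add: nn_integral_distr nn_integral_density Geq ac_simps)
qed

text \<open>Away from the finitely many critical points \<open>poly p\<close> is locally injective.
  Countably many balls of injectivity cover this region, and making them disjoint reduces the claim
  to a countable sum of charts.\<close>

theorem nn_integral_poly_preimages:
  fixes p :: "complex poly" and g :: "complex \<Rightarrow> ennreal"
  assumes p: "pderiv p \<noteq> 0" and g [measurable]: "g \<in> borel_measurable borel"
  shows "(\<integral>\<^sup>+y. (\<Sum>w\<in>{w. poly p w = y}. g w) \<partial>lborel)
    = (\<integral>\<^sup>+w. g w * ennreal ((cmod (poly (pderiv p) w))^2) \<partial>lborel)"
proof -
  define Z where "Z = {w. poly (pderiv p) w = 0}"
  have Z: "finite Z" unfolding Z_def using p by (rule poly_roots_finite)
  define F where "F = {ball w r |w r. inj_on (poly p) (ball w r)}"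
  have F: "open S" "bounded S" "inj_on (poly p) S" if "S \<in> F" for S
    using that by (auto simp: F_def)
  obtain F' where F': "F' \<subseteq> F" "countable F'" "\<Union>F' = \<Union>F"
    using Lindelof[of F] F(1) by metis
  have cover: "- Z \<subseteq> \<Union>F"
  proof
    fix w assume "w \<in> - Z"
    then have d: "deriv (poly p) w \<noteq> 0"
      by (simp add: Z_def DERIV_imp_deriv[OF poly_DERIV])
    obtain r where "r > 0" "inj_on (poly p) (ball w r)"
    proof (rule has_complex_derivative_locally_injective[of "poly p" UNIV w])
      show "poly p holomorphic_on UNIV" by (intro holomorphic_intros)
    qed (use d that in auto)
    then have "ball w r \<in> F" "w \<in> ball w r" unfolding F_def by auto
    then show "w \<in> \<Union>F" by (rule UnionI)
  qed
  have ne: "F' \<noteq> {}"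
  proof
    assume "F' = {}"
    then have "(UNIV :: complex set) \<subseteq> Z" using cover F' by auto
    then show False using Z infinite_UNIV_char_0 finite_subset by blast
  qed
  define U where "U = from_nat_into F'"
  have U: "U n \<in> F'" for n unfolding U_def using ne by (rule from_nat_into)
  have rU: "range U = F'" unfolding U_def using F'(2) ne by simp
  define B where "B n = disjointed (\<lambda>n. U n - Z) n" for n
  have Zb: "Z \<in> sets borel" using Z by (simp add: finite_imp_closed)
  have UZ: "range (\<lambda>n. U n - Z) \<subseteq> sets borel"
  proof -
    have "open (U n)" for n using U[of n] F'(1) F(1) by auto
    then show ?thesis using Zb by auto
  qed
  have Bs [measurable]: "B n \<in> sets borel" for n
    unfolding B_def using sets.range_disjointed_sets[OF UZ[folded sets_lborel]] by auto
  have BU: "B n \<subseteq> U n" for n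
    unfolding B_def using disjointed_subset[of "\<lambda>n. U n - Z" n] by auto
  have Bdis: "disjoint_family B" unfolding B_def by (rule disjoint_family_disjointed)
  have BZ: "(\<Union>n. B n) = - Z"
    unfolding B_def UN_disjointed_eq using cover rU F'(3) by auto
  have ind: "(\<Sum>n. indicator (B n) w) = (indicator (- Z) w :: ennreal)" for w
    using suminf_indicator[OF Bdis] by (simp add: BZ)
  have indm: "(\<Sum>n. indicator (B n) w * c) = (if w \<in> Z then 0 else c)" for w and c :: ennreal
    unfolding ennreal_suminf_multc ind by simp
  define G where "G n y = (\<Sum>w\<in>{w\<in>B n. poly p w = y}. g w)" for n y
  have UF: "U n \<in> F" for n using U F'(1) by auto
  note chart = nn_integral_poly_chart[OF F(1,2,3)[OF UF] Bs BU g]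
  have Gm [measurable]: "G n \<in> borel_measurable borel" for n
    unfolding G_def[abs_def] by (rule chart(1))
  have Gi: "(\<integral>\<^sup>+y. G n y \<partial>lborel)
      = (\<integral>\<^sup>+w. indicator (B n) w * (g w * ennreal ((cmod (poly (pderiv p) w))^2)) \<partial>lborel)" for n
    unfolding G_def[abs_def] by (rule chart(2))
  have [measurable]: "(\<lambda>w. ennreal ((cmod (poly (pderiv p) w))^2)) \<in> borel_measurable borel"
    by (intro measurable_compose[OF _ measurable_ennreal] borel_measurable_continuous_onI continuous_intros)
  have fin: "finite {w. poly p w = y}" for y
  proof -
    have "p - [:y:] \<noteq> 0" using p by (metis eq_iff_diff_eq_0 pderiv_pCons pderiv_0 pCons_0_0 add_0_left)
    from poly_roots_finite[OF this] show ?thesis by simp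
  qed
  have "(\<integral>\<^sup>+y. (\<Sum>w\<in>{w. poly p w = y}. g w) \<partial>lborel) = (\<integral>\<^sup>+y. (\<Sum>n. G n y) \<partial>lborel)"
  proof (rule nn_integral_cong_AE)
    \<comment> \<open>The pieces \<open>B n\<close> miss the critical points \<open>Z\<close>, so
      the two sums may differ only at the finitely many critical values.\<close>
    have "AE y in lborel. y \<notin> poly p ` Z"
      by (rule AE_not_in) (use Z in \<open>auto intro!: finite_imp_null_set_lborel\<close>)
    then show "AE y in lborel. (\<Sum>w\<in>{w. poly p w = y}. g w) = (\<Sum>n. G n y)"
    proof eventually_elim
      fix y assume y: "y \<notin> poly p ` Z"
      have "G n y = (\<Sum>w\<in>{w. poly p w = y}. indicator (B n) w * g w)" for n
        unfolding G_def using fin[of y]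
        by (intro sum.mono_neutral_cong_left) (auto simp: indicator_def)
      then have "(\<Sum>n. G n y) = (\<Sum>w\<in>{w. poly p w = y}. (\<Sum>n. indicator (B n) w * g w))"
        by (simp add: suminf_sum)
      also have "\<dots> = (\<Sum>w\<in>{w. poly p w = y}. g w)"
        using y unfolding indm
        by (intro sum.cong) auto
      finally show "(\<Sum>w\<in>{w. poly p w = y}. g w) = (\<Sum>n. G n y)" by simp
    qed
  qed
  also have "\<dots> = (\<Sum>n. \<integral>\<^sup>+y. G n y \<partial>lborel)" by (rule nn_integral_suminf) simp
  also have "\<dots> = (\<integral>\<^sup>+w. (\<Sum>n. indicator (B n) w * (g w * ennreal ((cmod (poly (pderiv p) w))^2))) \<partial>lborel)"
    unfolding Gi by (rule nn_integral_suminf[symmetric]) simp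
  also have "\<dots> = (\<integral>\<^sup>+w. g w * ennreal ((cmod (poly (pderiv p) w))^2) \<partial>lborel)"
    \<comment> \<open>On \<open>Z\<close> the pieces contribute nothing, and the integrand vanishes
      there because the derivative does.\<close>
    unfolding indm by (intro nn_integral_cong) (auto simp: Z_def)
  finally show ?thesis .
qed

section \<open>Measurability of functionals of the roots\<close>

definition coeff_vector_poly :: "nat \<Rightarrow> (nat \<Rightarrow> 'a::comm_monoid_add) \<Rightarrow> 'a poly" where
  "coeff_vector_poly N a = (\<Sum>n\<le>N. monom (a n) n)"

lemma coeff_coeff_vector_poly: "coeff (coeff_vector_poly N a) n = (if n \<le> N then a n else 0)"
  by (simp add: coeff_vector_poly_def coeff_sum)

lemma continuous_on_coeff_prod_linear:
  fixes d :: nat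
  shows "continuous_on S (\<lambda>x::complex \<times> (nat \<Rightarrow> complex). coeff (\<Prod>i<d. [:- snd x i, 1:]) n)"
proof (induction d arbitrary: n)
  case 0
  then show ?case by simp
next
  case (Suc d)
  have *: "continuous_on S (\<lambda>x::complex \<times> (nat \<Rightarrow> complex). snd x d)"
    by (rule continuous_on_compose2[OF continuous_on_product_coordinates continuous_on_snd])
       (auto intro: continuous_on_id)
  have "coeff (\<Prod>i<Suc d. [:- snd x i, 1:]) n = - snd x d * coeff (\<Prod>i<d. [:- snd x i, 1:]) n
      + (case n of 0 \<Rightarrow> 0 | Suc k \<Rightarrow> coeff (\<Prod>i<d. [:- snd x i, 1:]) k)" for x :: "complex \<times> (nat \<Rightarrow> complex)"
    by (simp add: coeff_pCons algebra_simps split: nat.split)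
  then show ?case
    by (cases n) (auto intro!: continuous_intros Suc.IH *)
qed

lemma proots_smult_prod_linear:
  fixes z :: "nat \<Rightarrow> complex"
  assumes "c \<noteq> 0"
  shows "proots (smult c (\<Prod>i<d. [:- z i, 1:])) = mset (map z [0..<d])"
proof -
  have "proots (smult c (\<Prod>i<d. [:- z i, 1:])) = (\<Sum>i<d. {#z i#})"
    using assms by (simp add: proots_prod)
  also have "\<dots> = mset (map z [0..<d])" by (induction d) auto
  finally show ?thesis .
qed

text \<open>Continuity of the roots in the coefficients is avoided. The map from a leading
  coefficient and a list of roots to the coefficients is continuous, so each superlevel set of
  \<open>\<Phi>\<close> is, apart from the zero polynomial, a countable union of continuous images
  of compact sets. Closedness of the superlevel sets in the roots is all that is asked of
  \<open>\<Phi>\<close>.\<close>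

lemma proots_functional_measurable:
  fixes \<Phi> :: "complex multiset \<Rightarrow> nat"
  assumes closed: "\<And>d k. closed {z :: nat \<Rightarrow> complex. k \<le> \<Phi> (mset (map z [0..<d]))}"
  shows "(\<lambda>a. \<Phi> (proots (coeff_vector_poly N a))) \<in> borel \<rightarrow>\<^sub>M count_space UNIV"
proof -
  define V :: "nat \<Rightarrow> complex \<times> (nat \<Rightarrow> complex) \<Rightarrow> nat \<Rightarrow> complex"
    where "V d = (\<lambda>x n. coeff (smult (fst x) (\<Prod>i<d. [:- snd x i, 1:])) n)" for d
  \<comment> \<open>The leading coefficient is kept away from 0 and infinity, and all root
    coordinates, including those beyond \<open>d\<close>, are bounded, so \<open>K d k m\<close> is
    compact by Tychonoff; the union over \<open>m\<close> exhausts the parameters that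
    matter.\<close>
  define K where "K d k m = {c :: complex. 1 / real (Suc m) \<le> cmod c \<and> cmod c \<le> real m}
    \<times> (PiE UNIV (\<lambda>_. cball 0 (real m)) \<inter> {z. k \<le> \<Phi> (mset (map z [0..<d]))})" for d k m
  define E where "E k = {a :: nat \<Rightarrow> complex. (\<forall>n>N. a n = 0) \<and> k \<le> \<Phi> (proots (coeff_vector_poly N a))}" for k
  have contV: "continuous_on S (V d)" for S d
    unfolding V_def coeff_smult
    by (intro continuous_on_coordinatewise_then_product continuous_on_mult continuous_on_coeff_prod_linear
        continuous_on_fst continuous_on_id)
  have compK: "compact (K d k m)" for d k m
  proof -
    have "compact {c :: complex. 1 / real (Suc m) \<le> cmod c \<and> cmod c \<le> real m}"
    proof -
      have "{c :: complex. 1 / real (Suc m) \<le> cmod c \<and> cmod c \<le> real m}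
          = cball 0 (real m) \<inter> {c. 1 / real (Suc m) \<le> cmod c}" by auto
      then show ?thesis
        by (auto intro!: compact_Int_closed closed_Collect_le continuous_intros)
    qed
    moreover have "compact (PiE UNIV (\<lambda>_::nat. cball 0 (real m) :: complex set))"
      using compactin_PiE[of "\<lambda>_::nat. euclidean :: complex topology" UNIV "\<lambda>_. cball 0 (real m)"]
      by (simp add: euclidean_product_topology)
    ultimately show ?thesis
      unfolding K_def by (intro compact_Times compact_Int_closed closed)
  qed
  have poly_V: "coeff_vector_poly N (V d x) = smult (fst x) (\<Prod>i<d. [:- snd x i, 1:])"
    and V_zero: "n > N \<Longrightarrow> V d x n = 0" if "d \<le> N" for d x n
  proof -
    have "degree (smult (fst x) (\<Prod>i<d. [:- snd x i, 1:])) \<le> degree (\<Prod>i<d. [:- snd x i, 1:])"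
      by (rule degree_smult_le)
    also have "\<dots> \<le> N"
      using that by (subst degree_prod_eq_sum_degree) auto
    finally have deg: "degree (smult (fst x) (\<Prod>i<d. [:- snd x i, 1:])) \<le> N" .
    show "n > N \<Longrightarrow> V d x n = 0"
      unfolding V_def using deg by (intro coeff_eq_0) simp
    show "coeff_vector_poly N (V d x) = smult (fst x) (\<Prod>i<d. [:- snd x i, 1:])"
      unfolding coeff_vector_poly_def V_def by (rule poly_as_sum_of_monoms'[OF deg])
  qed
  have "E k = {a. a = (\<lambda>_. 0) \<and> k \<le> \<Phi> {#}} \<union> (\<Union>d\<le>N. \<Union>m. V d ` K d k m)" for k
  proof (intro equalityI subsetI)
    fix a assume a: "a \<in> E k"
    define p where "p = coeff_vector_poly N a"
    show "a \<in> {a. a = (\<lambda>_. 0) \<and> k \<le> \<Phi> {#}} \<union> (\<Union>d\<le>N. \<Union>m. V d ` K d k m)"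
    proof (cases "p = 0")
      case True
      then have "a n = 0" for n
        using a coeff_coeff_vector_poly[of N a n] by (cases "n \<le> N") (auto simp: p_def E_def)
      then show ?thesis using a True by (auto simp: E_def p_def)
    next
      case False
      obtain A where A: "size A = degree p" "p = smult (lead_coeff p) (\<Prod>x\<in>#A. [:-x, 1:])"
        using alg_closed_imp_factorization[OF False] by auto
      obtain xs where xs: "mset xs = A" using ex_mset by auto
      define d where "d = length xs"
      \<comment> \<open>The padding by 0 keeps the coordinates beyond \<open>d\<close> inside every
        ball of \<open>K d k m\<close>.\<close>
      define z where "z i = (if i < d then xs ! i else 0)" for i
      have mz: "map z [0..<d] = xs" by (auto simp: z_def d_def intro: nth_equalityI)
      have prod: "(\<Prod>x\<in>#A. [:-x, 1:]) = (\<Prod>i<d. [:- z i, 1:])"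
      proof -
        have "(\<Prod>x\<in>#A. [:-x, 1:]) = prod_list (map (\<lambda>x. [:-x, 1:]) (map z [0..<d]))"
          unfolding mz xs[symmetric] by (simp flip: prod_mset_prod_list)
        also have "\<dots> = prod_list (map (\<lambda>i. [:- z i, 1:]) [0..<d])" by (simp add: o_def)
        also have "\<dots> = (\<Prod>i<d. [:- z i, 1:])"
          by (simp add: prod.distinct_set_conv_list[symmetric] lessThan_atLeast0)
        finally show ?thesis .
      qed
      have pz: "p = smult (lead_coeff p) (\<Prod>i<d. [:- z i, 1:])" using A(2) prod by simp
      have "degree p \<le> N"
        unfolding p_def by (intro degree_le) (simp add: coeff_coeff_vector_poly)
      then have dN: "d \<le> N" using A(1) xs by (auto simp: d_def)
      have lc: "lead_coeff p \<noteq> 0" using False by simp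
      have proots: "proots p = mset (map z [0..<d])"
        using proots_smult_prod_linear[OF lc, of z d] pz by simp
      define B where "B = Max (insert (cmod (lead_coeff p)) (insert (1 / cmod (lead_coeff p)) (cmod ` z ` {..<d})))"
      have B: "cmod (lead_coeff p) \<le> B" "1 / cmod (lead_coeff p) \<le> B" "\<And>i. i < d \<Longrightarrow> cmod (z i) \<le> B"
        unfolding B_def by (rule Max_ge; simp)+
      obtain m where m: "B \<le> real m" using real_arch_simple by auto
      have "cmod (z i) \<le> real m" for i
        using B(3)[of i] m by (cases "i < d") (auto simp: z_def)
      moreover have "1 / real (Suc m) \<le> cmod (lead_coeff p)"
      proof -
        have "1 / cmod (lead_coeff p) \<le> real (Suc m)" using B(2) m by simp
        then show ?thesis using lc by (simp add: field_simps)
      qed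
      moreover have "k \<le> \<Phi> (mset (map z [0..<d]))"
        using a unfolding E_def proots[symmetric] p_def by simp
      ultimately have "(lead_coeff p, z) \<in> K d k m"
        using B(1) m by (auto simp: K_def)
      moreover have "V d (lead_coeff p, z) = a"
      proof
        fix n
        have "V d (lead_coeff p, z) n = coeff p n"
          unfolding V_def using pz by simp
        also have "\<dots> = a n" using a by (auto simp: p_def coeff_coeff_vector_poly E_def)
        finally show "V d (lead_coeff p, z) n = a n" .
      qed
      ultimately show ?thesis using dN by blast
    qed
  next
    fix a assume "a \<in> {a. a = (\<lambda>_. 0) \<and> k \<le> \<Phi> {#}} \<union> (\<Union>d\<le>N. \<Union>m. V d ` K d k m)"
    then consider "a = (\<lambda>_. 0)" "k \<le> \<Phi> {#}"
      | d m c z where "d \<le> N" "(c, z) \<in> K d k m" "a = V d (c, z)" by auto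
    then show "a \<in> E k"
    proof cases
      case 1
      then show ?thesis by (simp add: E_def coeff_vector_poly_def)
    next
      case 2
      have "c \<noteq> 0" using 2(2) by (auto simp: K_def)
      then have "proots (coeff_vector_poly N a) = mset (map z [0..<d])"
        unfolding 2(3) poly_V[OF 2(1)] fst_conv snd_conv by (rule proots_smult_prod_linear)
      moreover have "\<forall>n>N. a n = 0" using 2(1) by (simp add: 2(3) V_zero)
      ultimately show ?thesis
        using 2(2) by (simp only: E_def K_def mem_Collect_eq mem_Times_iff snd_conv Int_iff)
    qed
  qed
  moreover have "closed (V d ` K d k m)" for d k m
    by (intro compact_imp_closed compact_continuous_image contV compK)
  ultimately have Eb: "E k \<in> sets borel" for k
    by (auto intro!: sets.Un sets.countable_UN borel_closed simp: conj_commute)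
  \<comment> \<open>\<open>E k\<close> only contains vectors that vanish beyond \<open>N\<close>;
    truncation transfers its measurability to arbitrary coefficient sequences.\<close>
  define trunc where "trunc a = (\<lambda>n. if n \<le> N then a n else 0)" for a :: "nat \<Rightarrow> complex"
  have "continuous_on UNIV (\<lambda>a. trunc a n)" for n
    by (cases "n \<le> N") (auto simp: trunc_def intro: continuous_on_product_coordinates)
  then have "continuous_on UNIV trunc"
    by (rule continuous_on_coordinatewise_then_product)
  then have trunc: "trunc \<in> borel_measurable borel" by (rule borel_measurable_continuous_onI)
  have "coeff_vector_poly N (trunc a) = coeff_vector_poly N a" for a
    unfolding coeff_vector_poly_def by (intro sum.cong) (auto simp: trunc_def)
  then have "{a. k \<le> \<Phi> (proots (coeff_vector_poly N a))} = trunc -` E k" for k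
    by (auto simp: E_def trunc_def)
  then have ge: "{a. k \<le> \<Phi> (proots (coeff_vector_poly N a))} \<in> sets borel" for k
    using measurable_sets[OF trunc Eb[of k]] by simp
  show ?thesis
  proof (subst measurable_count_space_eq2_countable, safe)
    fix k :: nat
    have "(\<lambda>a. \<Phi> (proots (coeff_vector_poly N a))) -` {k} \<inter> space borel
        = {a. k \<le> \<Phi> (proots (coeff_vector_poly N a))} - {a. Suc k \<le> \<Phi> (proots (coeff_vector_poly N a))}"
      by auto
    then show "(\<lambda>a. \<Phi> (proots (coeff_vector_poly N a))) -` {k} \<inter> space borel \<in> sets borel"
      using ge by simp
  qed auto
qed

text \<open>At least \<open>k\<close> of finitely many closed conditions hold iff all conditions in
  some subset of size at least \<open>k\<close> hold: a finite union of intersections of closed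
  sets.\<close>

lemma closed_le_card_Collect:
  assumes "finite X" "\<And>x. x \<in> X \<Longrightarrow> closed {z. P x z}"
  shows "closed {z. k \<le> card {x \<in> X. P x z}}"
proof -
  have "{z. k \<le> card {x \<in> X. P x z}} = (\<Union>S\<in>{S. S \<subseteq> X \<and> k \<le> card S}. \<Inter>x\<in>S. {z. P x z})"
  proof (intro equalityI subsetI)
    fix z assume "z \<in> {z. k \<le> card {x \<in> X. P x z}}"
    then show "z \<in> (\<Union>S\<in>{S. S \<subseteq> X \<and> k \<le> card S}. \<Inter>x\<in>S. {z. P x z})"
      by (intro UN_I[of "{x \<in> X. P x z}"]) auto
  next
    fix z assume "z \<in> (\<Union>S\<in>{S. S \<subseteq> X \<and> k \<le> card S}. \<Inter>x\<in>S. {z. P x z})"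
    then obtain S where "S \<subseteq> X" "k \<le> card S" "S \<subseteq> {x \<in> X. P x z}" by auto
    then show "z \<in> {z. k \<le> card {x \<in> X. P x z}}"
      using card_mono[of "{x \<in> X. P x z}" S] assms(1) by auto
  qed
  then show ?thesis using assms
    by (auto intro!: closed_UN closed_INT)
qed

section \<open>Gaussian integrals\<close>

abbreviation gaussian_PiM :: "'i set \<Rightarrow> ('i \<Rightarrow> complex) measure" where
  "gaussian_PiM I \<equiv> PiM I (\<lambda>_. std_cgauss)"

abbreviation lborel_PiM :: "'i set \<Rightarrow> ('i \<Rightarrow> complex) measure" where
  "lborel_PiM I \<equiv> PiM I (\<lambda>_. lborel)"

text \<open>Polar coordinates reduced to one fact: the disc \<open>(cmod z)^2 \<le> x\<close> has
  area \<open>pi * x\<close>. In the variable \<open>(cmod z)^2\<close> the radial density is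
  therefore constant.\<close>

lemma distr_cmod_squared:
  "distr lborel borel (\<lambda>z::complex. (cmod z)^2) = density lborel (\<lambda>x. ennreal pi * indicator {0..} x)"
proof -
  have 1: "emeasure (distr lborel borel (\<lambda>z::complex. (cmod z)^2)) {..x} = ennreal (pi * max 0 x)" for x :: real
  proof (cases "x \<ge> 0")
    case True
    then have "(\<lambda>z::complex. (cmod z)^2) -` {..x} = cball 0 (sqrt x)"
      by (auto simp: real_le_rsqrt real_le_lsqrt dest: real_le_rsqrt) (metis norm_ge_zero real_sqrt_le_iff real_sqrt_pow2_iff real_sqrt_power abs_norm_cancel real_sqrt_abs sqrt_le_D)
    then show ?thesis using True
      by (subst emeasure_distr) (auto simp: emeasure_cball DIM_complex unit_ball_vol_2)
  next
    case False
    then have "(\<lambda>z::complex. (cmod z)^2) -` {..x} = {}"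
      by (auto dest: order_trans[OF zero_le_power2])
    then show ?thesis using False
      by (subst emeasure_distr) auto
  qed
  have 2: "emeasure (density lborel (\<lambda>x. ennreal pi * indicator {0..} x)) {..x} = ennreal (pi * max 0 x)" for x :: real
  proof -
    have "emeasure (density lborel (\<lambda>x. ennreal pi * indicator {0..} x)) {..x}
        = (\<integral>\<^sup>+y. ennreal pi * indicator {0..x} y \<partial>lborel)"
      by (subst emeasure_density) (auto intro!: nn_integral_cong split: split_indicator)
    also have "\<dots> = ennreal pi * ennreal (max 0 x)"
      by (subst nn_integral_cmult_indicator) (auto simp: max_def)
    finally show ?thesis by (simp add: ennreal_mult)
  qed
  have sb: "sets borel = sigma_sets UNIV (range (\<lambda>a::real. {..a}))"
    by (subst borel_eq_atMost) simp
  show ?thesis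
  proof (rule measure_eqI_generator_eq[of "range (\<lambda>a::real. {..a})" UNIV _ _ "\<lambda>n. {..real n}"])
    show "Int_stable (range (\<lambda>a::real. {..a}))"
      by (auto simp: Int_stable_def)
    show "(\<Union>n. {..real n}) = UNIV" by (auto simp: real_arch_simple)
  qed (auto simp: 1 2 sb)
qed

lemma nn_integral_cmod_squared:
  assumes [measurable]: "f \<in> borel_measurable borel"
  shows "(\<integral>\<^sup>+z. f ((cmod z)^2) \<partial>lborel) = ennreal pi * (\<integral>\<^sup>+x. indicator {0..} x * f x \<partial>lborel)"
proof -
  have "(\<integral>\<^sup>+z. f ((cmod z)^2) \<partial>lborel) = (\<integral>\<^sup>+x. f x \<partial>distr lborel borel (\<lambda>z::complex. (cmod z)^2))"
    by (simp add: nn_integral_distr)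
  also have "\<dots> = (\<integral>\<^sup>+x. ennreal pi * (indicator {0..} x * f x) \<partial>lborel)"
    unfolding distr_cmod_squared by (simp add: nn_integral_density mult.assoc)
  finally show ?thesis by (simp add: nn_integral_cmult)
qed

definition cgauss_density :: "complex \<Rightarrow> ennreal" where
  "cgauss_density z = ennreal (exp (- (cmod z)\<^sup>2) / pi)"

lemma cgauss_density_measurable [measurable]: "cgauss_density \<in> borel_measurable borel"
  unfolding cgauss_density_def[abs_def] by measurable

lemma std_cgauss_eq: "std_cgauss = density lborel cgauss_density"
  by (simp add: std_cgauss_def cgauss_density_def[abs_def])

lemma sets_std_cgauss [measurable_cong, simp]: "sets std_cgauss = sets borel"
  by (simp add: std_cgauss_eq)

lemma space_std_cgauss [simp]: "space std_cgauss = UNIV"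
  by (simp add: std_cgauss_eq)

text \<open>In the variable \<open>(cmod z)^2\<close> the integrand is a constant multiple of an
  Erlang density with rate \<open>1 + c\<close>, whose total mass is 1.\<close>

lemma cgauss_moment_exp:
  assumes "c \<ge> 0"
  shows "(\<integral>\<^sup>+z. ennreal (((cmod z)^2) ^ k * exp (- (c * (cmod z)^2))) \<partial>std_cgauss)
    = ennreal (fact k / (1 + c) ^ Suc k)"
proof -
  have l: "1 + c > 0" using assms by simp
  define f where "f x = ennreal (x ^ k * exp (- ((1 + c) * x)) / pi)" for x :: real
  have [measurable]: "f \<in> borel_measurable borel" unfolding f_def by measurable
  have "(\<integral>\<^sup>+z. ennreal (((cmod z)^2) ^ k * exp (- (c * (cmod z)^2))) \<partial>std_cgauss)
      = (\<integral>\<^sup>+z. f ((cmod z)^2) \<partial>lborel)"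
    unfolding std_cgauss_eq
    by (subst nn_integral_density)
       (auto intro!: nn_integral_cong simp: cgauss_density_def f_def ennreal_mult[symmetric]
          exp_add[symmetric] algebra_simps simp del: ennreal_mult)
  also have "\<dots> = (\<integral>\<^sup>+x. ennreal pi * (indicator {0..} x * f x) \<partial>lborel)"
    by (simp add: nn_integral_cmod_squared nn_integral_cmult)
  also have "\<dots> = (\<integral>\<^sup>+x. ennreal (fact k / (1 + c) ^ Suc k) * ennreal (erlang_density k (1 + c) x) \<partial>lborel)"
  proof (rule nn_integral_cong)
    fix x :: real
    have "pi * (x ^ k * exp (- ((1 + c) * x)) / pi)
        = fact k / (1 + c) ^ Suc k * ((1 + c) ^ Suc k * x ^ k * exp (- (1 + c) * x) / fact k)"
      using l by (simp add: field_simps del: power_Suc)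
    then show "ennreal pi * (indicator {0..} x * f x)
        = ennreal (fact k / (1 + c) ^ Suc k) * ennreal (erlang_density k (1 + c) x)"
      using l by (cases "x < 0")
        (auto simp: f_def erlang_density_def ennreal_mult[symmetric] simp del: power_Suc)
  qed
  also have "\<dots> = ennreal (fact k / (1 + c) ^ Suc k) * (\<integral>\<^sup>+x. ennreal (erlang_density k (1 + c) x) \<partial>lborel)"
    by (rule nn_integral_cmult) auto
  also have "(\<integral>\<^sup>+x. ennreal (erlang_density k (1 + c) x) \<partial>lborel) = 1"
    using prob_space.emeasure_space_1[OF prob_space_erlang_density[OF l, of k]]
    by (simp add: emeasure_density)
  finally show ?thesis by simp
qed

lemma prob_space_std_cgauss: "prob_space std_cgauss"
proof
  show "emeasure std_cgauss (space std_cgauss) = 1"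
    using cgauss_moment_exp[of 0 0] by (simp add: nn_integral_const)
qed

interpretation std_cgauss: prob_space std_cgauss by (rule prob_space_std_cgauss)

interpretation gauss_product: product_prob_space "\<lambda>_. std_cgauss" I for I :: "'i set"
  by unfold_locales

interpretation lebesgue_product: product_sigma_finite "\<lambda>_. lborel :: complex measure"
  by unfold_locales

lemma PiM_std_cgauss_density:
  assumes I: "finite I"
  shows "gaussian_PiM I
    = density (lborel_PiM I) (\<lambda>x. \<Prod>i\<in>I. cgauss_density (x i))" (is "_ = ?D")
proof (rule sym, rule gauss_product.PiM_eqI[OF I])
  show "sets ?D
      = sets (gaussian_PiM I)"
    by (simp cong: sets_PiM_cong)
  fix A assume A: "\<And>i. i \<in> I \<Longrightarrow> A i \<in> sets std_cgauss"
  then have [measurable]: "\<And>i. i \<in> I \<Longrightarrow> A i \<in> sets borel" by simp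
  have m: "Pi\<^sub>E I A \<in> sets (lborel_PiM I)"
    by (rule sets_PiM_I_finite) (use I A in auto)
  have "emeasure ?D (Pi\<^sub>E I A)
      = (\<integral>\<^sup>+x. (\<Prod>i\<in>I. cgauss_density (x i) * indicator (A i) (x i)) \<partial>lborel_PiM I)"
  proof (subst emeasure_density)
    show "(\<lambda>x. \<Prod>i\<in>I. cgauss_density (x i)) \<in> borel_measurable (lborel_PiM I)"
      by measurable
    have "(indicator (Pi\<^sub>E I A) x :: ennreal) = (\<Prod>i\<in>I. indicator (A i) (x i))"
      if "x \<in> space (lborel_PiM I)" for x
      proof (cases "\<forall>i\<in>I. x i \<in> A i")
      case True
      then show ?thesis using that by (auto simp: space_PiM PiE_def)
    next
      case False
      then obtain j where "j \<in> I" "x j \<notin> A j" by auto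
      then have "(\<Prod>i\<in>I. indicator (A i) (x i) :: ennreal) = 0"
        by (intro prod_zero[OF I] bexI[of _ j]) auto
      then show ?thesis using False by (auto simp: PiE_def indicator_def)
    qed
    then show "(\<integral>\<^sup>+x. (\<Prod>i\<in>I. cgauss_density (x i)) * indicator (Pi\<^sub>E I A) x \<partial>lborel_PiM I)
      = (\<integral>\<^sup>+x. (\<Prod>i\<in>I. cgauss_density (x i) * indicator (A i) (x i)) \<partial>lborel_PiM I)"
      by (intro nn_integral_cong) (simp add: prod.distrib)
  qed (rule m)
  also have "\<dots> = (\<Prod>i\<in>I. \<integral>\<^sup>+z. cgauss_density z * indicator (A i) z \<partial>lborel)"
    by (rule lebesgue_product.product_nn_integral_prod[OF I]) measurable
  also have "\<dots> = (\<Prod>i\<in>I. emeasure std_cgauss (A i))"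
    unfolding std_cgauss_eq by (intro prod.cong refl) (simp add: emeasure_density)
  finally show "emeasure ?D (Pi\<^sub>E I A)
    = (\<Prod>i\<in>I. emeasure std_cgauss (A i))" .
qed

section \<open>Lebesgue measure on finite products under translations, reflections and linear
  maps\<close>

lemma distr_PiM_lborel:
  fixes T :: "'i \<Rightarrow> complex \<Rightarrow> complex"
  assumes I: "finite I" and T: "\<And>i. T i \<in> borel_measurable borel" "\<And>i. distr lborel borel (T i) = lborel"
  shows "distr (lborel_PiM I) (lborel_PiM I) (\<lambda>x. \<lambda>i\<in>I. T i (x i)) = lborel_PiM I"
proof (rule lebesgue_product.PiM_eqI[OF I])
  have [measurable]: "T i \<in> borel_measurable borel" for i by (rule T)
  fix A :: "'i \<Rightarrow> complex set" assume "\<And>i. i \<in> I \<Longrightarrow> A i \<in> sets lborel"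
  then have A: "\<And>i. i \<in> I \<Longrightarrow> A i \<in> sets borel" by simp
  have pre: "(\<lambda>x. \<lambda>i\<in>I. T i (x i)) -` (Pi\<^sub>E I A) \<inter> space (lborel_PiM I)
      = Pi\<^sub>E I (\<lambda>i. T i -` A i)"
    by (auto simp: space_PiM PiE_def Pi_def)
  have "emeasure (distr (lborel_PiM I) (lborel_PiM I) (\<lambda>x. \<lambda>i\<in>I. T i (x i))) (Pi\<^sub>E I A)
      = emeasure (lborel_PiM I) (Pi\<^sub>E I (\<lambda>i. T i -` A i))"
    using I A by (subst emeasure_distr) (auto simp: pre intro!: sets_PiM_I_finite)
  also have "\<dots> = (\<Prod>i\<in>I. emeasure lborel (T i -` A i))"
    using I A T(1) measurable_sets[OF T(1)]
    by (intro lebesgue_product.emeasure_PiM) auto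
  also have "\<dots> = (\<Prod>i\<in>I. emeasure lborel (A i))"
  proof (rule prod.cong)
    fix i assume "i \<in> I"
    have "emeasure lborel (A i) = emeasure (distr lborel borel (T i)) (A i)" by (simp add: T(2))
    also have "\<dots> = emeasure lborel (T i -` A i)"
      using A[OF \<open>i \<in> I\<close>] by (subst emeasure_distr) auto
    finally show "emeasure lborel (T i -` A i) = emeasure lborel (A i)" ..
  qed simp
  finally show "emeasure (distr (lborel_PiM I) (lborel_PiM I) (\<lambda>x. \<lambda>i\<in>I. T i (x i))) (Pi\<^sub>E I A)
    = (\<Prod>i\<in>I. emeasure lborel (A i))" .
qed simp

lemma lborel_distr_minus:
  fixes d :: "'a :: euclidean_space"
  shows "distr lborel borel ((-) d) = lborel"
  by (subst lborel_affine[of "-1" d]) (auto simp: density_1 one_ennreal_def[symmetric] cong: distr_cong)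

lemma nn_integral_PiM_lborel_map:
  fixes T :: "'i \<Rightarrow> complex \<Rightarrow> complex"
  assumes I: "finite I" and T: "\<And>i. T i \<in> borel_measurable borel" "\<And>i. distr lborel borel (T i) = lborel"
    and f: "f \<in> borel_measurable (lborel_PiM I)"
  shows "(\<integral>\<^sup>+x. f (\<lambda>i\<in>I. T i (x i)) \<partial>lborel_PiM I) = (\<integral>\<^sup>+x. f x \<partial>lborel_PiM I)"
proof -
  have [measurable]: "T i \<in> borel_measurable borel" for i by (rule T)
  have "(\<integral>\<^sup>+x. f (\<lambda>i\<in>I. T i (x i)) \<partial>lborel_PiM I)
      = (\<integral>\<^sup>+x. f x \<partial>distr (lborel_PiM I) (lborel_PiM I) (\<lambda>x. \<lambda>i\<in>I. T i (x i)))"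
  proof (rule nn_integral_distr[symmetric])
    show "(\<lambda>x. \<lambda>i\<in>I. T i (x i)) \<in> lborel_PiM I \<rightarrow>\<^sub>M lborel_PiM I"
      by (intro measurable_restrict) measurable
  qed (use f in simp)
  then show ?thesis unfolding distr_PiM_lborel[OF I T] .
qed

lemmas nn_integral_PiM_lborel_shift =
  nn_integral_PiM_lborel_map[where T = "\<lambda>i. (+) (c i)" for c, OF _ _ lborel_distr_plus, simplified]

lemmas nn_integral_PiM_lborel_reflect =
  nn_integral_PiM_lborel_map[where T = "\<lambda>i. (-) (c i)" for c, OF _ _ lborel_distr_minus, simplified]

text \<open>The uniqueness argument for Haar measure, applied to Lebesgue measure and its image under
  a surjective additive map; the Jacobian is eliminated by integrating a second function.\<close>

lemma nn_integral_PiM_lborel_linear: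
  fixes M :: "('i \<Rightarrow> complex) \<Rightarrow> 'i \<Rightarrow> complex"
  assumes I: "finite I"
    and M [measurable]: "M \<in> lborel_PiM I \<rightarrow>\<^sub>M lborel_PiM I"
    and diff: "\<And>x y. x \<in> extensional I \<Longrightarrow> y \<in> extensional I \<Longrightarrow>
      M (\<lambda>i\<in>I. x i - y i) = (\<lambda>i\<in>I. M x i - M y i)"
    and surj: "\<And>y. y \<in> extensional I \<Longrightarrow> \<exists>x\<in>extensional I. M x = y"
    and f [measurable]: "f \<in> borel_measurable (lborel_PiM I)"
    and g [measurable]: "g \<in> borel_measurable (lborel_PiM I)"
  shows "(\<integral>\<^sup>+x. f x \<partial>lborel_PiM I) * (\<integral>\<^sup>+b. g (M b) \<partial>lborel_PiM I)
    = (\<integral>\<^sup>+x. g x \<partial>lborel_PiM I) * (\<integral>\<^sup>+b. f (M b) \<partial>lborel_PiM I)"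
proof -
  let ?P = "lborel_PiM I"
  let ?p = "\<lambda>b x. \<lambda>i\<in>I. M b i + x i"
  let ?m = "\<lambda>b x. \<lambda>i\<in>I. x i - M b i"
  let ?n = "\<lambda>b x. \<lambda>i\<in>I. - M b i + x i"
  interpret P: sigma_finite_measure ?P by (rule lebesgue_product.sigma_finite[OF I])
  interpret PP: pair_sigma_finite ?P ?P by unfold_locales
  have sp: "space ?P = extensional I" by (auto simp: space_PiM PiE_def)
  have Mi [measurable]: "(\<lambda>b. M b i) \<in> borel_measurable ?P" if "i \<in> I" for i
    using measurable_compose[OF M measurable_component_singleton[OF that]] by simp
  have Mext: "M x \<in> extensional I" if "x \<in> extensional I" for x
    using measurable_space[OF M, of x] that by (simp add: sp)
  have add: "M (\<lambda>i\<in>I. x i + y i) = (\<lambda>i\<in>I. M x i + M y i)"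
    if xy: "x \<in> extensional I" "y \<in> extensional I" for x y
  proof -
    have "(\<lambda>i\<in>I. (\<lambda>i\<in>I. x i + y i) i - y i) = x"
      using xy by (auto simp: fun_eq_iff extensional_def)
    then have "M x = (\<lambda>i\<in>I. M (\<lambda>i\<in>I. x i + y i) i - M y i)"
      using diff[of "\<lambda>i\<in>I. x i + y i" y] xy by simp
    then show ?thesis
      using Mext[of "\<lambda>i\<in>I. x i + y i"] by (auto simp: fun_eq_iff extensional_def)
  qed
  \<comment> \<open>Surjectivity supplies \<open>c\<close> with \<open>M c = x\<close>, so
    translating \<open>b\<close> by \<open>c\<close> translates \<open>M b\<close> by
    \<open>x\<close>. This makes the next integral independent of \<open>x\<close>, although
    \<open>M\<close> has not been shown injective.\<close>
  have shift: "(\<integral>\<^sup>+b. g (M b) \<partial>?P) = (\<integral>\<^sup>+b. g (?p b x) \<partial>?P)"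
    if x: "x \<in> extensional I" for x
  proof -
    obtain c where c: "c \<in> extensional I" "M c = x" using surj[OF x] by auto
    have "(\<integral>\<^sup>+b. g (M b) \<partial>?P) = (\<integral>\<^sup>+b. g (M (\<lambda>i\<in>I. c i + b i)) \<partial>?P)"
      by (rule nn_integral_PiM_lborel_shift[OF I, symmetric]) measurable
    also have "\<dots> = (\<integral>\<^sup>+b. g (?p b x) \<partial>?P)"
      by (intro nn_integral_cong) (use c in \<open>simp add: sp add add.commute\<close>)
    finally show ?thesis .
  qed
  have reflect: "(\<integral>\<^sup>+b. f (M b) \<partial>?P) = (\<integral>\<^sup>+b. f (?m b x) \<partial>?P)"
    if x: "x \<in> extensional I" for x
  proof -
    obtain c where c: "c \<in> extensional I" "M c = x" using surj[OF x] by auto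
    have "(\<integral>\<^sup>+b. f (M b) \<partial>?P) = (\<integral>\<^sup>+b. f (M (\<lambda>i\<in>I. c i - b i)) \<partial>?P)"
      by (rule nn_integral_PiM_lborel_reflect[OF I, symmetric]) measurable
    also have "\<dots> = (\<integral>\<^sup>+b. f (?m b x) \<partial>?P)"
      by (intro nn_integral_cong) (use c in \<open>simp add: sp diff\<close>)
    finally show ?thesis .
  qed
  have "(\<integral>\<^sup>+x. f x \<partial>?P) * (\<integral>\<^sup>+b. g (M b) \<partial>?P) = (\<integral>\<^sup>+x. f x * (\<integral>\<^sup>+b. g (M b) \<partial>?P) \<partial>?P)"
    by (rule nn_integral_multc[symmetric]) measurable
  also have "\<dots> = (\<integral>\<^sup>+x. (\<integral>\<^sup>+b. f x * g (?p b x) \<partial>?P) \<partial>?P)"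
  proof (rule nn_integral_cong)
    fix x assume "x \<in> space ?P"
    then have x: "x \<in> extensional I" by (simp add: sp)
    have "(\<integral>\<^sup>+b. f x * g (?p b x) \<partial>?P)
        = f x * (\<integral>\<^sup>+b. g (?p b x) \<partial>?P)"
      by (rule nn_integral_cmult) measurable
    then show "f x * (\<integral>\<^sup>+b. g (M b) \<partial>?P) = (\<integral>\<^sup>+b. f x * g (?p b x) \<partial>?P)"
      by (simp add: shift[OF x])
  qed
  also have "\<dots> = (\<integral>\<^sup>+b. (\<integral>\<^sup>+x. f x * g (?p b x) \<partial>?P) \<partial>?P)"
    by (rule PP.Fubini'[symmetric]) measurable
  \<comment> \<open>For fixed \<open>b\<close> the variable \<open>x\<close> is translated by
    \<open>- M b\<close>, which moves the dependence on \<open>M b\<close> from \<open>g\<close> to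
    \<open>f\<close>; the reflection then frees the integral of \<open>f\<close> from
    \<open>x\<close>.\<close>
  also have "\<dots> = (\<integral>\<^sup>+b. (\<integral>\<^sup>+x. f (?m b x) * g x \<partial>?P) \<partial>?P)"
  proof (rule nn_integral_cong)
    fix b assume "b \<in> space ?P"
    have "(\<integral>\<^sup>+x. f x * g (?p b x) \<partial>?P)
        = (\<integral>\<^sup>+x. f (?n b x) * g (\<lambda>i\<in>I. M b i + (?n b x) i) \<partial>?P)"
      by (rule nn_integral_PiM_lborel_shift[OF I, symmetric]) measurable
    also have "\<dots> = (\<integral>\<^sup>+x. f (?m b x) * g x \<partial>?P)"
    proof (rule nn_integral_cong)
      fix x assume "x \<in> space ?P"
      then have "(\<lambda>i\<in>I. M b i + (?n b x) i) = x"
        by (auto simp: fun_eq_iff sp extensional_def)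
      then show "f (?n b x) * g (\<lambda>i\<in>I. M b i + (?n b x) i)
          = f (?m b x) * g x" by simp
    qed
    finally show "(\<integral>\<^sup>+x. f x * g (?p b x) \<partial>?P) = (\<integral>\<^sup>+x. f (?m b x) * g x \<partial>?P)" .
  qed
  also have "\<dots> = (\<integral>\<^sup>+x. (\<integral>\<^sup>+b. f (?m b x) * g x \<partial>?P) \<partial>?P)"
    by (rule PP.Fubini'[symmetric]) measurable
  also have "\<dots> = (\<integral>\<^sup>+x. (\<integral>\<^sup>+b. f (M b) \<partial>?P) * g x \<partial>?P)"
  proof (rule nn_integral_cong)
    fix x assume "x \<in> space ?P"
    then have x: "x \<in> extensional I" by (simp add: sp)
    have "(\<integral>\<^sup>+b. f (?m b x) * g x \<partial>?P)
        = (\<integral>\<^sup>+b. f (?m b x) \<partial>?P) * g x"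
      by (rule nn_integral_multc) measurable
    then show "(\<integral>\<^sup>+b. f (?m b x) * g x \<partial>?P) = (\<integral>\<^sup>+b. f (M b) \<partial>?P) * g x"
      by (simp add: reflect[OF x])
  qed
  also have "\<dots> = (\<integral>\<^sup>+x. g x \<partial>?P) * (\<integral>\<^sup>+b. f (M b) \<partial>?P)"
    by (subst nn_integral_cmult) (auto simp: mult.commute)
  finally show ?thesis .
qed


section \<open>Gaussian vectors under linear maps\<close>

lemma prod_cgauss_density:
  "(\<Prod>i\<in>I. cgauss_density (x i)) = ennreal (exp (- (\<Sum>i\<in>I. (cmod (x i))^2)) / pi ^ card I)"
proof (cases "finite I")
  case True
  then show ?thesis
    by (simp add: cgauss_density_def prod_ennreal prod_dividef exp_sum[symmetric] sum_negf)
qed (simp add: one_ennreal_def)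

lemma nn_integral_PiM_std_cgauss:
  assumes I: "finite I" and [measurable]: "f \<in> borel_measurable (PiM I (\<lambda>_. borel))"
  shows "(\<integral>\<^sup>+x. f x \<partial>gaussian_PiM I)
    = (\<integral>\<^sup>+x. (\<Prod>i\<in>I. cgauss_density (x i)) * f x \<partial>lborel_PiM I)"
proof -
  have [measurable]: "f \<in> borel_measurable (lborel_PiM I)"
    using assms(2) by (simp cong: measurable_cong_sets sets_PiM_cong)
  show ?thesis
    unfolding PiM_std_cgauss_density[OF I] by (rule nn_integral_density) measurable
qed

lemma emeasure_space_PiM_std_cgauss [simp]:
  "emeasure (gaussian_PiM I) (space (gaussian_PiM I)) = 1"
  by (intro prob_space.emeasure_space_1 prob_space_PiM prob_space_std_cgauss)

text \<open>The function \<open>h\<close> is the factor by which the Gaussian density at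
  \<open>M b\<close> must be multiplied to give the density at \<open>b\<close>. In
  \<open>nn_integral_PiM_lborel_linear\<close>, \<open>f\<close> and \<open>g\<close> are the
  density times \<open>h * F\<close> and times \<open>h\<close>. The integral of
  \<open>g (M b)\<close> is the total Gaussian mass 1, so the Jacobian becomes the integral of
  \<open>h\<close>.\<close>

lemma gaussian_linear_change:
  fixes M :: "('i \<Rightarrow> complex) \<Rightarrow> 'i \<Rightarrow> complex"
  assumes I: "finite I"
    and M: "M \<in> PiM I (\<lambda>_. borel) \<rightarrow>\<^sub>M PiM I (\<lambda>_. borel)"
    and diff: "\<And>x y. x \<in> extensional I \<Longrightarrow> y \<in> extensional I \<Longrightarrow>
      M (\<lambda>i\<in>I. x i - y i) = (\<lambda>i\<in>I. M x i - M y i)"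
    and surj: "\<And>y. y \<in> extensional I \<Longrightarrow> \<exists>x\<in>extensional I. M x = y"
    and h: "h \<in> borel_measurable (PiM I (\<lambda>_. borel))"
    and F: "F \<in> borel_measurable (PiM I (\<lambda>_. borel))"
    and density: "\<And>b. b \<in> extensional I \<Longrightarrow>
      (\<Prod>i\<in>I. cgauss_density (M b i)) * h (M b) = (\<Prod>i\<in>I. cgauss_density (b i))"
  shows "(\<integral>\<^sup>+a. h a * F a \<partial>gaussian_PiM I)
    = (\<integral>\<^sup>+a. h a \<partial>gaussian_PiM I) * (\<integral>\<^sup>+b. F (M b) \<partial>gaussian_PiM I)"
proof -
  let ?L = "lborel_PiM I"
  let ?d = "\<lambda>x. \<Prod>i\<in>I. cgauss_density (x i)"
  have sp: "space ?L = extensional I" by (auto simp: space_PiM PiE_def)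
  have [measurable]: "M \<in> ?L \<rightarrow>\<^sub>M ?L" "h \<in> borel_measurable ?L" "F \<in> borel_measurable ?L"
    using M h F by (simp_all cong: measurable_cong_sets sets_PiM_cong)
  note [measurable] = h F M
  have FM [measurable]: "(\<lambda>b. F (M b)) \<in> borel_measurable (PiM I (\<lambda>_. borel))" by measurable
  have 1: "(\<integral>\<^sup>+b. ?d (M b) * (h (M b) * F (M b)) \<partial>?L) = (\<integral>\<^sup>+b. F (M b) \<partial>gaussian_PiM I)"
    by (subst nn_integral_PiM_std_cgauss[OF I FM])
       (intro nn_integral_cong, simp add: sp density[symmetric] mult.assoc)
  have 2: "(\<integral>\<^sup>+b. ?d (M b) * h (M b) \<partial>?L) = 1"
  proof -
    have "(\<integral>\<^sup>+b. ?d (M b) * h (M b) \<partial>?L) = (\<integral>\<^sup>+b. ?d b * 1 \<partial>?L)"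
      by (intro nn_integral_cong) (simp add: sp density)
    also have "\<dots> = 1" by (subst nn_integral_PiM_std_cgauss[OF I, symmetric]) auto
    finally show ?thesis .
  qed
  have "(\<integral>\<^sup>+x. ?d x * (h x * F x) \<partial>?L) * (\<integral>\<^sup>+b. ?d (M b) * h (M b) \<partial>?L)
      = (\<integral>\<^sup>+x. ?d x * h x \<partial>?L) * (\<integral>\<^sup>+b. ?d (M b) * (h (M b) * F (M b)) \<partial>?L)"
    by (rule nn_integral_PiM_lborel_linear[OF I _ diff surj]) measurable
  then show ?thesis
    by (simp add: 1 2 nn_integral_PiM_std_cgauss[OF I])
qed

text \<open>Trades the component of \<open>b\<close> along \<open>q\<close> with the fresh coordinate \<open>k\<close>, which makes
  \<open>\<Sum>i\<in>I. q i * b i\<close> independent of the rest.\<close>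

lemma gaussian_swap:
  fixes q :: "'i \<Rightarrow> complex"
  assumes I: "finite I" "k \<notin> I" and s: "s > 0" "s^2 = (\<Sum>i\<in>I. (cmod (q i))^2)"
    and F: "F \<in> borel_measurable (PiM (insert k I) (\<lambda>_. borel))"
  defines "L \<equiv> \<lambda>b. (\<Sum>i\<in>I. q i * b i) / of_real s"
  defines "M \<equiv> \<lambda>b. \<lambda>i\<in>insert k I. if i = k then L b else b i + cnj (q i) / of_real s * (b k - L b)"
  shows "(\<integral>\<^sup>+b. F b \<partial>gaussian_PiM (insert k I)) = (\<integral>\<^sup>+b. F (M b) \<partial>gaussian_PiM (insert k I))"
proof -
  have qq: "(\<Sum>i\<in>I. q i * cnj (q i)) = of_real (s^2)"
    unfolding s(2) by (simp add: complex_norm_square[symmetric] mult.commute)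
  have Lk: "M b k = L b" for b by (simp add: M_def)
  have MI: "M b i = b i + cnj (q i) / of_real s * (b k - L b)" if "i \<in> I" for b i
    using that I by (auto simp: M_def)
  have LM: "L (M b) = b k" for b
  proof -
    have "(\<Sum>i\<in>I. q i * M b i) = (\<Sum>i\<in>I. q i * b i + q i * cnj (q i) * ((b k - L b) / of_real s))"
      by (intro sum.cong) (auto simp: MI algebra_simps)
    also have "\<dots> = of_real s * L b + of_real (s^2) * ((b k - L b) / of_real s)"
      unfolding sum.distrib sum_distrib_right[symmetric] qq using s(1) by (simp add: L_def)
    also have "\<dots> = of_real s * b k"
      using s(1) by (simp add: field_simps power2_eq_square)
    finally show ?thesis using s(1) by (simp add: L_def)
  qed
  \<comment> \<open>\<open>M\<close> exchanges \<open>b k\<close> with \<open>L b\<close> and is its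
    own inverse, which gives surjectivity. Together with \<open>norm\<close> below, the change of
    variables holds with \<open>h = 1\<close>.\<close>
  have MM: "M (M b) = b" if "b \<in> extensional (insert k I)" for b
  proof
    fix i
    consider "i = k" | "i \<in> I" "i \<noteq> k" | "i \<notin> insert k I" by blast
    then show "M (M b) i = b i"
    proof cases
      case 1 then show ?thesis by (simp add: Lk LM)
    next
      case 2 then show ?thesis by (simp add: MI LM Lk) (simp add: algebra_simps diff_divide_distrib)
    next
      case 3 then show ?thesis using that by (simp add: M_def extensional_def)
    qed
  qed
  have norm: "(\<Sum>i\<in>insert k I. (cmod (M b i))^2) = (\<Sum>i\<in>insert k I. (cmod (b i))^2)" for b
  proof -
    define e where "e = (b k - L b) / of_real s"
    have sq: "(cmod (x + y))^2 = (cmod x)^2 + 2 * Re (x * cnj y) + (cmod y)^2" for x y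
      unfolding cmod_power2 by (simp add: power2_eq_square algebra_simps)
    have "(\<Sum>i\<in>I. (cmod (M b i))^2)
        = (\<Sum>i\<in>I. (cmod (b i))^2 + 2 * Re (q i * b i * cnj e) + (cmod (q i))^2 * (cmod e)^2)"
    proof (rule sum.cong)
      fix i assume "i \<in> I"
      then have "M b i = b i + cnj (q i) * e" by (simp add: MI e_def)
      then show "(cmod (M b i))^2 = (cmod (b i))^2 + 2 * Re (q i * b i * cnj e) + (cmod (q i))^2 * (cmod e)^2"
        by (simp only: sq norm_mult complex_mod_cnj power_mult_distrib complex_cnj_mult complex_cnj_cnj ac_simps)
    qed simp
    also have "\<dots> = (\<Sum>i\<in>I. (cmod (b i))^2) + 2 * Re (of_real s * L b * cnj e) + s^2 * (cmod e)^2"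
    proof -
      have "(\<Sum>i\<in>I. Re (q i * b i * cnj e)) = Re (of_real s * L b * cnj e)"
        using s(1) by (simp only: Re_sum[symmetric] sum_distrib_right[symmetric]) (simp add: L_def)
      then show ?thesis
        by (simp only: sum.distrib s(2) sum_distrib_right[symmetric] sum_distrib_left[symmetric])
    qed
    also have "\<dots> = (\<Sum>i\<in>I. (cmod (b i))^2) + 2 * Re (L b * cnj (b k - L b)) + (cmod (b k - L b))^2"
      using s(1) by (simp add: e_def norm_divide power_divide)
    finally have "(cmod (L b))^2 + (\<Sum>i\<in>I. (cmod (M b i))^2)
        = (\<Sum>i\<in>I. (cmod (b i))^2) + (cmod (L b + (b k - L b)))^2"
      by (simp only: sq[of "L b" "b k - L b"])
    then show ?thesis using I by (simp add: Lk)
  qed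
  have ext: "M b \<in> extensional (insert k I)" for b by (simp add: M_def)
  have "(\<integral>\<^sup>+b. 1 * F b \<partial>gaussian_PiM (insert k I))
      = (\<integral>\<^sup>+b. 1 \<partial>gaussian_PiM (insert k I)) * (\<integral>\<^sup>+b. F (M b) \<partial>gaussian_PiM (insert k I))"
  proof (rule gaussian_linear_change)
    show "M \<in> PiM (insert k I) (\<lambda>_. borel) \<rightarrow>\<^sub>M PiM (insert k I) (\<lambda>_. borel)"
      unfolding M_def L_def by (intro measurable_restrict) measurable
    show "M (\<lambda>i\<in>insert k I. x i - y i) = (\<lambda>i\<in>insert k I. M x i - M y i)" for x y
    proof -
      have "L (\<lambda>i\<in>insert k I. x i - y i) = L x - L y"
        by (simp add: L_def sum_subtractf algebra_simps diff_divide_distrib)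
      then have "M (\<lambda>i\<in>insert k I. x i - y i) i = (\<lambda>i\<in>insert k I. M x i - M y i) i" for i
        by (cases "i = k"; cases "i \<in> I") (simp_all add: M_def ring_distribs diff_divide_distrib add_divide_distrib)
      then show ?thesis ..
    qed
    show "\<exists>x\<in>extensional (insert k I). M x = y" if "y \<in> extensional (insert k I)" for y
      using MM[OF that] ext by blast
    show "(\<Prod>i\<in>insert k I. cgauss_density (M b i)) * 1 = (\<Prod>i\<in>insert k I. cgauss_density (b i))" for b
      by (simp only: prod_cgauss_density norm mult_1_right)
  qed (use I F in auto)
  then show ?thesis by simp
qed

lemma cgauss_second_moment:
  "(\<integral>\<^sup>+z. ennreal ((cmod (r * z + c))^2) \<partial>std_cgauss) = ennreal ((cmod r)^2 + (cmod c)^2)"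
proof -
  let ?J = "\<lambda>r. \<integral>\<^sup>+z. ennreal ((cmod (r * z + c))^2) \<partial>std_cgauss"
  have m: "(\<integral>\<^sup>+z. ennreal ((cmod z)^2) \<partial>std_cgauss) = 1"
    using cgauss_moment_exp[of 0 1] by simp
  have neg: "?J (- r) = ?J r"
  proof -
    have "?J r = (\<integral>\<^sup>+z. cgauss_density z * ennreal ((cmod (r * z + c))^2) \<partial>distr lborel borel ((-) 0))"
      unfolding std_cgauss_eq by (simp add: nn_integral_density lborel_distr_minus)
    also have "\<dots> = ?J (- r)"
      unfolding std_cgauss_eq by (simp add: nn_integral_density nn_integral_distr cgauss_density_def)
    finally show ?thesis ..
  qed
  have "2 * ?J r = ?J r + ?J (- r)" by (subst neg) (rule mult_2)
  also have "\<dots> = (\<integral>\<^sup>+z. ennreal ((cmod (r * z + c))^2) + ennreal ((cmod (- r * z + c))^2) \<partial>std_cgauss)"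
    by (rule nn_integral_add[symmetric]) measurable
  also have "\<dots> = (\<integral>\<^sup>+z. ennreal (2 * (cmod r)^2) * ennreal ((cmod z)^2) + ennreal (2 * (cmod c)^2) \<partial>std_cgauss)"
  proof (rule nn_integral_cong)
    fix z
    have "(cmod (r * z + c))^2 + (cmod (- r * z + c))^2 = 2 * (cmod r)^2 * (cmod z)^2 + 2 * (cmod c)^2"
      unfolding cmod_power2 by (simp add: power2_eq_square algebra_simps)
    then show "ennreal ((cmod (r * z + c))^2) + ennreal ((cmod (- r * z + c))^2)
        = ennreal (2 * (cmod r)^2) * ennreal ((cmod z)^2) + ennreal (2 * (cmod c)^2)"
      by (simp flip: ennreal_plus ennreal_mult)
  qed
  also have "\<dots> = ennreal (2 * (cmod r)^2) + ennreal (2 * (cmod c)^2)"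
    using std_cgauss.emeasure_space_1 by (simp add: nn_integral_add nn_integral_cmult m)
  also have "\<dots> = 2 * ennreal ((cmod r)^2 + (cmod c)^2)"
    by (simp add: ennreal_mult[symmetric] ennreal_plus[symmetric] del: ennreal_plus
        flip: ennreal_numeral)
  finally show ?thesis
    by (simp only: ennreal_mult_cancel_left) simp
qed

lemma gaussian_second_moment:
  fixes r :: "'i \<Rightarrow> complex"
  assumes "finite I"
  shows "(\<integral>\<^sup>+b. ennreal ((cmod ((\<Sum>i\<in>I. r i * b i) + c))^2) \<partial>gaussian_PiM I)
    = ennreal ((\<Sum>i\<in>I. (cmod (r i))^2) + (cmod c)^2)"
  using assms
proof (induction I arbitrary: c)
  case empty
  then show ?case by (simp add: nn_integral_empty)
next
  case (insert k I)
  have "(\<integral>\<^sup>+b. ennreal ((cmod ((\<Sum>i\<in>insert k I. r i * b i) + c))^2) \<partial>gaussian_PiM (insert k I))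
      = (\<integral>\<^sup>+b. (\<integral>\<^sup>+y. ennreal ((cmod ((\<Sum>i\<in>insert k I. r i * (b(k := y)) i) + c))^2) \<partial>std_cgauss)
          \<partial>gaussian_PiM I)"
    using insert.hyps by (intro gauss_product.product_nn_integral_insert) (auto, measurable)
  also have "\<dots> = (\<integral>\<^sup>+b. ennreal ((cmod (r k))^2) + ennreal ((cmod ((\<Sum>i\<in>I. r i * b i) + c))^2) \<partial>gaussian_PiM I)"
  proof (rule nn_integral_cong)
    fix b :: "'i \<Rightarrow> complex"
    have *: "(\<Sum>i\<in>insert k I. r i * (b(k := y)) i) + c = r k * y + ((\<Sum>i\<in>I. r i * b i) + c)" for y
    proof -
      have "(\<Sum>i\<in>I. r i * (b(k := y)) i) = (\<Sum>i\<in>I. r i * b i)"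
        using insert.hyps by (intro sum.cong) auto
      then show ?thesis using insert.hyps by simp
    qed
    show "(\<integral>\<^sup>+y. ennreal ((cmod ((\<Sum>i\<in>insert k I. r i * (b(k := y)) i) + c))^2) \<partial>std_cgauss)
        = ennreal ((cmod (r k))^2) + ennreal ((cmod ((\<Sum>i\<in>I. r i * b i) + c))^2)"
      unfolding * by (simp add: cgauss_second_moment)
  qed
  also have "\<dots> = ennreal ((cmod (r k))^2) + ennreal ((\<Sum>i\<in>I. (cmod (r i))^2) + (cmod c)^2)"
    by (subst nn_integral_add) (auto simp: insert.IH)
  finally show ?case
    using insert.hyps by (simp add: ennreal_plus[symmetric] sum_nonneg add.assoc del: ennreal_plus)
qed

text \<open>Linear regression of one functional on another. \<open>A\<close> is the covariance of
  the \<open>p\<close>-functional with the normalized \<open>q\<close>-functional \<open>g\<close>;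
  the residual is independent of \<open>g\<close> and has variance
  \<open>(\<Sum>i\<in>I. (cmod (p i))^2) - (cmod A)^2\<close>.\<close>

lemma gaussian_two_functionals:
  fixes p q :: "'i \<Rightarrow> complex"
  assumes I: "finite I" "k \<notin> I" and s: "s > 0" "s^2 = (\<Sum>i\<in>I. (cmod (q i))^2)"
    and h [measurable]: "h \<in> borel_measurable borel"
  defines "A \<equiv> (\<Sum>i\<in>I. p i * cnj (q i)) / of_real s"
  shows "(\<integral>\<^sup>+b. ennreal ((cmod ((\<Sum>i\<in>I. p i * b i) + c))^2) * h (\<Sum>i\<in>I. q i * b i) \<partial>gaussian_PiM I)
    = (\<integral>\<^sup>+g. ennreal ((\<Sum>i\<in>I. (cmod (p i))^2) - (cmod A)^2 + (cmod (A * g + c))^2) * h (of_real s * g)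
        \<partial>std_cgauss)"
proof -
  define f where "f b = ennreal ((cmod ((\<Sum>i\<in>I. p i * b i) + c))^2) * h (\<Sum>i\<in>I. q i * b i)" for b
  define L where "L b = (\<Sum>i\<in>I. q i * b i) / of_real s" for b
  define M where "M b = (\<lambda>i\<in>insert k I. if i = k then L b else b i + cnj (q i) / of_real s * (b k - L b))" for b
  define r where "r i = p i - A * q i / of_real s" for i
  have fk: "f (b(k := y)) = f b" for b y
  proof -
    have "(\<Sum>i\<in>I. u i * (b(k := y)) i) = (\<Sum>i\<in>I. u i * b i)" for u :: "'i \<Rightarrow> complex"
      using I by (intro sum.cong) auto
    then show ?thesis by (simp only: f_def)
  qed
  have fm [measurable]: "f \<in> borel_measurable (PiM I (\<lambda>_. borel))"
    "f \<in> borel_measurable (PiM (insert k I) (\<lambda>_. borel))"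
    unfolding f_def by measurable
  have fm' [measurable]: "f \<in> borel_measurable (gaussian_PiM I)"
    "f \<in> borel_measurable (gaussian_PiM (insert k I))"
    using fm by (simp_all cong: measurable_cong_sets sets_PiM_cong)
  have rnorm: "(\<Sum>i\<in>I. (cmod (r i))^2) = (\<Sum>i\<in>I. (cmod (p i))^2) - (cmod A)^2"
  proof -
    have "(\<Sum>i\<in>I. (cmod (r i))^2) = (\<Sum>i\<in>I. (cmod (p i))^2 - 2 * Re (p i * cnj (q i) * cnj A / of_real s)
        + (cmod (q i))^2 * ((cmod A)^2 / s^2))"
    proof (rule sum.cong)
      fix i assume "i \<in> I"
      have sq: "(cmod (x - y))^2 = (cmod x)^2 - 2 * Re (x * cnj y) + (cmod y)^2" for x y
        unfolding cmod_power2 by (simp add: power2_eq_square algebra_simps)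
      show "(cmod (r i))^2 = (cmod (p i))^2 - 2 * Re (p i * cnj (q i) * cnj A / of_real s)
        + (cmod (q i))^2 * ((cmod A)^2 / s^2)"
        unfolding r_def sq by (simp add: norm_mult norm_divide power_mult_distrib power_divide ac_simps)
    qed simp
    also have "\<dots> = (\<Sum>i\<in>I. (cmod (p i))^2) - 2 * Re (of_real s * A * cnj A / of_real s) + s^2 * ((cmod A)^2 / s^2)"
    proof -
      have "(\<Sum>i\<in>I. Re (p i * cnj (q i) * cnj A / of_real s)) = Re (of_real s * A * cnj A / of_real s)"
        using s(1) by (simp only: Re_sum[symmetric] sum_distrib_right[symmetric] sum_divide_distrib[symmetric])
          (simp add: A_def)
      then show ?thesis
        by (simp only: sum.distrib sum_subtractf s(2) sum_distrib_right[symmetric] sum_distrib_left[symmetric])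
    qed
    also have "Re (of_real s * A * cnj A / of_real s) = (cmod A)^2"
      using s(1) unfolding cmod_power2 by (simp add: power2_eq_square)
    finally show ?thesis using s(1) by simp
  qed
  have fM: "f (M (b(k := y))) = ennreal ((cmod ((\<Sum>i\<in>I. r i * b i) + (A * y + c)))^2) * h (of_real s * y)" for b y
  proof -
    have L: "L (b(k := y)) = L b"
      unfolding L_def using I by (intro arg_cong2[where f="(/)"] sum.cong) auto
    have Mi: "M (b(k := y)) i = b i + cnj (q i) / of_real s * (y - L b)" if "i \<in> I" for i
      using that I by (auto simp: M_def L)
    have "(\<Sum>i\<in>I. u i * M (b(k := y)) i)
        = (\<Sum>i\<in>I. u i * b i) + (\<Sum>i\<in>I. u i * cnj (q i)) / of_real s * (y - L b)" for u :: "'i \<Rightarrow> complex"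
      unfolding sum_divide_distrib sum_distrib_right sum.distrib[symmetric]
      by (intro sum.cong) (auto simp: Mi algebra_simps)
    note e = this
    have "(\<Sum>i\<in>I. q i * cnj (q i)) = of_real (s^2)"
      unfolding s(2) by (simp add: complex_norm_square[symmetric] mult.commute)
    then have 1: "(\<Sum>i\<in>I. q i * M (b(k := y)) i) = of_real s * y"
      unfolding e using s(1) by (simp add: L_def field_simps power2_eq_square)
    have "(\<Sum>i\<in>I. r i * b i) = (\<Sum>i\<in>I. p i * b i) - A * L b"
      unfolding L_def r_def sum_divide_distrib sum_distrib_left sum_subtractf[symmetric]
      by (intro sum.cong) (auto simp: algebra_simps)
    then have 2: "(\<Sum>i\<in>I. p i * M (b(k := y)) i) = (\<Sum>i\<in>I. r i * b i) + A * y"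
      unfolding e A_def[symmetric] by (simp add: algebra_simps)
    show ?thesis unfolding f_def 1 2 by (simp only: add.assoc)
  qed
  \<comment> \<open>A coordinate \<open>k\<close> on which \<open>f\<close> does not depend is
    adjoined. After the swap the \<open>q\<close>-functional is \<open>s\<close> times this single
    coordinate \<open>y\<close>, and only the coefficients \<open>r\<close> of the residual meet the
    other coordinates.\<close>
  have "(\<integral>\<^sup>+b. f b \<partial>gaussian_PiM I) = (\<integral>\<^sup>+b. (\<integral>\<^sup>+y. f (b(k := y)) \<partial>std_cgauss) \<partial>gaussian_PiM I)"
    using std_cgauss.emeasure_space_1 by (simp add: fk)
  also have "\<dots> = (\<integral>\<^sup>+b. f b \<partial>gaussian_PiM (insert k I))"
    using I by (intro gauss_product.product_nn_integral_insert[symmetric]) auto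
  also have "\<dots> = (\<integral>\<^sup>+b. f (M b) \<partial>gaussian_PiM (insert k I))"
    unfolding M_def L_def by (rule gaussian_swap) (use I s in auto)
  also have "\<dots> = (\<integral>\<^sup>+y. (\<integral>\<^sup>+b. f (M (b(k := y))) \<partial>gaussian_PiM I) \<partial>std_cgauss)"
  proof (rule gauss_product.product_nn_integral_insert_rev)
    have "M \<in> PiM (insert k I) (\<lambda>_. borel) \<rightarrow>\<^sub>M PiM (insert k I) (\<lambda>_. borel)"
      unfolding M_def L_def by (intro measurable_restrict) measurable
    from measurable_compose[OF this fm(2)]
    show "(\<lambda>x. f (M x)) \<in> borel_measurable (gaussian_PiM (insert k I))"
      by (simp cong: measurable_cong_sets sets_PiM_cong)
  qed (use I in auto)
  also have "\<dots> = (\<integral>\<^sup>+y. ennreal ((\<Sum>i\<in>I. (cmod (r i))^2) + (cmod (A * y + c))^2) * h (of_real s * y) \<partial>std_cgauss)"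
  proof (rule nn_integral_cong)
    fix y
    have "(\<integral>\<^sup>+b. f (M (b(k := y))) \<partial>gaussian_PiM I)
        = (\<integral>\<^sup>+b. ennreal ((cmod ((\<Sum>i\<in>I. r i * b i) + (A * y + c)))^2) \<partial>gaussian_PiM I) * h (of_real s * y)"
      unfolding fM by (rule nn_integral_multc) measurable
    then show "(\<integral>\<^sup>+b. f (M (b(k := y))) \<partial>gaussian_PiM I)
        = ennreal ((\<Sum>i\<in>I. (cmod (r i))^2) + (cmod (A * y + c))^2) * h (of_real s * y)"
      by (simp only: gaussian_second_moment[OF I(1)])
  qed
  finally show ?thesis
    by (simp only: f_def rnorm)
qed

lemma gaussian_functional:
  fixes q :: "'i \<Rightarrow> complex"
  assumes I: "finite I" "k \<notin> I" and s: "s \<ge> 0" "s^2 = (\<Sum>i\<in>I. (cmod (q i))^2)"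
    and h [measurable]: "h \<in> borel_measurable borel"
  shows "(\<integral>\<^sup>+b. h (\<Sum>i\<in>I. q i * b i) \<partial>gaussian_PiM I) = (\<integral>\<^sup>+g. h (of_real s * g) \<partial>std_cgauss)"
proof (cases "s = 0")
  case True
  then have "\<And>i. i \<in> I \<Longrightarrow> q i = 0"
    using s(2) I(1) by (simp add: sum_nonneg_eq_0_iff)
  then show ?thesis using True std_cgauss.emeasure_space_1 by simp
next
  case False
  then show ?thesis
    using gaussian_two_functionals[OF I _ s(2) h, of "\<lambda>_. 0" 1] s(1) by simp
qed

section \<open>Rotations of the sphere\<close>

text \<open>The Bombieri-Weyl weights. Their squares are binomial coefficients, so the covariance
  kernel of the random polynomial is a power of \<open>1 + z * cnj w\<close> and rotations act
  unitarily.\<close>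

definition bw_weight :: "nat \<Rightarrow> nat \<Rightarrow> complex" where
  "bw_weight N n = complex_of_real (sqrt (real (N choose n)))"

lemma bw_weight_nonzero [simp]: "n \<le> N \<Longrightarrow> bw_weight N n \<noteq> 0"
  by (simp add: bw_weight_def)

lemma bw_weight_squared: "bw_weight N n * bw_weight N n = of_nat (N choose n)"
  by (simp add: bw_weight_def flip: of_real_mult)

lemma cnj_bw_weight [simp]: "cnj (bw_weight N n) = bw_weight N n"
  by (simp add: bw_weight_def)

lemma elliptic_poly_eq: "elliptic_poly N a = coeff_vector_poly N (\<lambda>n. a n * bw_weight N n)"
  by (simp add: elliptic_poly_def coeff_vector_poly_def bw_weight_def)

lemma poly_coeff_vector_poly: "poly (coeff_vector_poly N a) (x :: complex) = (\<Sum>n\<le>N. a n * x ^ n)"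
  by (simp add: coeff_vector_poly_def poly_sum poly_monom)

lemma poly_elliptic_poly: "poly (elliptic_poly N a) x = (\<Sum>n\<le>N. a n * bw_weight N n * x ^ n)"
  by (simp add: elliptic_poly_eq poly_coeff_vector_poly)

lemma coeff_elliptic_poly_top: "coeff (elliptic_poly N a) N = a N"
  by (simp add: elliptic_poly_eq coeff_coeff_vector_poly bw_weight_def)

lemma degree_elliptic_poly_le: "degree (elliptic_poly N a) \<le> N"
  by (rule degree_le) (simp add: elliptic_poly_eq coeff_coeff_vector_poly)

lemma degree_elliptic_poly: "a N \<noteq> 0 \<Longrightarrow> degree (elliptic_poly N a) = N"
  using degree_elliptic_poly_le[of N a] le_degree[of "elliptic_poly N a" N]
  by (simp add: coeff_elliptic_poly_top)

text \<open>Lets identities between rotated polynomials be checked away from the pole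
  \<open>1 + cnj w * v = 0\<close> of the Moebius map.\<close>

lemma poly_eqI_cofinite:
  fixes p q :: "complex poly"
  assumes "finite S" "\<And>x. x \<notin> S \<Longrightarrow> poly p x = poly q x"
  shows "p = q"
proof (rule ccontr)
  assume "p \<noteq> q"
  then have "finite {x. poly (p - q) x = 0}" by (intro poly_roots_finite) simp
  moreover have "- S \<subseteq> {x. poly (p - q) x = 0}" using assms(2) by auto
  ultimately have "finite (- S)" by (rule rev_finite_subset)
  with assms(1) have "finite (UNIV :: complex set)" by (metis finite_compl infinite_UNIV_char_0)
  then show False using infinite_UNIV_char_0 by blast
qed

lemma coeff_vector_poly_inject:
  assumes "coeff_vector_poly N a = coeff_vector_poly N b" "n \<le> N"
  shows "a n = b n"
  using arg_cong[OF assms(1), of "\<lambda>p. coeff p n"] assms(2) by (simp add: coeff_coeff_vector_poly)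

lemma poly_eq_sum_le:
  fixes p :: "complex poly"
  assumes "degree p \<le> N"
  shows "poly p x = (\<Sum>m\<le>N. coeff p m * x ^ m)"
  using poly_as_sum_of_monoms'[OF assms] by (metis (no_types, lifting) poly_sum poly_monom sum.cong)

text \<open>The normalization that makes the rotation an involution; its square is the factor
  \<open>(1 + w * cnj w) ^ N\<close> produced by applying the substitution twice.\<close>

definition moebius_factor :: "nat \<Rightarrow> complex \<Rightarrow> complex" where
  "moebius_factor N w = of_real (sqrt (1 + (cmod w)^2) ^ N)"

lemma one_plus_cmod_pos: "1 + (cmod w)^2 > 0"
  by (simp add: add_pos_nonneg)

lemma moebius_factor_nonzero [simp]: "moebius_factor N w \<noteq> 0"
  using one_plus_cmod_pos[of w] by (simp add: moebius_factor_def)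

lemma cnj_moebius_factor [simp]: "cnj (moebius_factor N w) = moebius_factor N w"
  by (simp add: moebius_factor_def)

lemma moebius_factor_squared:
  "moebius_factor N w * moebius_factor N w = (1 + w * cnj w) ^ N"
proof -
  have "moebius_factor N w * moebius_factor N w = of_real ((sqrt (1 + (cmod w)^2) * sqrt (1 + (cmod w)^2)) ^ N)"
    by (simp add: moebius_factor_def flip: of_real_mult power_mult_distrib)
  also have "\<dots> = (1 + of_real ((cmod w)^2)) ^ N"
    using one_plus_cmod_pos[of w] by simp
  finally show ?thesis by (simp add: complex_norm_square del: of_real_power)
qed

text \<open>The matrix, in the orthonormal monomials \<open>bw_weight N n * z ^ n\<close>, of the rotation of the
  sphere by the angle \<open>pi\<close> that exchanges \<open>0\<close> and \<open>w\<close>, that is, of the substitution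
  \<open>v \<mapsto> (w - v) / (1 + cnj w * v)\<close>.\<close>

definition moebius_matrix :: "nat \<Rightarrow> complex \<Rightarrow> nat \<Rightarrow> nat \<Rightarrow> complex" where
  "moebius_matrix N w m n = coeff ([:w, -1:] ^ n * [:1, cnj w:] ^ (N - n)) m
     * bw_weight N n / (bw_weight N m * moebius_factor N w)"

definition moebius :: "nat \<Rightarrow> complex \<Rightarrow> (nat \<Rightarrow> complex) \<Rightarrow> nat \<Rightarrow> complex" where
  "moebius N w a m = (\<Sum>n\<le>N. moebius_matrix N w m n * a n)"

lemma degree_moebius_le:
  assumes "n \<le> N"
  shows "degree ([:w, -1:] ^ n * [:1, cnj w:] ^ (N - n)) \<le> N"
proof -
  have "degree ([:w, -1:] ^ n * [:1, cnj w:] ^ (N - n)) \<le> degree ([:w, -1:] ^ n) + degree ([:1, cnj w:] ^ (N - n))"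
    by (rule degree_mult_le)
  also have "\<dots> \<le> degree [:w, -1:] * n + degree [:1, cnj w:] * (N - n)"
    by (intro add_mono degree_power_le)
  also have "\<dots> \<le> 1 * n + 1 * (N - n)" by (intro add_mono mult_mono) auto
  finally show ?thesis using assms by simp
qed

lemma moebius_matrix_column:
  assumes "n \<le> N"
  shows "(\<Sum>m\<le>N. moebius_matrix N w m n * bw_weight N m * v ^ m)
    = bw_weight N n * (w - v) ^ n * (1 + cnj w * v) ^ (N - n) / moebius_factor N w"
proof -
  let ?p = "[:w, -1:] ^ n * [:1, cnj w:] ^ (N - n)"
  have "(\<Sum>m\<le>N. moebius_matrix N w m n * bw_weight N m * v ^ m)
      = (\<Sum>m\<le>N. coeff ?p m * v ^ m) * (bw_weight N n / moebius_factor N w)"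
    unfolding sum_distrib_right by (intro sum.cong) (auto simp: moebius_matrix_def)
  also have "(\<Sum>m\<le>N. coeff ?p m * v ^ m) = poly ?p v"
    by (rule poly_eq_sum_le[OF degree_moebius_le[OF assms], symmetric])
  finally show ?thesis by (simp add: poly_power mult_ac)
qed

text \<open>The two weights multiply to \<open>N choose m\<close>, so the sum along a row is one
  coefficient of the binomial expansion of \<open>(u * (w - X) + (1 + cnj w * X)) ^ N\<close>, the
  power of a linear polynomial in \<open>X\<close>.\<close>

lemma moebius_matrix_row:
  assumes "n \<le> N"
  shows "(\<Sum>m\<le>N. moebius_matrix N w n m * bw_weight N m * u ^ m)
    = bw_weight N n * (cnj w - u) ^ n * (1 + u * w) ^ (N - n) / moebius_factor N w"
proof -
  have "(\<Sum>m\<le>N. moebius_matrix N w n m * bw_weight N m * u ^ m)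
      = (\<Sum>m\<le>N. of_nat (N choose m) * u ^ m * coeff ([:w, -1:] ^ m * [:1, cnj w:] ^ (N - m)) n)
        / (bw_weight N n * moebius_factor N w)"
    unfolding sum_divide_distrib
    by (intro sum.cong) (auto simp: moebius_matrix_def bw_weight_squared[symmetric])
  also have "(\<Sum>m\<le>N. of_nat (N choose m) * u ^ m * coeff ([:w, -1:] ^ m * [:1, cnj w:] ^ (N - m)) n)
      = coeff (\<Sum>m\<le>N. of_nat (N choose m) * smult u [:w, -1:] ^ m * [:1, cnj w:] ^ (N - m)) n"
    unfolding coeff_sum
  proof (rule sum.cong)
    fix m
    have "of_nat (N choose m) * smult u [:w, -1:] ^ m * [:1, cnj w:] ^ (N - m)
        = smult (of_nat (N choose m) * u ^ m) ([:w, -1:] ^ m * [:1, cnj w:] ^ (N - m))"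
      by (simp add: smult_power of_nat_poly mult.commute del: smult_pCons)
    then show "of_nat (N choose m) * u ^ m * coeff ([:w, -1:] ^ m * [:1, cnj w:] ^ (N - m)) n
        = coeff (of_nat (N choose m) * smult u [:w, -1:] ^ m * [:1, cnj w:] ^ (N - m)) n"
      by (simp only: coeff_smult)
  qed simp
  also have "\<dots> = coeff ((smult u [:w, -1:] + [:1, cnj w:]) ^ N) n"
    by (simp only: binomial_ring)
  also have "smult u [:w, -1:] + [:1, cnj w:] = [:1 + u * w, cnj w - u:]" by simp
  also have "coeff ([:1 + u * w, cnj w - u:] ^ N) n
      = of_nat (N choose n) * (cnj w - u) ^ n * (1 + u * w) ^ (N - n)"
    using assms by (rule coeff_linear_poly_power)
  finally show ?thesis
    using assms by (simp add: bw_weight_squared[symmetric])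
qed

text \<open>Column \<open>n\<close> and the conjugate of row \<open>n\<close> have the same
  generating polynomial.\<close>

lemma moebius_matrix_hermitian:
  assumes "m \<le> N" "n \<le> N"
  shows "moebius_matrix N w m n = cnj (moebius_matrix N w n m)"
proof -
  have "coeff_vector_poly N (\<lambda>m. moebius_matrix N w m n * bw_weight N m)
      = coeff_vector_poly N (\<lambda>m. cnj (moebius_matrix N w n m) * bw_weight N m)"
  proof (rule poly_eqI_cofinite[of "{}"])
    fix v :: complex
    have "(\<Sum>m\<le>N. cnj (moebius_matrix N w n m) * bw_weight N m * v ^ m)
        = cnj (\<Sum>m\<le>N. moebius_matrix N w n m * bw_weight N m * cnj v ^ m)" by simp
    then show "poly (coeff_vector_poly N (\<lambda>m. moebius_matrix N w m n * bw_weight N m)) v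
        = poly (coeff_vector_poly N (\<lambda>m. cnj (moebius_matrix N w n m) * bw_weight N m)) v"
      unfolding poly_coeff_vector_poly moebius_matrix_column[OF assms(2)] moebius_matrix_row[OF assms(2)]
      by (simp add: mult.commute)
  qed simp
  from coeff_vector_poly_inject[OF this assms(1)] show ?thesis using assms(1) by simp
qed

lemma poly_elliptic_moebius:
  "poly (elliptic_poly N (moebius N w a)) v
    = (\<Sum>n\<le>N. a n * bw_weight N n * (w - v) ^ n * (1 + cnj w * v) ^ (N - n)) / moebius_factor N w"
proof -
  have "poly (elliptic_poly N (moebius N w a)) v
      = (\<Sum>m\<le>N. \<Sum>n\<le>N. moebius_matrix N w m n * a n * bw_weight N m * v ^ m)"
    by (simp add: poly_elliptic_poly moebius_def sum_distrib_right)
  also have "\<dots> = (\<Sum>n\<le>N. a n * (\<Sum>m\<le>N. moebius_matrix N w m n * bw_weight N m * v ^ m))"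
    by (subst sum.swap) (simp add: sum_distrib_left mult_ac)
  also have "\<dots> = (\<Sum>n\<le>N. a n * bw_weight N n * (w - v) ^ n * (1 + cnj w * v) ^ (N - n)) / moebius_factor N w"
    unfolding sum_divide_distrib by (intro sum.cong) (auto simp: moebius_matrix_column)
  finally show ?thesis .
qed

lemma poly_elliptic_moebius_quotient:
  assumes "1 + cnj w * v \<noteq> 0"
  shows "poly (elliptic_poly N (moebius N w a)) v
    = (1 + cnj w * v) ^ N * poly (elliptic_poly N a) ((w - v) / (1 + cnj w * v)) / moebius_factor N w"
proof -
  have "(1 + cnj w * v) ^ N * (a n * bw_weight N n * ((w - v) / (1 + cnj w * v)) ^ n)
      = a n * bw_weight N n * (w - v) ^ n * (1 + cnj w * v) ^ (N - n)" if "n \<le> N" for n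
    using assms that power_add[of "1 + cnj w * v" n "N - n"] by (simp add: power_divide field_simps)
  then have "(1 + cnj w * v) ^ N * poly (elliptic_poly N a) ((w - v) / (1 + cnj w * v))
      = (\<Sum>n\<le>N. a n * bw_weight N n * (w - v) ^ n * (1 + cnj w * v) ^ (N - n))"
    unfolding poly_elliptic_poly sum_distrib_left by (intro sum.cong) auto
  then show ?thesis by (simp only: poly_elliptic_moebius)
qed

text \<open>With \<open>u\<close> the image of \<open>v\<close>, both \<open>w - u\<close> and
  \<open>1 + cnj w * u\<close> are multiples of \<open>(1 + w * cnj w) / (1 + cnj w * v)\<close>, by
  the factors \<open>v\<close> and 1. Hence all terms of degree \<open>N\<close> acquire the same
  power, which the normalization cancels.\<close>

lemma moebius_involution:
  assumes "n \<le> N"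
  shows "moebius N w (moebius N w a) n = a n"
proof -
  have ne: "1 + w * cnj w \<noteq> 0"
    using moebius_factor_squared[of 1 w] moebius_factor_nonzero[of 1 w] by (metis mult_eq_0_iff power_one_right)
  have "elliptic_poly N (moebius N w (moebius N w a)) = elliptic_poly N a"
  proof (rule poly_eqI_cofinite)
    show "finite {v. poly [:1, cnj w:] v = 0}" by (rule poly_roots_finite) simp
    fix v assume "v \<notin> {v. poly [:1, cnj w:] v = 0}"
    then have v: "1 + cnj w * v \<noteq> 0" by (simp add: mult.commute)
    define u where "u = (w - v) / (1 + cnj w * v)"
    have 1: "w - u = v * (1 + w * cnj w) / (1 + cnj w * v)"
      using v by (simp add: u_def field_simps)
    have 2: "1 + cnj w * u = (1 + w * cnj w) / (1 + cnj w * v)"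
      using v by (simp add: u_def field_simps)
    have 3: "(w - u) ^ n * (1 + cnj w * u) ^ (N - n) = v ^ n * ((1 + w * cnj w) / (1 + cnj w * v)) ^ N"
      if "n \<le> N" for n
    proof -
      have "(w - u) ^ n * (1 + cnj w * u) ^ (N - n)
          = v ^ n * (((1 + w * cnj w) / (1 + cnj w * v)) ^ n * ((1 + w * cnj w) / (1 + cnj w * v)) ^ (N - n))"
        unfolding 1 2 by (simp add: power_mult_distrib power_divide mult_ac)
      then show ?thesis using that by (simp flip: power_add)
    qed
    have "poly (elliptic_poly N (moebius N w (moebius N w a))) v
        = (1 + cnj w * v) ^ N * ((\<Sum>n\<le>N. a n * bw_weight N n * ((w - u) ^ n * (1 + cnj w * u) ^ (N - n)))
            / moebius_factor N w) / moebius_factor N w"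
      by (simp only: poly_elliptic_moebius_quotient[OF v, folded u_def]) (simp only: poly_elliptic_moebius mult.assoc)
    also have "\<dots> = (1 + cnj w * v) ^ N * (\<Sum>n\<le>N. a n * bw_weight N n * (v ^ n * ((1 + w * cnj w) / (1 + cnj w * v)) ^ N))
            / (moebius_factor N w * moebius_factor N w)"
    proof -
      have "(\<Sum>n\<le>N. a n * bw_weight N n * ((w - u) ^ n * (1 + cnj w * u) ^ (N - n)))
          = (\<Sum>n\<le>N. a n * bw_weight N n * (v ^ n * ((1 + w * cnj w) / (1 + cnj w * v)) ^ N))"
        by (intro sum.cong) (auto simp: 3)
      then show ?thesis by simp
    qed
    also have "\<dots> = (\<Sum>n\<le>N. a n * bw_weight N n * v ^ n)"
      using v ne unfolding moebius_factor_squared sum_distrib_left sum_divide_distrib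
      by (intro sum.cong) (auto simp: power_divide)
    finally show "poly (elliptic_poly N (moebius N w (moebius N w a))) v = poly (elliptic_poly N a) v"
      by (simp add: poly_elliptic_poly)
  qed
  from coeff_vector_poly_inject[OF this[unfolded elliptic_poly_eq] assms] show ?thesis
    using assms by simp
qed

text \<open>A Hermitian involution is unitary: the inner product of \<open>M a\<close> with itself
  is that of \<open>a\<close> with \<open>M (M a) = a\<close>.\<close>

lemma moebius_norm: "(\<Sum>m\<le>N. (cmod (moebius N w a m))^2) = (\<Sum>m\<le>N. (cmod (a m))^2)"
proof -
  have cnj: "cnj (moebius_matrix N w m n) = moebius_matrix N w n m" if "m \<le> N" "n \<le> N" for m n
    using moebius_matrix_hermitian[OF that(2,1)] by simp
  have "complex_of_real (\<Sum>m\<le>N. (cmod (moebius N w a m))^2)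
      = (\<Sum>m\<le>N. \<Sum>n\<le>N. moebius_matrix N w m n * a n * cnj (moebius N w a m))"
    by (simp only: of_real_sum complex_norm_square) (simp add: moebius_def sum_distrib_right)
  also have "\<dots> = (\<Sum>n\<le>N. a n * cnj (\<Sum>m\<le>N. cnj (moebius_matrix N w m n) * moebius N w a m))"
    by (subst sum.swap) (simp add: sum_distrib_left mult_ac)
  also have "\<dots> = (\<Sum>n\<le>N. a n * cnj (moebius N w (moebius N w a) n))"
    unfolding moebius_def[of N w "moebius N w a"]
    by (intro sum.cong refl arg_cong2[where f="(*)"] arg_cong[where f=cnj])
       (auto simp: cnj)
  also have "\<dots> = complex_of_real (\<Sum>m\<le>N. (cmod (a m))^2)"
    by (simp only: of_real_sum complex_norm_square) (simp add: moebius_involution)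
  finally show ?thesis by (simp only: of_real_eq_iff)
qed

text \<open>With \<open>a 0 = 0\<close> a factor \<open>w - v\<close> splits off, and at
  \<open>v = w\<close> only the term \<open>n = 1\<close> of the cofactor survives. So the
  derivative at the root depends on the single coefficient \<open>a 1\<close>.\<close>

lemma elliptic_moebius_at_center:
  assumes "a 0 = 0" "N \<ge> 1"
  shows "poly (elliptic_poly N (moebius N w a)) w = 0"
    and "(cmod (poly (pderiv (elliptic_poly N (moebius N w a))) w))^2
      = N * (cmod (a 1))^2 * (1 + (cmod w)^2) ^ N / (1 + (cmod w)^2)^2"
proof -
  let ?P = "elliptic_poly N (moebius N w a)"
  let ?S = "\<lambda>v. \<Sum>n\<in>{1..N}. a n * bw_weight N n * (w - v) ^ (n - 1) * (1 + cnj w * v) ^ (N - n)"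
  define Q where "Q = smult (1 / moebius_factor N w)
    (\<Sum>n\<in>{1..N}. smult (a n * bw_weight N n) ([:w, -1:] ^ (n - 1) * [:1, cnj w:] ^ (N - n)))"
  have eq: "?P = [:w, -1:] * Q"
  proof (rule poly_eqI_cofinite[of "{}"])
    fix v
    have split: "{..N} = insert 0 {1..N}" by auto
    have "(\<Sum>n\<le>N. a n * bw_weight N n * (w - v) ^ n * (1 + cnj w * v) ^ (N - n))
        = (\<Sum>n\<in>{1..N}. a n * bw_weight N n * (w - v) ^ n * (1 + cnj w * v) ^ (N - n))"
      unfolding split using assms by simp
    also have "\<dots> = (\<Sum>n\<in>{1..N}. (w - v) * (a n * bw_weight N n * (w - v) ^ (n - 1) * (1 + cnj w * v) ^ (N - n)))"
    proof (rule sum.cong)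
      fix n assume "n \<in> {1..N}"
      then have "(w - v) ^ n = (w - v) * (w - v) ^ (n - 1)" by (cases n) auto
      then show "a n * bw_weight N n * (w - v) ^ n * (1 + cnj w * v) ^ (N - n)
          = (w - v) * (a n * bw_weight N n * (w - v) ^ (n - 1) * (1 + cnj w * v) ^ (N - n))"
        by (simp add: mult_ac)
    qed simp
    also have "\<dots> = (w - v) * ?S v"
      by (simp only: sum_distrib_left)
    finally have "poly (?P) v
        = (w - v) * ?S v / moebius_factor N w"
      by (simp only: poly_elliptic_moebius)
    moreover have "poly Q v = ?S v / moebius_factor N w"
      by (simp add: Q_def poly_sum poly_power mult_ac)
    ultimately show "poly (?P) v = poly ([:w, -1:] * Q) v"
      by (simp add: left_diff_distrib diff_divide_distrib)
  qed simp
  show "poly (?P) w = 0" unfolding eq by simp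
  have "poly (pderiv (?P)) w = - poly Q w"
    unfolding eq pderiv_mult by (simp add: pderiv_pCons)
  also have "poly Q w = a 1 * bw_weight N 1 * (1 + w * cnj w) ^ (N - 1) / moebius_factor N w"
  proof -
    have "(\<Sum>n\<in>{1..N}. a n * bw_weight N n * (0 ^ (n - 1) * (1 + w * cnj w) ^ (N - n)))
        = (\<Sum>n\<in>{1}. a n * bw_weight N n * (0 ^ (n - 1) * (1 + w * cnj w) ^ (N - n)))"
      using assms(2) by (intro sum.mono_neutral_right) auto
    then show ?thesis by (simp add: Q_def poly_sum poly_power mult_ac)
  qed
  finally have d: "poly (pderiv (?P)) w
      = - (a 1 * bw_weight N 1 * (1 + w * cnj w) ^ (N - 1) / moebius_factor N w)" .
  have c1: "cmod (1 + w * cnj w) = 1 + (cmod w)^2"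
  proof -
    have "1 + w * cnj w = of_real (1 + (cmod w)^2)" by (simp add: complex_norm_square del: of_real_power)
    then show ?thesis using one_plus_cmod_pos[of w] by (simp only: norm_of_real abs_of_pos)
  qed
  have c2: "(cmod (moebius_factor N w))^2 = (1 + (cmod w)^2) ^ N"
  proof -
    have "(cmod (moebius_factor N w))^2 = cmod (moebius_factor N w * moebius_factor N w)"
      by (simp only: norm_mult power2_eq_square)
    then show ?thesis by (simp only: moebius_factor_squared norm_power c1)
  qed
  have c3: "(cmod (bw_weight N 1))^2 = N"
    by (simp add: bw_weight_def)
  let ?x = "1 + (cmod w)^2"
  have x: "?x > 0" by (rule one_plus_cmod_pos)
  have "(cmod (poly (pderiv (?P)) w))^2
      = (cmod (a 1))^2 * N * ((?x ^ (N - 1))^2 / ?x ^ N)"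
    unfolding d by (simp only: norm_minus_cancel norm_mult norm_divide power_mult_distrib power_divide
        norm_power c1 c2 c3 times_divide_eq_right)
  also have "(?x ^ (N - 1))^2 / ?x ^ N = ?x ^ N / ?x^2"
  proof -
    have "(y ^ (N - 1))^2 / y ^ N = y ^ N / y^2" if "y > 0" for y :: real
      using assms(2) that by (cases N) (simp_all add: power2_eq_square)
    then show ?thesis using x .
  qed
  finally show "(cmod (poly (pderiv (?P)) w))^2
      = N * (cmod (a 1))^2 * ?x ^ N / ?x^2" by (simp only: mult_ac times_divide_eq_right)
qed

lemma measurable_coeff_mult:
  fixes p q :: "'a \<Rightarrow> complex poly"
  assumes "\<And>m. (\<lambda>w. coeff (p w) m) \<in> borel_measurable M" "\<And>m. (\<lambda>w. coeff (q w) m) \<in> borel_measurable M"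
  shows "(\<lambda>w. coeff (p w * q w) m) \<in> borel_measurable M"
  unfolding coeff_mult using assms by (intro borel_measurable_sum borel_measurable_times)

lemma measurable_coeff_power:
  fixes p :: "'a \<Rightarrow> complex poly"
  assumes "\<And>m. (\<lambda>w. coeff (p w) m) \<in> borel_measurable M"
  shows "(\<lambda>w. coeff (p w ^ n) m) \<in> borel_measurable M"
proof (induction n arbitrary: m)
  case (Suc n)
  then show ?case unfolding power_Suc by (intro measurable_coeff_mult assms)
qed simp

lemma moebius_matrix_measurable [measurable]:
  "(\<lambda>w. moebius_matrix N w m n) \<in> borel_measurable borel"
proof -
  have 1: "coeff [:x, y:] k = (if k = 0 then x else if k = 1 then y else 0)" for x y :: complex and k
    by (auto simp: coeff_pCons split: nat.split)
  have cnj: "cnj \<in> borel_measurable borel"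
    by (intro borel_measurable_continuous_onI continuous_intros)
  have 2: "(\<lambda>w::complex. coeff [:w, -1:] k) \<in> borel_measurable borel"
    "(\<lambda>w. coeff [:1, cnj w:] k) \<in> borel_measurable borel" for k
    unfolding 1 using cnj by auto
  have [measurable]: "(\<lambda>w. coeff ([:w, -1:] ^ n * [:1, cnj w:] ^ (N - n)) m) \<in> borel_measurable borel"
    by (intro measurable_coeff_mult measurable_coeff_power 2)
  show ?thesis unfolding moebius_matrix_def moebius_factor_def by measurable
qed


section \<open>Chordal discs and the roots of rotated polynomials\<close>

lemma chordal_dist_le_iff:
  assumes "t \<ge> 0"
  shows "dist (stereo w) (stereo z) \<le> t
    \<longleftrightarrow> 4 * (cmod (w - z))^2 \<le> t^2 * ((cmod (w - z))^2 + (cmod (1 + z * cnj w))^2)"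
proof -
  define W where "W = 1 + (cmod w)^2"
  define Z where "Z = 1 + (cmod z)^2"
  have pos: "W > 0" "Z > 0" unfolding W_def Z_def by (rule one_plus_cmod_pos)+
  obtain a b c d where w: "w = Complex a b" and z: "z = Complex c d"
    by (cases w; cases z) blast
  have W: "W = 1 + a^2 + b^2" and Z: "Z = 1 + c^2 + d^2"
    unfolding W_def Z_def w z cmod_power2 by simp_all
  \<comment> \<open>This identity clears the denominators of the chordal distance. The division-free
    criterion also covers antipodal points, where \<open>1 + z * cnj w = 0\<close>.\<close>
  have prod: "(cmod (w - z))^2 + (cmod (1 + z * cnj w))^2 = W * Z"
    unfolding W Z w z cmod_power2 by (simp add: power2_eq_square algebra_simps)
  have "(dist (stereo w) (stereo z))^2
      = (2 * a / W - 2 * c / Z)^2 + ((2 * b / W - 2 * d / Z)^2 + ((W - 2) / W - (Z - 2) / Z)^2)"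
    unfolding stereo_def dist_prod_def dist_real_def
    by (simp add: W_def[symmetric] Z_def[symmetric])
       (simp add: w z W_def Z_def)
  also have "\<dots> = ((2 * a * Z - 2 * c * W)^2 + (2 * b * Z - 2 * d * W)^2 + (2 * (W - Z))^2) / (W * Z)^2"
    using pos by (simp add: field_simps power2_eq_square)
  also have "(2 * a * Z - 2 * c * W)^2 + (2 * b * Z - 2 * d * W)^2 + (2 * (W - Z))^2
      = 4 * (cmod (w - z))^2 * (W * Z)"
    unfolding W Z w z cmod_power2 by (simp add: power2_eq_square algebra_simps)
  also have "4 * (cmod (w - z))^2 * (W * Z) / (W * Z)^2 = 4 * (cmod (w - z))^2 / (W * Z)"
    using pos by (simp add: power2_eq_square)
  finally have d: "(dist (stereo w) (stereo z))^2 = 4 * (cmod (w - z))^2 / (W * Z)" .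
  have "dist (stereo w) (stereo z) \<le> t \<longleftrightarrow> (dist (stereo w) (stereo z))^2 \<le> t^2"
    using assms by (simp add: power2_le_iff_abs_le)
  also have "\<dots> \<longleftrightarrow> 4 * (cmod (w - z))^2 \<le> t^2 * (W * Z)"
    unfolding d using pos by (simp add: pos_divide_le_eq)
  finally show ?thesis by (simp only: prod)
qed

lemma proots_linear_nonconst:
  fixes \<alpha> \<beta> :: complex
  assumes "\<beta> \<noteq> 0"
  shows "proots [:\<alpha>, \<beta>:] = {#- \<alpha> / \<beta>#}"
proof -
  have "[:\<alpha>, \<beta>:] = smult \<beta> [:\<alpha> / \<beta>, 1:]" using assms by simp
  then show ?thesis using assms by (simp del: smult_pCons)
qed

lemma size_filter_proots_prod_mset:
  fixes f :: "'a \<Rightarrow> complex poly"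
  assumes "\<And>x. x \<in># A \<Longrightarrow> f x \<noteq> 0"
  shows "size (filter_mset Q (proots (\<Prod>x\<in>#A. f x))) = (\<Sum>x\<in>#A. size (filter_mset Q (proots (f x))))"
  using assms
proof (induction A)
  case (add x A)
  have "(\<Prod>x\<in>#A. f x) \<noteq> 0" using add.prems by (auto simp: prod_mset_zero_iff)
  then show ?case using add by (simp add: proots_mult)
qed simp

text \<open>The rotation turns the linear factor of a root \<open>z\<close> into \<open>f z\<close>,
  whose root is the rotated point. If \<open>z\<close> is antipodal to \<open>w\<close>, then
  \<open>f z\<close> is constant and the root escapes to infinity; this leaves the count unchanged
  because antipodes have distance \<open>2 > t\<close>. The threshold comes from solving
  \<open>2 * cmod u / sqrt (1 + (cmod u)^2) \<le> t\<close> for \<open>(cmod u)^2\<close>.\<close>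

lemma size_filter_proots_moebius:
  assumes a: "a N \<noteq> 0" and t: "0 \<le> t" "t < 2"
  shows "size (filter_mset (\<lambda>z. dist (stereo w) (stereo z) \<le> t) (proots (elliptic_poly N a)))
    = size (filter_mset (\<lambda>u. (cmod u)^2 \<le> t^2 / (4 - t^2)) (proots (elliptic_poly N (moebius N w a))))"
proof -
  let ?P = "elliptic_poly N a"
  have t2: "4 - t^2 > 0" using t power_strict_mono[of t 2 2] by simp
  note lc = coeff_elliptic_poly_top[of N a]
  note deg = degree_elliptic_poly[where a = a, OF a]
  have P0: "?P \<noteq> 0" using lc a by auto
  obtain A where A: "size A = N" "?P = smult (a N) (\<Prod>z\<in>#A. [:-z, 1:])"
    using alg_closed_imp_factorization[OF P0] unfolding deg lc by blast
  have proots: "proots ?P = A"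
  proof -
    have "proots (\<Prod>z\<in>#B. [:-z, 1:]) = B" for B :: "complex multiset"
    proof (induction B)
      case (add x B)
      have "(\<Prod>z\<in>#B. [:-z, 1:]) \<noteq> 0" by (auto simp: prod_mset_zero_iff)
      then have "proots ([:-x, 1:] * (\<Prod>z\<in>#B. [:-z, 1:])) = add_mset x B"
        using add by (subst proots_mult) auto
      then show ?case by (simp del: mult_pCons_left)
    qed simp
    then show ?thesis using a by (subst A(2)) simp
  qed
  define f where "f z = [:w - z, - (1 + z * cnj w):]" for z
  have fnz: "f z \<noteq> 0" for z
  proof
    assume "f z = 0"
    then have "w = z" "- 1 = z * cnj w" by (auto simp: f_def)
    then have "1 + w * cnj w = 0" by (metis add.right_inverse)
    then have "complex_of_real (1 + (cmod w)^2) = 0" by (simp add: complex_norm_square del: of_real_power)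
    then show False using one_plus_cmod_pos[of w] by (simp only: of_real_eq_0_iff)
  qed
  have Q: "elliptic_poly N (moebius N w a) = smult (a N / moebius_factor N w) (\<Prod>z\<in>#A. f z)"
  proof (rule poly_eqI_cofinite)
    show "finite {v. poly [:1, cnj w:] v = 0}" by (rule poly_roots_finite) simp
    fix v assume "v \<notin> {v. poly [:1, cnj w:] v = 0}"
    then have v: "1 + cnj w * v \<noteq> 0" by (simp add: mult.commute)
    have "(1 + cnj w * v) ^ size B * (\<Prod>z\<in>#B. (w - v) / (1 + cnj w * v) - z) = (\<Prod>z\<in>#B. poly (f z) v)" for B
    proof (induction B)
      case (add z B)
      have "(1 + cnj w * v) * ((w - v) / (1 + cnj w * v) - z) = poly (f z) v"
        using v by (simp add: f_def field_simps)
      then show ?case using add by (simp flip: add.IH)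
    qed simp
    from this[of A] have e: "(1 + cnj w * v) ^ N * (\<Prod>z\<in>#A. (w - v) / (1 + cnj w * v) - z) = (\<Prod>z\<in>#A. poly (f z) v)"
      unfolding A(1) .
    have "poly ?P u = a N * (\<Prod>z\<in>#A. u - z)" for u
      by (subst A(2)) (simp add: poly_prod_mset image_mset.compositionality o_def)
    then have "poly (elliptic_poly N (moebius N w a)) v
        = a N / moebius_factor N w * (\<Prod>z\<in>#A. poly (f z) v)"
      by (simp add: poly_elliptic_moebius_quotient[OF v] flip: e)
    then show "poly (elliptic_poly N (moebius N w a)) v
        = poly (smult (a N / moebius_factor N w) (\<Prod>z\<in>#A. f z)) v"
      by (simp add: poly_prod_mset image_mset.compositionality o_def)
  qed
  have one: "size (filter_mset (\<lambda>u. (cmod u)^2 \<le> t^2 / (4 - t^2)) (proots (f z)))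
      = (if dist (stereo w) (stereo z) \<le> t then 1 else 0)" for z
  proof (cases "1 + z * cnj w = 0")
    case True
    have "w \<noteq> z" using fnz[of z] True by (auto simp: f_def)
    then have "t^2 * (cmod (w - z))^2 < 4 * (cmod (w - z))^2" using t2 by (intro mult_strict_right_mono) auto
    then show ?thesis using True t by (simp add: f_def chordal_dist_le_iff)
  next
    case False
    then have pos: "(cmod (1 + z * cnj w))^2 > 0" by simp
    define u where "u = - (w - z) / - (1 + z * cnj w)"
    have u: "proots (f z) = {#u#}"
      unfolding f_def u_def using False by (intro proots_linear_nonconst) (simp only: neg_equal_0_iff_equal not_False_eq_True)
    have nu: "(cmod u)^2 = (cmod (w - z))^2 / (cmod (1 + z * cnj w))^2"
      unfolding u_def by (simp only: norm_divide norm_minus_cancel power_divide)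
    have "x / y \<le> t^2 / (4 - t^2) \<longleftrightarrow> 4 * x \<le> t^2 * (x + y)" if "y > 0" for x y
      using t2 that by (simp add: field_simps)
    from this[OF pos, of "(cmod (w - z))^2"]
    have "(cmod u)^2 \<le> t^2 / (4 - t^2) \<longleftrightarrow> dist (stereo w) (stereo z) \<le> t"
      unfolding chordal_dist_le_iff[OF t(1)] nu .
    then show ?thesis by (simp add: u)
  qed
  have "size (filter_mset (\<lambda>u. (cmod u)^2 \<le> t^2 / (4 - t^2)) (proots (elliptic_poly N (moebius N w a))))
      = (\<Sum>z\<in>#A. if dist (stereo w) (stereo z) \<le> t then 1 else 0)"
    unfolding Q using a by (simp add: size_filter_proots_prod_mset fnz one)
  also have "\<dots> = size (filter_mset (\<lambda>z. dist (stereo w) (stereo z) \<le> t) A)"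
    by (induction A) auto
  finally show ?thesis unfolding proots ..
qed

section \<open>Summing over the roots\<close>

text \<open>Outside \<open>I\<close> the coordinate has the constant value \<open>undefined\<close>,
  so no membership of \<open>i\<close> has to be assumed.\<close>

lemma borel_measurable_PiM_component:
  fixes M :: "'b::topological_space measure"
  assumes "sets M = sets borel"
  shows "(\<lambda>x. x i) \<in> borel_measurable (PiM I (\<lambda>_. M))"
proof (cases "i \<in> I")
  case True
  then have "(\<lambda>x. x i) \<in> PiM I (\<lambda>_. M) \<rightarrow>\<^sub>M M" by simp
  then show ?thesis using assms by (simp cong: measurable_cong_sets)
next
  case False
  then have "(\<lambda>x. x i) \<in> borel_measurable (PiM I (\<lambda>_. M)) \<longleftrightarrow> (\<lambda>_. undefined :: 'b) \<in> borel_measurable (PiM I (\<lambda>_. M))"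
    by (intro measurable_cong) (auto simp: space_PiM PiE_def extensional_def)
  then show ?thesis by simp
qed

lemma measurable_fun_upd_const:
  fixes I :: "nat set"
  shows "(\<lambda>b. b(j := c)) \<in> borel_measurable (gaussian_PiM I)"
proof (rule measurable_coordinatewise_then_product)
  fix i
  show "(\<lambda>b. (b(j := c)) i) \<in> borel_measurable (gaussian_PiM I)"
    by (cases "i = j") (simp_all add: borel_measurable_PiM_component)
qed

lemma measurable_cmod_component:
  "(\<lambda>b. ennreal ((cmod (b i))^2)) \<in> borel_measurable (gaussian_PiM I)"
  using measurable_compose[OF borel_measurable_PiM_component[OF sets_std_cgauss], of "\<lambda>z. ennreal ((cmod z)^2)" borel i I]
  by simp

lemma pderiv_sum: "pderiv (sum f A) = (\<Sum>i\<in>A. pderiv (f i))"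
  by (induction A rule: infinite_finite_induct) (auto simp: pderiv_add)

definition nonconstant_part :: "nat \<Rightarrow> (nat \<Rightarrow> complex) \<Rightarrow> complex poly" where
  "nonconstant_part N a = elliptic_poly N (a(0 := 0))"

lemma bw_weight_0 [simp]: "bw_weight N 0 = 1"
  by (simp add: bw_weight_def)

lemma poly_nonconstant_part:
  "poly (nonconstant_part N a) w = (\<Sum>n\<in>{1..N}. bw_weight N n * w ^ n * a n)"
proof -
  have split: "{..N} = insert 0 {1..N}" by auto
  show ?thesis
    unfolding nonconstant_part_def poly_elliptic_poly split by (simp add: mult_ac)
qed

lemma elliptic_poly_fun_upd: "elliptic_poly N (a(0 := y)) = nonconstant_part N a + [:y:]"
  by (rule poly_eqI)
     (auto simp: nonconstant_part_def elliptic_poly_eq coeff_coeff_vector_poly coeff_pCons split: nat.split)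

lemma poly_pderiv_nonconstant_part:
  "poly (pderiv (nonconstant_part N a)) w = (\<Sum>n\<in>{1..N}. bw_weight N n * of_nat n * w ^ (n - 1) * a n)"
proof -
  have split: "{..N} = insert 0 {1..N}" by auto
  show ?thesis
    unfolding nonconstant_part_def elliptic_poly_eq coeff_vector_poly_def pderiv_sum split
    by (simp add: pderiv_monom poly_sum poly_monom mult_ac)
qed

lemma pderiv_nonconstant_part_nonzero:
  assumes "N \<ge> 1" "a N \<noteq> 0"
  shows "pderiv (nonconstant_part N a) \<noteq> 0"
proof
  assume "pderiv (nonconstant_part N a) = 0"
  then have "degree (nonconstant_part N a) = 0" by (simp add: pderiv_eq_0_iff)
  moreover have "N \<le> degree (nonconstant_part N a)"
    using assms by (intro le_degree)
      (simp add: nonconstant_part_def elliptic_poly_eq coeff_coeff_vector_poly)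
  ultimately show False using assms(1) by simp
qed

lemma moebius_cong:
  "(\<And>n. n \<le> N \<Longrightarrow> a n = b n) \<Longrightarrow> moebius N w a m = moebius N w b m"
  unfolding moebius_def by (intro sum.cong) auto

lemma elliptic_poly_cong:
  "(\<And>n. n \<le> N \<Longrightarrow> a n = b n) \<Longrightarrow> elliptic_poly N a = elliptic_poly N b"
  unfolding elliptic_poly_def by (intro sum.cong) auto

text \<open>The summand 1 belongs to the constant coefficient; the right-hand side is the full
  variance of the random polynomial at \<open>w\<close>.\<close>

lemma one_plus_weights:
  "1 + (\<Sum>n\<in>{1..N}. (cmod (bw_weight N n * w ^ n))^2) = (1 + (cmod w)^2) ^ N"
proof -
  have split: "{..N} = insert 0 {1..N}" by auto
  have "(cmod (bw_weight N n * w ^ n))^2 = real (N choose n) * ((cmod w)^2) ^ n" for n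
    by (simp add: bw_weight_def norm_mult norm_power power_mult_distrib flip: power_mult)
       (simp add: mult.commute)
  then have "1 + (\<Sum>n\<in>{1..N}. (cmod (bw_weight N n * w ^ n))^2)
      = (\<Sum>n\<le>N. real (N choose n) * ((cmod w)^2) ^ n)"
    unfolding split by simp
  also have "\<dots> = ((cmod w)^2 + 1) ^ N" by (simp add: binomial_ring)
  finally show ?thesis by (simp add: add.commute)
qed

text \<open>The law of the coefficients conditioned on \<open>P w = 0\<close>, with the constant coefficient
  eliminated: rotating \<open>w\<close> to the origin turns the condition into \<open>b 0 = 0\<close>.\<close>

lemma gaussian_conditioned_on_root:
  fixes C :: "(nat \<Rightarrow> complex) \<Rightarrow> ennreal"
  assumes N: "N \<ge> 1" and C [measurable]: "C \<in> borel_measurable borel"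
    and C_cong: "\<And>a b. (\<And>n. n \<le> N \<Longrightarrow> a n = b n) \<Longrightarrow> C a = C b"
  shows "(\<integral>\<^sup>+a. ennreal (exp (- (cmod (poly (nonconstant_part N a) w))\<^sup>2))
        * (C (moebius N w (a(0 := - poly (nonconstant_part N a) w)))
          * ennreal ((cmod (poly (pderiv (nonconstant_part N a)) w))^2)) \<partial>gaussian_PiM {1..N})
    = ennreal (real N / (1 + (cmod w)^2)^2)
        * (\<integral>\<^sup>+b. ennreal ((cmod (b 1))^2) * C (b(0 := 0)) \<partial>gaussian_PiM {1..N})"
proof -
  let ?I = "{1..N}"
  let ?x = "1 + (cmod w)^2"
  have x: "?x > 0" by (rule one_plus_cmod_pos)
  define M where "M b = (\<lambda>i\<in>?I. moebius N w (b(0 := 0)) i)" for b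
  let ?u = "\<lambda>b. (M b)(0 := - poly (nonconstant_part N (M b)) w)"
  define h where "h a = ennreal (exp (- (cmod (poly (nonconstant_part N a) w))\<^sup>2))" for a
  define F where "F a = C (moebius N w (a(0 := - poly (nonconstant_part N a) w)))
          * ennreal ((cmod (poly (pderiv (nonconstant_part N a)) w))^2)" for a
  have split: "{..N} = insert 0 ?I" by auto
  have root: "poly (elliptic_poly N a) w = 0 \<longleftrightarrow> moebius N w a 0 = 0" for a
  proof -
    define b where "b = moebius N w a"
    have "elliptic_poly N a = elliptic_poly N (moebius N w b)"
      unfolding b_def by (rule elliptic_poly_cong) (simp add: moebius_involution)
    then have "poly (elliptic_poly N a) w
        = (\<Sum>n\<le>N. b n * bw_weight N n * 0 ^ n * (1 + cnj w * w) ^ (N - n)) / moebius_factor N w"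
      by (simp add: poly_elliptic_moebius)
    also have "(\<Sum>n\<le>N. b n * bw_weight N n * 0 ^ n * (1 + cnj w * w) ^ (N - n)) = b 0 * (1 + cnj w * w) ^ N"
    proof -
      have "(\<Sum>n\<in>?I. b n * bw_weight N n * 0 ^ n * (1 + cnj w * w) ^ (N - n)) = 0"
        by (intro sum.neutral) auto
      then show ?thesis unfolding split by simp
    qed
    finally have e: "poly (elliptic_poly N a) w = b 0 * (1 + cnj w * w) ^ N / moebius_factor N w" .
    have "moebius_factor N w * moebius_factor N w \<noteq> 0" by simp
    then have "(1 + cnj w * w) ^ N \<noteq> 0" unfolding moebius_factor_squared by (simp add: mult.commute)
    then show ?thesis unfolding e b_def by (simp only: divide_eq_0_iff mult_eq_0_iff) simp
  qed
  have M_const: "moebius N w (b(0 := 0)) 0 = - poly (nonconstant_part N (M b)) w" for b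
  proof -
    have 0: "poly (elliptic_poly N (moebius N w (b(0 := 0)))) w = 0"
      using N by (intro elliptic_moebius_at_center(1)) auto
    have "elliptic_poly N (moebius N w (b(0 := 0)))
        = elliptic_poly N ((M b)(0 := moebius N w (b(0 := 0)) 0))"
      by (rule elliptic_poly_cong) (auto simp: M_def)
    also have "poly \<dots> w = poly (nonconstant_part N (M b)) w + moebius N w (b(0 := 0)) 0"
      unfolding elliptic_poly_fun_upd poly_add by (simp del: fun_upd_apply)
    finally show ?thesis using 0 by (metis eq_neg_iff_add_eq_0 add.commute)
  qed
  have M_upd: "(?u b) n = moebius N w (b(0 := 0)) n"
    if "n \<le> N" for b n
    using that by (auto simp: M_const[symmetric]) (auto simp: M_def)
  have Mcomp: "(\<lambda>b. M b) \<in> PiM ?I (\<lambda>_. borel) \<rightarrow>\<^sub>M PiM ?I (\<lambda>_. borel)"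
    unfolding M_def moebius_def split by (intro measurable_restrict) simp
  have hm [measurable]: "h \<in> borel_measurable (PiM ?I (\<lambda>_. borel))"
    unfolding h_def poly_nonconstant_part by measurable
  have Fm [measurable]: "F \<in> borel_measurable (PiM ?I (\<lambda>_. borel))"
  proof -
    have "(\<lambda>a. moebius N w (a(0 := - poly (nonconstant_part N a) w))) \<in> borel_measurable (PiM ?I (\<lambda>_. borel))"
      unfolding moebius_def split poly_nonconstant_part
      by (intro measurable_coordinatewise_then_product) simp
    from measurable_compose[OF this C] show ?thesis
      unfolding F_def poly_pderiv_nonconstant_part by measurable
  qed
  have "(\<integral>\<^sup>+a. h a * F a \<partial>gaussian_PiM ?I)
      = (\<integral>\<^sup>+a. h a \<partial>gaussian_PiM ?I) * (\<integral>\<^sup>+b. F (M b) \<partial>gaussian_PiM ?I)"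
  proof (rule gaussian_linear_change[OF _ Mcomp _ _ hm Fm])
    fix y z :: "nat \<Rightarrow> complex"
    have "moebius N w ((\<lambda>i\<in>?I. y i - z i)(0 := 0)) i
        = moebius N w (y(0 := 0)) i - moebius N w (z(0 := 0)) i" for i
      unfolding moebius_def split by (simp add: sum_subtractf algebra_simps)
    then show "M (\<lambda>i\<in>?I. y i - z i) = (\<lambda>i\<in>?I. M y i - M z i)"
      by (auto simp: M_def)
  next
    fix y :: "nat \<Rightarrow> complex" assume y: "y \<in> extensional ?I"
    define a where "a = y(0 := - poly (nonconstant_part N y) w)"
    define b where "b = moebius N w a"
    have "poly (elliptic_poly N a) w = 0" by (simp add: a_def elliptic_poly_fun_upd)
    then have b0: "b 0 = 0" by (simp add: root b_def)
    have "M (restrict b ?I) i = y i" for i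
    proof (cases "i \<in> ?I")
      case True
      have "moebius N w ((restrict b ?I)(0 := 0)) i = moebius N w b i"
        by (rule moebius_cong) (use b0 in auto)
      also have "\<dots> = a i" using True by (simp add: b_def moebius_involution)
      finally show ?thesis using True by (simp add: M_def a_def)
    next
      case False
      then show ?thesis unfolding M_def extensional_arb[OF y False] by (simp only: restrict_apply if_False)
    qed
    then have "M (restrict b ?I) = y" ..
    then show "\<exists>x\<in>extensional ?I. M x = y" by (intro bexI[of _ "restrict b ?I"]) auto
  next
    fix b :: "nat \<Rightarrow> complex"
    \<comment> \<open>Unitarity accounts for the dropped coefficient: its squared modulus is exactly
      the exponent in \<open>h\<close>. This is the density condition of
      \<open>gaussian_linear_change\<close>.\<close>
    have "(\<Sum>i\<in>?I. (cmod (M b i))^2) + (cmod (poly (nonconstant_part N (M b)) w))^2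
        = (\<Sum>m\<le>N. (cmod (moebius N w (b(0 := 0)) m))^2)"
    proof -
      have "(\<Sum>i\<in>?I. (cmod (M b i))^2) = (\<Sum>i\<in>?I. (cmod (moebius N w (b(0 := 0)) i))^2)"
        by (intro sum.cong) (simp_all only: M_def restrict_apply if_True)
      moreover have "(\<Sum>m\<le>N. (cmod (moebius N w (b(0 := 0)) m))^2)
          = (cmod (moebius N w (b(0 := 0)) 0))^2 + (\<Sum>i\<in>?I. (cmod (moebius N w (b(0 := 0)) i))^2)"
        unfolding split by (rule sum.insert) auto
      ultimately show ?thesis by (simp only: M_const norm_minus_cancel add.commute)
    qed
    also have "\<dots> = (\<Sum>i\<in>?I. (cmod (b i))^2)"
      unfolding moebius_norm unfolding split by simp
    finally have e: "(\<Sum>i\<in>?I. (cmod (b i))^2)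
      = (\<Sum>i\<in>?I. (cmod (M b i))^2) + (cmod (poly (nonconstant_part N (M b)) w))^2" ..
    show "(\<Prod>i\<in>?I. cgauss_density (M b i)) * h (M b) = (\<Prod>i\<in>?I. cgauss_density (b i))"
      unfolding prod_cgauss_density h_def e
      by (simp add: ennreal_mult[symmetric] exp_add[symmetric] del: ennreal_mult)
  qed simp
  \<comment> \<open>The Jacobian of \<open>M\<close> appears as a one-dimensional Gaussian integral.
    Its value \<open>1 / (1 + (cmod w)^2) ^ N\<close> cancels the power from
    \<open>elliptic_moebius_at_center\<close>, leaving the spherical area density in
    \<open>w\<close>.\<close>
  also have "(\<integral>\<^sup>+a. h a \<partial>gaussian_PiM ?I) = ennreal (1 / ?x ^ N)"
  proof -
    define s where "s = sqrt (\<Sum>i\<in>?I. (cmod (bw_weight N i * w ^ i))^2)"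
    have s: "s \<ge> 0" "s^2 = (\<Sum>i\<in>?I. (cmod (bw_weight N i * w ^ i))^2)"
      by (simp_all add: s_def sum_nonneg)
    have "(\<integral>\<^sup>+a. h a \<partial>gaussian_PiM ?I) = (\<integral>\<^sup>+g. ennreal (exp (- (cmod (of_real s * g))\<^sup>2)) \<partial>std_cgauss)"
      unfolding h_def poly_nonconstant_part
      by (rule gaussian_functional[of ?I 0]) (use s in auto)
    also have "\<dots> = ennreal (1 / (1 + s^2))"
      using cgauss_moment_exp[of "s^2" 0] by (simp add: norm_mult power_mult_distrib)
    finally show ?thesis unfolding s(2) one_plus_weights .
  qed
  also have "(\<integral>\<^sup>+b. F (M b) \<partial>gaussian_PiM ?I)
      = (\<integral>\<^sup>+b. ennreal (N * ?x ^ N / ?x^2) * (ennreal ((cmod (b 1))^2) * C (b(0 := 0))) \<partial>gaussian_PiM ?I)"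
  proof (rule nn_integral_cong)
    fix b
    have 1: "C (moebius N w (?u b)) = C (b(0 := 0))"
    proof (rule C_cong)
      fix n assume n: "n \<le> N"
      have "moebius N w (?u b) n
          = moebius N w (moebius N w (b(0 := 0))) n"
        by (rule moebius_cong) (rule M_upd)
      then show "moebius N w (?u b) n = (b(0 := 0)) n"
        using n by (simp add: moebius_involution)
    qed
    have "pderiv (nonconstant_part N (M b)) = pderiv (elliptic_poly N (?u b))"
      by (simp add: elliptic_poly_fun_upd pderiv_add)
    also have "elliptic_poly N (?u b) = elliptic_poly N (moebius N w (b(0 := 0)))"
      by (rule elliptic_poly_cong) (rule M_upd)
    finally have "(cmod (poly (pderiv (nonconstant_part N (M b))) w))^2
        = N * (cmod (b 1))^2 * ?x ^ N / ?x^2"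
      using elliptic_moebius_at_center(2)[of "b(0 := 0)" N w] N by simp
    then have "F (M b) = C (b(0 := 0)) * ennreal (N * (cmod (b 1))^2 * ?x ^ N / ?x^2)"
      unfolding F_def 1 by simp
    also have "ennreal (N * (cmod (b 1))^2 * ?x ^ N / ?x^2) = ennreal (N * ?x ^ N / ?x^2) * ennreal ((cmod (b 1))^2)"
      using x by (subst ennreal_mult[symmetric]) (simp_all add: mult_ac)
    finally show "F (M b) = ennreal (N * ?x ^ N / ?x^2) * (ennreal ((cmod (b 1))^2) * C (b(0 := 0)))"
      by (simp only: mult_ac)
  qed
  also have "\<dots> = ennreal (N * ?x ^ N / ?x^2) * (\<integral>\<^sup>+b. ennreal ((cmod (b 1))^2) * C (b(0 := 0)) \<partial>gaussian_PiM ?I)"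
  proof (rule nn_integral_cmult)
    show "(\<lambda>b. ennreal ((cmod (b 1))^2) * C (b(0 := 0))) \<in> borel_measurable (gaussian_PiM ?I)"
      by (intro borel_measurable_times_ennreal measurable_cmod_component measurable_compose[OF measurable_fun_upd_const C])
  qed
  also have "ennreal (1 / ?x ^ N) * (ennreal (N * ?x ^ N / ?x^2) * (\<integral>\<^sup>+b. ennreal ((cmod (b 1))^2) * C (b(0 := 0)) \<partial>gaussian_PiM ?I))
      = ennreal (N / ?x^2) * (\<integral>\<^sup>+b. ennreal ((cmod (b 1))^2) * C (b(0 := 0)) \<partial>gaussian_PiM ?I)"
    unfolding mult.assoc[symmetric] using x by (subst ennreal_mult[symmetric]) simp_all
  finally show ?thesis unfolding h_def F_def .
qed


lemma proots_simple:
  fixes P :: "complex poly"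
  assumes P: "P \<noteq> 0" and simple: "\<And>w. poly P w = 0 \<Longrightarrow> poly (pderiv P) w \<noteq> 0"
  shows "proots P = mset_set {w. poly P w = 0}"
proof (rule multiset_eqI)
  fix w
  have "rsquarefree P" using simple by (auto simp: rsquarefree_roots)
  then have o: "order w P = 0 \<or> order w P = 1" by (simp add: rsquarefree_def)
  have fin: "finite {w. poly P w = 0}" using P by (rule poly_roots_finite)
  show "count (proots P) w = count (mset_set {w. poly P w = 0}) w"
    using o P order_root[of P w] fin by (cases "poly P w = 0") auto
qed

lemma AE_std_cgauss_nonzero: "AE z in std_cgauss. z \<noteq> 0"
  unfolding std_cgauss_eq using AE_lborel_singleton[of "0::complex"]
  by (subst AE_density) auto

lemma AE_PiM_std_cgauss_nonzero:
  assumes "i \<in> I"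
  shows "AE a in gaussian_PiM I. a i \<noteq> 0"
  using assms AE_std_cgauss_nonzero by (intro AE_PiM_component prob_space_std_cgauss)

text \<open>For fixed higher coefficients \<open>w\<close> is a root iff \<open>a 0 = - nonconstant_part a w\<close>, so the
  integral over \<open>a 0\<close> becomes an integral over the position of the root.\<close>

lemma expectation_sum_over_roots:
  fixes C S :: "(nat \<Rightarrow> complex) \<Rightarrow> ennreal"
  assumes N: "N \<ge> 1" and C [measurable]: "C \<in> borel_measurable borel"
    and C_cong: "\<And>a b. (\<And>n. n \<le> N \<Longrightarrow> a n = b n) \<Longrightarrow> C a = C b"
    and S: "S \<in> borel_measurable (coef_measure N)"
    and S_eq: "\<And>a. a N \<noteq> 0 \<Longrightarrow>
      (\<And>w. poly (elliptic_poly N a) w = 0 \<Longrightarrow> poly (pderiv (elliptic_poly N a)) w \<noteq> 0) \<Longrightarrow>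
      S a = (\<Sum>w\<in>{w. poly (elliptic_poly N a) w = 0}. C (moebius N w a))"
  shows "(\<integral>\<^sup>+a. S a \<partial>coef_measure N)
    = (\<integral>\<^sup>+w. ennreal (1 / (pi * (1 + (cmod w)^2)^2)) \<partial>lborel)
      * (of_nat N * (\<integral>\<^sup>+b. ennreal ((cmod (b 1))^2) * C (b(0 := 0)) \<partial>gaussian_PiM {1..N}))"
proof -
  let ?I = "{1..N}"
  let ?G = "gaussian_PiM ?I"
  let ?R = "nonconstant_part N"
  let ?L = "\<lambda>a. \<integral>\<^sup>+y. S (a(0 := y)) \<partial>std_cgauss"
  define J where "J = (\<integral>\<^sup>+b. ennreal ((cmod (b 1))^2) * C (b(0 := 0)) \<partial>?G)"
  define \<Phi> where "\<Phi> a w = ennreal (exp (- (cmod (poly (?R a) w))\<^sup>2))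
        * (C (moebius N w (a(0 := - poly (?R a) w)))
          * ennreal ((cmod (poly (pderiv (?R a)) w))^2))" for a w
  let ?K = "\<lambda>a. \<integral>\<^sup>+w. ennreal (1 / pi) * \<Phi> a w \<partial>lborel"
  have split: "{..N} = insert 0 ?I" by auto
  have CM: "coef_measure N = gaussian_PiM (insert 0 ?I)"
    unfolding coef_measure_def split ..
  have Sm0 [measurable]: "S \<in> borel_measurable (gaussian_PiM (insert 0 ?I))"
    using S unfolding CM .
  have arg: "(\<lambda>x. moebius N (snd x) ((fst x)(0 := - poly (?R (fst x)) (snd x)))) \<in> borel_measurable (?G \<Otimes>\<^sub>M lborel)"
    unfolding moebius_def split poly_nonconstant_part
    by (intro measurable_coordinatewise_then_product) simp
  have \<Phi>m0: "(\<lambda>(a, w). \<Phi> a w) \<in> borel_measurable (?G \<Otimes>\<^sub>M lborel)"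
    using measurable_compose[OF arg C]
    unfolding \<Phi>_def poly_nonconstant_part poly_pderiv_nonconstant_part split_beta by measurable
  then have \<Phi>m: "(\<lambda>(a, w). ennreal (1 / pi) * \<Phi> a w) \<in> borel_measurable (?G \<Otimes>\<^sub>M lborel)"
    by (simp add: split_beta)
  interpret G: prob_space ?G by (rule prob_space_PiM) (rule prob_space_std_cgauss)
  interpret GL: pair_sigma_finite ?G "lborel :: complex measure" by unfold_locales
  have inner: "?L a = ?K a"
    if a: "a \<in> space ?G" "a N \<noteq> 0" for a
  proof -
    \<comment> \<open>The sign makes the fibre of \<open>p\<close> over \<open>y\<close> the set of
      roots of the polynomial with constant coefficient \<open>y\<close>.\<close>
    define p where "p = - ?R a"
    have dp: "pderiv p \<noteq> 0" using pderiv_nonconstant_part_nonzero[OF N, of a] a(2) by (simp add: p_def pderiv_minus)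
    define g where "g w = cgauss_density (poly p w) * C (moebius N w (a(0 := poly p w)))" for w
    have "(\<lambda>w. moebius N w (a(0 := poly p w))) \<in> borel_measurable borel"
    proof -
      have "(\<lambda>w. (a, w)) \<in> lborel \<rightarrow>\<^sub>M (?G \<Otimes>\<^sub>M lborel)" using a(1) by measurable
      from measurable_compose[OF this arg] show ?thesis by (simp add: p_def)
    qed
    from measurable_compose[OF this C]
    have 1: "(\<lambda>w. C (moebius N w (a(0 := poly p w)))) \<in> borel_measurable borel" .
    have "poly p \<in> borel_measurable borel" by (intro borel_measurable_continuous_onI continuous_intros)
    from measurable_compose[OF this cgauss_density_measurable] 1
    have g: "g \<in> borel_measurable borel"
      unfolding g_def by (rule borel_measurable_times_ennreal)
    have Sm: "(\<lambda>y. S (a(0 := y))) \<in> borel_measurable lborel"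
    proof -
      have "(\<lambda>y. a(0 := y)) \<in> std_cgauss \<rightarrow>\<^sub>M gaussian_PiM (insert 0 ?I)"
        using a(1) by (intro measurable_component_update) auto
      from measurable_compose[OF this Sm0] show ?thesis by (simp cong: measurable_cong_sets)
    qed
    have "?L a = (\<integral>\<^sup>+y. cgauss_density y * S (a(0 := y)) \<partial>lborel)"
      unfolding std_cgauss_eq using Sm by (subst nn_integral_density) auto
    also have "\<dots> = (\<integral>\<^sup>+y. (\<Sum>w\<in>{w. poly p w = y}. g w) \<partial>lborel)"
    proof (rule nn_integral_cong_AE)
      \<comment> \<open>Only finitely many constant coefficients produce a multiple root; for all
        others \<open>S_eq\<close> applies.\<close>
      have "finite (poly p ` {w. poly (pderiv p) w = 0})"
        using dp by (intro finite_imageI poly_roots_finite)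
      then have "AE y in lborel. y \<notin> poly p ` {w. poly (pderiv p) w = 0}"
        by (intro AE_not_in finite_imp_null_set_lborel)
      then show "AE y in lborel. cgauss_density y * S (a(0 := y)) = (\<Sum>w\<in>{w. poly p w = y}. g w)"
      proof eventually_elim
        fix y assume y: "y \<notin> poly p ` {w. poly (pderiv p) w = 0}"
        have root: "poly (elliptic_poly N (a(0 := y))) w = 0 \<longleftrightarrow> poly p w = y" for w
          unfolding elliptic_poly_fun_upd by (auto simp: p_def add_eq_0_iff)
        have der: "pderiv (elliptic_poly N (a(0 := y))) = - pderiv p"
          unfolding elliptic_poly_fun_upd by (simp add: p_def pderiv_add pderiv_minus pderiv_pCons)
        have "S (a(0 := y)) = (\<Sum>w\<in>{w. poly (elliptic_poly N (a(0 := y))) w = 0}. C (moebius N w (a(0 := y))))"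
          by (rule S_eq) (use a(2) N y in \<open>auto simp: der root\<close>)
        also have "\<dots> = (\<Sum>w\<in>{w. poly p w = y}. C (moebius N w (a(0 := poly p w))))"
          unfolding root by (intro sum.cong) auto
        finally show "cgauss_density y * S (a(0 := y)) = (\<Sum>w\<in>{w. poly p w = y}. g w)"
          by (simp add: sum_distrib_left g_def)
      qed
    qed
    also have "\<dots> = (\<integral>\<^sup>+w. g w * ennreal ((cmod (poly (pderiv p) w))^2) \<partial>lborel)"
      by (rule nn_integral_poly_preimages[OF dp g])
    also have "\<dots> = ?K a"
    proof (rule nn_integral_cong)
      fix w
      have "cgauss_density (poly p w) = ennreal (1 / pi) * ennreal (exp (- (cmod (poly (?R a) w))\<^sup>2))"
        by (simp add: cgauss_density_def p_def ennreal_mult[symmetric])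
      then show "g w * ennreal ((cmod (poly (pderiv p) w))^2) = ennreal (1 / pi) * \<Phi> a w"
        by (simp add: g_def \<Phi>_def p_def pderiv_minus mult.assoc)
    qed
    finally show ?thesis .
  qed
  have "(\<integral>\<^sup>+a. S a \<partial>coef_measure N) = (\<integral>\<^sup>+a. ?L a \<partial>?G)"
    unfolding CM by (rule gauss_product.product_nn_integral_insert[OF _ _ Sm0]) auto
  also have "\<dots> = (\<integral>\<^sup>+a. ?K a \<partial>?G)"
  proof (rule nn_integral_cong_AE)
    have "AE a in ?G. a N \<noteq> 0" using N by (intro AE_PiM_std_cgauss_nonzero) auto
    with AE_space show "AE a in ?G. ?L a = ?K a"
      by eventually_elim (rule inner)
  qed
  also have "\<dots> = (\<integral>\<^sup>+w. (\<integral>\<^sup>+a. ennreal (1 / pi) * \<Phi> a w \<partial>?G) \<partial>lborel)"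
    by (rule GL.Fubini'[symmetric, OF \<Phi>m])
  also have "\<dots> = (\<integral>\<^sup>+w. ennreal (1 / (pi * (1 + (cmod w)^2)^2)) * (of_nat N * J) \<partial>lborel)"
  proof (rule nn_integral_cong)
    fix w
    let ?x = "1 + (cmod w)^2"
    have x: "?x > 0" by (rule one_plus_cmod_pos)
    have "(\<lambda>a. (a, w)) \<in> ?G \<rightarrow>\<^sub>M (?G \<Otimes>\<^sub>M lborel)" by measurable
    from measurable_compose[OF this \<Phi>m0]
    have "(\<integral>\<^sup>+a. ennreal (1 / pi) * \<Phi> a w \<partial>?G) = ennreal (1 / pi) * (\<integral>\<^sup>+a. \<Phi> a w \<partial>?G)"
      by (intro nn_integral_cmult) simp
    also have "(\<integral>\<^sup>+a. \<Phi> a w \<partial>?G) = ennreal (real N / ?x^2) * J"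
      unfolding \<Phi>_def J_def by (rule gaussian_conditioned_on_root[OF N C C_cong])
    also have "ennreal (1 / pi) * (ennreal (real N / ?x^2) * J) = ennreal (1 / pi * (real N / ?x^2)) * J"
      using x by (subst ennreal_mult) (simp_all add: mult.assoc)
    also have "1 / pi * (real N / ?x^2) = 1 / (pi * ?x^2) * real N" by simp
    also have "ennreal (1 / (pi * ?x^2) * real N) * J = ennreal (1 / (pi * ?x^2)) * (of_nat N * J)"
      using x by (subst ennreal_mult) (simp_all add: mult.assoc ennreal_of_nat_eq_real_of_nat)
    finally show "(\<integral>\<^sup>+a. ennreal (1 / pi) * \<Phi> a w \<partial>?G) = ennreal (1 / (pi * ?x^2)) * (of_nat N * J)" .
  qed
  also have "\<dots> = (\<integral>\<^sup>+w. ennreal (1 / (pi * (1 + (cmod w)^2)^2)) \<partial>lborel) * (of_nat N * J)"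
    by (rule nn_integral_multc) measurable
  finally show ?thesis unfolding J_def .
qed

lemma nn_integral_std_cgauss_component:
  assumes "finite I" "i \<in> I"
  shows "(\<integral>\<^sup>+b. ennreal ((cmod (b i))^2) \<partial>gaussian_PiM I) = 1"
proof -
  have "(\<Sum>j\<in>I. (if j = i then 1 else 0) * b j) = b i" for b :: "'a \<Rightarrow> complex"
    using assms by (simp add: if_distrib[of "\<lambda>x. x * _"] cong: if_cong)
  moreover have "(\<Sum>j\<in>I. (cmod (if j = i then 1 else 0))^2) = 1"
    using assms by (simp add: if_distrib[of cmod] if_distrib[of "\<lambda>x. x^2"] cong: if_cong)
  ultimately show ?thesis
    using gaussian_second_moment[OF assms(1), of "\<lambda>j. if j = i then 1 else 0" 0] by simp
qed

text \<open>Counting the single root of a polynomial of degree one computes the area of the sphere.\<close>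

lemma nn_integral_spherical_area:
  "(\<integral>\<^sup>+w. ennreal (1 / (pi * (1 + (cmod w)^2)^2)) \<partial>lborel) = 1"
proof -
  have "(\<integral>\<^sup>+a. 1 \<partial>coef_measure 1)
    = (\<integral>\<^sup>+w. ennreal (1 / (pi * (1 + (cmod w)^2)^2)) \<partial>lborel)
      * (of_nat 1 * (\<integral>\<^sup>+b. ennreal ((cmod (b 1))^2) * 1 \<partial>gaussian_PiM {1..1::nat}))"
  proof (rule expectation_sum_over_roots[where C = "\<lambda>_. 1" and S = "\<lambda>_. 1"])
    fix a :: "nat \<Rightarrow> complex" assume a: "a 1 \<noteq> 0"
    have "poly (elliptic_poly 1 a) w = 0 \<longleftrightarrow> w = - a 0 / a 1" for w
      using a by (auto simp: poly_elliptic_poly bw_weight_def field_simps add_eq_0_iff)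
    then show "1 = (\<Sum>w\<in>{w. poly (elliptic_poly 1 a) w = 0}. 1 :: ennreal)" by simp
  qed auto
  moreover have "(\<integral>\<^sup>+a. 1 \<partial>coef_measure 1) = 1"
    by (simp add: coef_measure_def)
  ultimately show ?thesis
    using nn_integral_std_cgauss_component[of "{1..1::nat}" 1] by simp
qed

section \<open>The conditional root density at the origin\<close>

lemma nn_integral_cgauss_quadratic:
  assumes "\<alpha> \<ge> 0" "\<beta> \<ge> 0" "v \<ge> 0"
  shows "(\<integral>\<^sup>+g. ennreal (\<alpha> + \<beta> * (cmod g)^2) * ennreal (v * (cmod g)^2 * exp (- (v * (cmod g)^2))) \<partial>std_cgauss)
    = ennreal (\<alpha> * v / (1 + v)^2 + 2 * \<beta> * v / (1 + v) ^ 3)"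
proof -
  let ?m = "\<lambda>k g. ennreal (((cmod g)^2) ^ k * exp (- (v * (cmod g)^2)))"
  have "(\<integral>\<^sup>+g. ennreal (\<alpha> + \<beta> * (cmod g)^2) * ennreal (v * (cmod g)^2 * exp (- (v * (cmod g)^2))) \<partial>std_cgauss)
      = (\<integral>\<^sup>+g. ennreal (\<alpha> * v) * ?m 1 g + ennreal (\<beta> * v) * ?m 2 g \<partial>std_cgauss)"
  proof (rule nn_integral_cong)
    fix g
    have "(\<alpha> + \<beta> * (cmod g)^2) * (v * (cmod g)^2 * exp (- (v * (cmod g)^2)))
        = \<alpha> * v * (((cmod g)^2) ^ 1 * exp (- (v * (cmod g)^2))) + \<beta> * v * (((cmod g)^2) ^ 2 * exp (- (v * (cmod g)^2)))"
      by (simp add: algebra_simps power2_eq_square)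
    then show "ennreal (\<alpha> + \<beta> * (cmod g)^2) * ennreal (v * (cmod g)^2 * exp (- (v * (cmod g)^2)))
        = ennreal (\<alpha> * v) * ?m 1 g + ennreal (\<beta> * v) * ?m 2 g"
      using assms by (simp flip: ennreal_mult ennreal_plus)
  qed
  also have "\<dots> = (\<integral>\<^sup>+g. ennreal (\<alpha> * v) * ?m 1 g \<partial>std_cgauss) + (\<integral>\<^sup>+g. ennreal (\<beta> * v) * ?m 2 g \<partial>std_cgauss)"
    by (rule nn_integral_add) measurable
  also have "\<dots> = ennreal (\<alpha> * v) * (\<integral>\<^sup>+g. ?m 1 g \<partial>std_cgauss) + ennreal (\<beta> * v) * (\<integral>\<^sup>+g. ?m 2 g \<partial>std_cgauss)"
    by (intro arg_cong2[where f = "(+)"] nn_integral_cmult) measurable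
  also have "\<dots> = ennreal (\<alpha> * v * (fact 1 / (1 + v) ^ Suc 1)) + ennreal (\<beta> * v * (fact 2 / (1 + v) ^ Suc 2))"
  proof -
    have "0 \<le> \<alpha> * v" "0 \<le> \<beta> * v" "0 \<le> fact 1 / (1 + v) ^ Suc 1" "0 \<le> fact 2 / (1 + v) ^ Suc 2"
      using assms by auto
    then show ?thesis unfolding cgauss_moment_exp[OF assms(3)] by (simp only: ennreal_mult)
  qed
  also have "\<dots> = ennreal (\<alpha> * v * (fact 1 / (1 + v) ^ Suc 1) + \<beta> * v * (fact 2 / (1 + v) ^ Suc 2))"
    using assms by (intro ennreal_plus[symmetric]) auto
  also have "\<alpha> * v * (fact 1 / (1 + v) ^ Suc 1) + \<beta> * v * (fact 2 / (1 + v) ^ Suc 2)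
      = \<alpha> * v / (1 + v)^2 + 2 * \<beta> * v / (1 + v) ^ 3"
    by (simp add: power2_eq_square power3_eq_cube fact_numeral numeral_2_eq_2 mult_ac)
  finally show ?thesis .
qed

lemma Cauchy_Schwarz_complex_sum:
  "(cmod (\<Sum>i\<in>I. p i * cnj (q i)))^2 \<le> (\<Sum>i\<in>I. (cmod (p i))^2) * (\<Sum>i\<in>I. (cmod (q i))^2)"
proof -
  have "cmod (\<Sum>i\<in>I. p i * cnj (q i)) \<le> (\<Sum>i\<in>I. cmod (p i) * cmod (q i))"
    by (rule order_trans[OF norm_sum]) (simp add: norm_mult)
  then have "(cmod (\<Sum>i\<in>I. p i * cnj (q i)))^2 \<le> (\<Sum>i\<in>I. cmod (p i) * cmod (q i))^2"
    by (intro power_mono) auto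
  also have "\<dots> \<le> (\<Sum>i\<in>I. (cmod (p i))^2) * (\<Sum>i\<in>I. (cmod (q i))^2)"
    by (rule Cauchy_Schwarz_ineq_sum)
  finally show ?thesis .
qed

text \<open>The variance of \<open>P z / z\<close> at \<open>(cmod z)^2 = x\<close>, given \<open>P 0 = 0\<close>.\<close>

definition reduced_variance :: "nat \<Rightarrow> real \<Rightarrow> real" where
  "reduced_variance N x = real N + (\<Sum>n\<in>{2..N}. real (N choose n) * x ^ (n - 1))"

text \<open>The derivative of \<open>reduced_variance\<close>. Times \<open>cnj z\<close> it is the
  covariance of the derivative of \<open>P z / z\<close> with its value.\<close>

definition reduced_variance' :: "nat \<Rightarrow> real \<Rightarrow> real" where
  "reduced_variance' N x = (\<Sum>n\<in>{2..N}. real (N choose n) * real (n - 1) * x ^ (n - 2))"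

text \<open>The variance of the derivative of \<open>P z / z\<close>. It is the derivative of
  \<open>x * reduced_variance' N x\<close>, in contrast to a second derivative of
  \<open>reduced_variance\<close>.\<close>

definition reduced_variance'' :: "nat \<Rightarrow> real \<Rightarrow> real" where
  "reduced_variance'' N x = (\<Sum>n\<in>{2..N}. real (N choose n) * (real (n - 1))^2 * x ^ (n - 2))"

text \<open>A primitive of \<open>conditional_density\<close> that vanishes at 0. It is the mean,
  weighted by \<open>(cmod (b 1))^2\<close>, of the number of further roots in the disc
  \<open>(cmod u)^2 \<le> x\<close>, given a root at 0.\<close>

definition conditional_count :: "nat \<Rightarrow> real \<Rightarrow> real" where
  "conditional_count N x = x * reduced_variance' N x * (reduced_variance N x - real N) / (reduced_variance N x)^2"

text \<open>The two summands are the \<open>\<alpha>\<close> and \<open>\<beta>\<close> terms of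
  \<open>nn_integral_cgauss_quadratic\<close>, with the residual variance of the derivative, its
  explained variance, and \<open>1 + v = reduced_variance N x / N\<close>.\<close>

definition conditional_density :: "nat \<Rightarrow> real \<Rightarrow> real" where
  "conditional_density N x =
    (reduced_variance'' N x * (reduced_variance N x - real N) - x * (reduced_variance' N x)^2) / (reduced_variance N x)^2
    + 2 * real N * x * (reduced_variance' N x)^2 / reduced_variance N x ^ 3"

lemma reduced_variance_ge: "x \<ge> 0 \<Longrightarrow> reduced_variance N x \<ge> real N"
  by (simp add: reduced_variance_def sum_nonneg)

lemma reduced_variance_pos: "x \<ge> 0 \<Longrightarrow> N \<ge> 1 \<Longrightarrow> reduced_variance N x > 0"
  using reduced_variance_ge[of x N] by linarith

lemma reduced_variance_DERIV:
  "(reduced_variance N has_real_derivative reduced_variance' N x) (at x)"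
  unfolding reduced_variance_def[abs_def] reduced_variance'_def
  by (auto intro!: derivative_eq_intros sum.cong simp: numeral_2_eq_2 Suc_diff_Suc mult_ac) 

lemma reduced_variance'_DERIV:
  "((\<lambda>x. x * reduced_variance' N x) has_real_derivative reduced_variance'' N x) (at x)"
proof -
  have e: "x * reduced_variance' N x = (\<Sum>n\<in>{2..N}. real (N choose n) * real (n - 1) * x ^ (n - 1))" for x
    unfolding reduced_variance'_def sum_distrib_left
  proof (intro sum.cong refl)
    fix n assume "n \<in> {2..N}"
    then have "n - 1 = Suc (n - 2)" by auto
    then show "x * (real (N choose n) * real (n - 1) * x ^ (n - 2)) = real (N choose n) * real (n - 1) * x ^ (n - 1)"
      by simp
  qed
  show ?thesis
    unfolding e reduced_variance''_def
    by (auto intro!: derivative_eq_intros sum.cong simp: numeral_2_eq_2 power2_eq_square mult_ac)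
qed

lemma conditional_count_DERIV:
  assumes "x \<ge> 0" "N \<ge> 1"
  shows "(conditional_count N has_real_derivative conditional_density N x) (at x)"
proof -
  have pos: "reduced_variance N x > 0" using assms by (rule reduced_variance_pos)
  have "((\<lambda>x. (x * reduced_variance' N x) * (reduced_variance N x - real N) / (reduced_variance N x)^2)
      has_real_derivative conditional_density N x) (at x)"
    by (rule derivative_eq_intros reduced_variance_DERIV reduced_variance'_DERIV refl)+
       (use pos in \<open>simp_all add: conditional_density_def field_simps power2_eq_square power3_eq_cube\<close>)
  then show ?thesis by (simp add: conditional_count_def[abs_def])
qed

text \<open>The analogue of \<open>nonconstant_part\<close> one degree lower: \<open>P z / z\<close>
  for \<open>b 0 = 0\<close>, without its constant coefficient
  \<open>bw_weight N 1 * b 1\<close>.\<close>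

definition reduced_poly :: "nat \<Rightarrow> (nat \<Rightarrow> complex) \<Rightarrow> complex poly" where
  "reduced_poly N b = (\<Sum>n\<in>{2..N}. monom (b n * bw_weight N n) (n - 1))"

lemma poly_reduced_poly: "poly (reduced_poly N b) u = (\<Sum>n\<in>{2..N}. bw_weight N n * u ^ (n - 1) * b n)"
  by (simp add: reduced_poly_def poly_sum poly_monom mult_ac)

lemma poly_pderiv_reduced_poly:
  "poly (pderiv (reduced_poly N b)) u = (\<Sum>n\<in>{2..N}. bw_weight N n * of_nat (n - 1) * u ^ (n - 2) * b n)"
  by (simp add: reduced_poly_def pderiv_sum pderiv_monom poly_sum poly_monom mult_ac numeral_2_eq_2)

lemma pderiv_reduced_poly_nonzero:
  assumes "N \<ge> 2" "b N \<noteq> 0"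
  shows "pderiv (reduced_poly N b) \<noteq> 0"
proof
  assume "pderiv (reduced_poly N b) = 0"
  then have "degree (reduced_poly N b) = 0" by (simp add: pderiv_eq_0_iff)
  moreover have "coeff (reduced_poly N b) (N - 1) = b N * bw_weight N N"
  proof -
    have "coeff (reduced_poly N b) (N - 1) = (\<Sum>n\<in>{2..N}. if n = N then b N * bw_weight N N else 0)"
      unfolding reduced_poly_def coeff_sum using assms(1) by (intro sum.cong) auto
    then show ?thesis using assms(1) by simp
  qed
  then have "N - 1 \<le> degree (reduced_poly N b)" using assms by (intro le_degree) simp
  ultimately show False using assms(1) by simp
qed

lemma elliptic_poly_root_zero:
  assumes "N \<ge> 1"
  shows "elliptic_poly N (b(0 := 0)) = [:0, 1:] * ([:bw_weight N 1 * b 1:] + reduced_poly N b)"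
proof (rule poly_eqI_cofinite[of "{}"])
  fix u
  have split: "{..N} = insert 0 (insert 1 {2..N})" using assms by auto
  have "poly (elliptic_poly N (b(0 := 0))) u = bw_weight N 1 * b 1 * u + (\<Sum>n\<in>{2..N}. b n * bw_weight N n * u ^ n)"
    unfolding poly_elliptic_poly split by (simp add: mult_ac)
  also have "(\<Sum>n\<in>{2..N}. b n * bw_weight N n * u ^ n) = u * (\<Sum>n\<in>{2..N}. bw_weight N n * u ^ (n - 1) * b n)"
    unfolding sum_distrib_left
  proof (intro sum.cong refl)
    fix n assume "n \<in> {2..N}"
    then have "u ^ n = u * u ^ (n - 1)" by (cases n) auto
    then show "b n * bw_weight N n * u ^ n = u * (bw_weight N n * u ^ (n - 1) * b n)" by (simp add: mult_ac)
  qed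
  finally have e: "poly (elliptic_poly N (b(0 := 0))) u
      = bw_weight N 1 * b 1 * u + u * (\<Sum>n\<in>{2..N}. bw_weight N n * u ^ (n - 1) * b n)" .
  show "poly (elliptic_poly N (b(0 := 0))) u = poly ([:0, 1:] * ([:bw_weight N 1 * b 1:] + reduced_poly N b)) u"
    unfolding e by (simp add: poly_reduced_poly algebra_simps)
qed simp

lemma bw_weight_1: "bw_weight N 1 = complex_of_real (sqrt (real N))"
  by (simp add: bw_weight_def)

lemma cmod_bw_weight: "(cmod (bw_weight N n))^2 = real (N choose n)"
  by (simp add: bw_weight_def)

text \<open>A root at \<open>u\<close> forces
  \<open>b 1 = - poly (reduced_poly N b) u / sqrt N\<close>. The integrand is the Jacobian of this
  relation times the weight \<open>(cmod (b 1))^2\<close> and the unnormalized density of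
  \<open>b 1\<close>; value and derivative are the two functionals. The second claim is
  Cauchy-Schwarz for them.\<close>

lemma gaussian_reduced_poly:
  assumes N: "N \<ge> 2" and u: "u \<noteq> 0"
  shows "(\<integral>\<^sup>+b. ennreal ((cmod (poly (pderiv (reduced_poly N b)) u))^2 / N)
       * ennreal ((cmod (poly (reduced_poly N b) u))^2 / N * exp (- ((cmod (poly (reduced_poly N b) u))^2 / N)))
       \<partial>gaussian_PiM {2..N})
    = ennreal (conditional_density N ((cmod u)^2))" (is "?lhs = _")
    and "conditional_density N ((cmod u)^2) \<ge> 0"
proof -
  let ?I = "{2..N}"
  define x where "x = (cmod u)^2"
  have x: "x > 0" using u by (simp add: x_def)
  define q where "q n = bw_weight N n * u ^ (n - 1) / of_real (sqrt N)" for n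
  define p where "p n = bw_weight N n * of_nat (n - 1) * u ^ (n - 2) / of_real (sqrt N)" for n
  have N0: "real N > 0" using N by simp
  have ps: "(\<Sum>n\<in>?I. p n * b n) = poly (pderiv (reduced_poly N b)) u / of_real (sqrt N)" for b
    unfolding poly_pderiv_reduced_poly sum_divide_distrib by (intro sum.cong) (auto simp: p_def)
  have qs: "(\<Sum>n\<in>?I. q n * b n) = poly (reduced_poly N b) u / of_real (sqrt N)" for b
    unfolding poly_reduced_poly sum_divide_distrib by (intro sum.cong) (auto simp: q_def)
  define v where "v = (\<Sum>n\<in>?I. (cmod (q n))^2)"
  have cu: "(cmod (u ^ k))^2 = x ^ k" for k
    by (simp add: x_def norm_power flip: power_mult) (simp add: mult.commute)
  have v: "v = (reduced_variance N x - real N) / N"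
    unfolding v_def reduced_variance_def
    by (simp add: q_def norm_mult norm_divide power_mult_distrib power_divide cmod_bw_weight cu[unfolded norm_power] norm_power sum_divide_distrib)
  have pp: "(\<Sum>n\<in>?I. (cmod (p n))^2) = reduced_variance'' N x / N"
  proof -
    have "(cmod (p n))^2 = real (N choose n) * (real (n - 1))^2 * x ^ (n - 2) / N" for n
      unfolding p_def by (simp only: norm_mult norm_divide power_mult_distrib power_divide cmod_bw_weight cu norm_of_nat) simp
    then show ?thesis
      unfolding reduced_variance''_def sum_divide_distrib by (simp only:)
  qed
  have pq: "(\<Sum>n\<in>?I. p n * cnj (q n)) = cnj u * of_real (reduced_variance' N x) / N"
  proof -
    have "p n * cnj (q n) = cnj u * of_real (real (N choose n) * real (n - 1) * x ^ (n - 2)) / N" if n: "n \<in> ?I" for n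
    proof -
      have 1: "n - 1 = Suc (n - 2)" using n by auto
      have cu1: "cnj u ^ (n - 1) = cnj u * cnj u ^ (n - 2)" by (subst 1) simp
      have 2: "u * cnj u = of_real x" unfolding x_def by (rule complex_norm_square[symmetric])
      have 3: "complex_of_real (sqrt N) * complex_of_real (sqrt N) = of_nat N"
        by (simp flip: of_real_mult)
      have "p n * cnj (q n) = (bw_weight N n * bw_weight N n) * of_nat (n - 1) * ((u * cnj u) ^ (n - 2) * cnj u)
          / (complex_of_real (sqrt N) * complex_of_real (sqrt N))"
        using cu1 unfolding p_def q_def by (simp add: power_mult_distrib mult_ac)
      then show ?thesis unfolding bw_weight_squared 2 3 by (simp add: mult_ac)
    qed
    then have "(\<Sum>n\<in>?I. p n * cnj (q n)) = (\<Sum>n\<in>?I. cnj u * of_real (real (N choose n) * real (n - 1) * x ^ (n - 2)) / N)"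
      by (intro sum.cong) auto
    then show ?thesis
      by (simp add: reduced_variance'_def sum_distrib_left sum_divide_distrib)
  qed
  \<comment> \<open>Here \<open>u \<noteq> 0\<close> enters: the coefficient of \<open>b 2\<close>
    keeps the variance positive, so the value functional can be normalized.\<close>
  have vpos: "v > 0"
  proof -
    have "0 < (cmod (q 2))^2" using N u by (simp add: q_def)
    also have "\<dots> \<le> v" unfolding v_def using N by (intro member_le_sum) auto
    finally show ?thesis .
  qed
  define A where "A = (\<Sum>n\<in>?I. p n * cnj (q n)) / of_real (sqrt v)"
  have A: "(cmod A)^2 = x * (reduced_variance' N x)^2 / (N^2 * v)"
    unfolding A_def pq using vpos by (simp add: norm_divide norm_mult power_divide power_mult_distrib x_def)
  have AP: "(cmod A)^2 \<le> (\<Sum>n\<in>?I. (cmod (p n))^2)"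
    using Cauchy_Schwarz_complex_sum[of p q ?I] vpos
    by (simp add: A_def norm_divide power_divide v_def[symmetric] pos_divide_le_eq)
  define h where "h z = ennreal ((cmod z)^2 * exp (- ((cmod z)^2)))" for z
  have [measurable]: "h \<in> borel_measurable borel" unfolding h_def by measurable
  have eq: "((\<Sum>n\<in>?I. (cmod (p n))^2) - (cmod A)^2) * v / (1 + v)^2 + 2 * (cmod A)^2 * v / (1 + v) ^ 3 = conditional_density N x"
  proof -
    define s where "s = reduced_variance N x"
    have s: "s > 0" unfolding s_def using x N by (intro reduced_variance_pos) auto
    have 1: "1 + v = s / N" unfolding v s_def using N0 by (simp add: field_simps)
    have 2: "((\<Sum>n\<in>?I. (cmod (p n))^2) - (cmod A)^2) * v
        = (reduced_variance'' N x * (s - N) - x * (reduced_variance' N x)^2) / N^2"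
      unfolding pp A using vpos N0 by (simp add: left_diff_distrib) (simp add: v s_def field_simps power2_eq_square)
    have 3: "(cmod A)^2 * v = x * (reduced_variance' N x)^2 / N^2"
      unfolding A using vpos by simp
    have "2 * (cmod A)^2 * v / (1 + v) ^ 3 = 2 * (x * (reduced_variance' N x)^2 / N^2) / (s / N) ^ 3"
      by (simp only: 1 3 mult.assoc)
    also have "\<dots> = 2 * real N * x * (reduced_variance' N x)^2 / s ^ 3"
      using N0 s by (simp add: field_simps power2_eq_square power3_eq_cube)
    finally have 4: "2 * (cmod A)^2 * v / (1 + v) ^ 3 = 2 * real N * x * (reduced_variance' N x)^2 / s ^ 3" .
    show ?thesis
      unfolding 4 unfolding 2 1 conditional_density_def s_def[symmetric] using N0 s by (simp add: power_divide)
  qed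
  have "?lhs = (\<integral>\<^sup>+b. ennreal ((cmod (\<Sum>n\<in>?I. p n * b n))^2) * h (\<Sum>n\<in>?I. q n * b n) \<partial>gaussian_PiM ?I)"
    unfolding ps qs h_def by (simp add: norm_divide power_divide)
  also have "\<dots> = (\<integral>\<^sup>+g. ennreal ((\<Sum>n\<in>?I. (cmod (p n))^2) - (cmod A)^2 + (cmod A)^2 * (cmod g)^2) * h (of_real (sqrt v) * g) \<partial>std_cgauss)"
    using gaussian_two_functionals[of ?I 0 "sqrt v" q h p 0, folded A_def] vpos
    by (simp add: v_def[symmetric] norm_mult power_mult_distrib)
  also have "\<dots> = ennreal (((\<Sum>n\<in>?I. (cmod (p n))^2) - (cmod A)^2) * v / (1 + v)^2 + 2 * (cmod A)^2 * v / (1 + v) ^ 3)"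
    using nn_integral_cgauss_quadratic[of "(\<Sum>n\<in>?I. (cmod (p n))^2) - (cmod A)^2" "(cmod A)^2" v] AP vpos
    by (simp add: h_def norm_mult power_mult_distrib)
  finally show "?lhs = ennreal (conditional_density N ((cmod u)^2))" unfolding eq x_def .
  have "0 \<le> ((\<Sum>n\<in>?I. (cmod (p n))^2) - (cmod A)^2) * v / (1 + v)^2 + 2 * (cmod A)^2 * v / (1 + v) ^ 3"
    using AP vpos by simp
  then show "conditional_density N ((cmod u)^2) \<ge> 0" unfolding eq x_def .
qed

text \<open>The fundamental theorem for nonnegative integrals asks for the sign on the closed
  interval; the endpoint 0, outside the probabilistic formula, is checked directly.\<close>

lemma conditional_density_nonneg:
  assumes N: "N \<ge> 2" and x: "x \<ge> 0"
  shows "conditional_density N x \<ge> 0"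
proof (cases "x = 0")
  case True
  have "reduced_variance N 0 = real N"
    unfolding reduced_variance_def by (simp add: sum.neutral)
  then show ?thesis using True by (simp add: conditional_density_def)
next
  case False
  then show ?thesis using gaussian_reduced_poly(2)[OF N, of "of_real (sqrt x)"] x by simp
qed

section \<open>The weighted number of roots in a disc, given a root at the origin\<close>

definition disc_root_count :: "nat \<Rightarrow> real \<Rightarrow> (nat \<Rightarrow> complex) \<Rightarrow> nat" where
  "disc_root_count N x b = size (filter_mset (\<lambda>u. (cmod u)^2 \<le> x) (proots (elliptic_poly N b)))"

lemma size_filter_mset_map: "size (filter_mset Q (mset (map z [0..<d]))) = card {i\<in>{..<d}. Q (z i)}"
proof -
  have "size (filter_mset Q (mset (map z [0..<d]))) = length (filter Q (map z [0..<d]))"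
    by (metis mset_filter size_mset)
  also have "\<dots> = card {i. i < d \<and> Q (z i)}"
    by (subst length_filter_conv_card) (auto intro!: arg_cong[where f=card])
  finally show ?thesis by simp
qed

lemma weighted_proots_functional_measurable:
  assumes "\<And>d k. closed {z :: nat \<Rightarrow> complex. k \<le> \<Phi> (mset (map z [0..<d]))}"
    and "\<And>i. (\<lambda>x. f x i) \<in> borel_measurable M"
  shows "(\<lambda>x. \<Phi> (proots (elliptic_poly N (f x)))) \<in> M \<rightarrow>\<^sub>M count_space (UNIV :: nat set)"
proof -
  have "(\<lambda>x n. f x n * bw_weight N n) \<in> borel_measurable M"
    using assms(2) by (intro measurable_coordinatewise_then_product borel_measurable_times) auto
  from measurable_compose[OF this proots_functional_measurable[OF assms(1), of N]]
  show ?thesis by (simp add: elliptic_poly_eq)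
qed

lemma disc_root_count_measurable: "disc_root_count N x \<in> borel \<rightarrow>\<^sub>M count_space UNIV"
  unfolding disc_root_count_def[abs_def]
proof (rule weighted_proots_functional_measurable)
  fix d k
  have "closed {z :: nat \<Rightarrow> complex. (cmod (z i))^2 \<le> x}" for i
    by (intro closed_Collect_le continuous_intros continuous_on_product_coordinates)
  then show "closed {z :: nat \<Rightarrow> complex. k \<le> size (filter_mset (\<lambda>u. (cmod u)^2 \<le> x) (mset (map z [0..<d])))}"
    unfolding size_filter_mset_map by (intro closed_le_card_Collect) auto
  show "(\<lambda>b :: nat \<Rightarrow> complex. b i) \<in> borel_measurable borel" for i
    by (intro borel_measurable_continuous_onI continuous_on_product_coordinates)
qed

lemma disc_root_count_cong:
  "(\<And>n. n \<le> N \<Longrightarrow> a n = b n) \<Longrightarrow> disc_root_count N x a = disc_root_count N x b"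
  unfolding disc_root_count_def using elliptic_poly_cong[of N a b] by simp

lemma disc_root_count_root_zero:
  assumes N: "N \<ge> 1" and x: "x \<ge> 0" and Q: "Q = [:bw_weight N 1 * b 1:] + reduced_poly N b"
    and Q0: "Q \<noteq> 0"
  shows "disc_root_count N x (b(0 := 0)) = 1 + size (filter_mset (\<lambda>u. (cmod u)^2 \<le> x) (proots Q))"
proof -
  have "proots (elliptic_poly N (b(0 := 0))) = proots [:0, 1:] + proots Q"
    unfolding elliptic_poly_root_zero[OF N] Q[symmetric] using Q0 by (intro proots_mult) auto
  also have "proots [:0, 1 :: complex:] = {#0#}" by simp
  finally show ?thesis using x by (simp add: disc_root_count_def del: fun_upd_apply)
qed

lemma nn_integral_conditional_density:
  assumes N: "N \<ge> 2" and x: "x \<ge> 0"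
  shows "(\<integral>\<^sup>+u. ennreal (1 / pi) * (indicator {u. (cmod u)^2 \<le> x} u * ennreal (conditional_density N ((cmod u)^2))) \<partial>lborel)
    = ennreal (conditional_count N x)"
proof -
  have [measurable]: "conditional_density N \<in> borel_measurable borel"
    unfolding conditional_density_def[abs_def] reduced_variance_def reduced_variance'_def reduced_variance''_def
    by measurable
  have "(\<integral>\<^sup>+u. ennreal (1 / pi) * (indicator {u. (cmod u)^2 \<le> x} u * ennreal (conditional_density N ((cmod u)^2))) \<partial>(lborel :: complex measure))
      = (\<integral>\<^sup>+u. (\<lambda>y. ennreal (1 / pi) * (indicator {..x} y * ennreal (conditional_density N y))) ((cmod u)^2) \<partial>(lborel :: complex measure))"
    by (intro nn_integral_cong) (simp add: indicator_def)
  also have "\<dots> = ennreal pi * (\<integral>\<^sup>+y. indicator {0..} y * (ennreal (1 / pi) * (indicator {..x} y * ennreal (conditional_density N y))) \<partial>lborel)"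
    by (rule nn_integral_cmod_squared) measurable
  also have "\<dots> = ennreal pi * (\<integral>\<^sup>+y. ennreal (1 / pi) * (ennreal (conditional_density N y) * indicator {0..x} y) \<partial>lborel)"
  proof -
    have "indicator {0..} y * (ennreal (1 / pi) * (indicator {..x} y * ennreal (conditional_density N y)))
        = ennreal (1 / pi) * (ennreal (conditional_density N y) * indicator {0..x} y)" for y
      by (simp split: split_indicator)
    then show ?thesis by (simp only:)
  qed
  also have "\<dots> = ennreal pi * (ennreal (1 / pi) * (\<integral>\<^sup>+y. ennreal (conditional_density N y) * indicator {0..x} y \<partial>lborel))"
    by (subst nn_integral_cmult) auto
  also have "\<dots> = (\<integral>\<^sup>+y. ennreal (conditional_density N y) * indicator {0..x} y \<partial>lborel)"
    by (simp add: mult.assoc[symmetric] ennreal_mult[symmetric])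
  also have "\<dots> = conditional_count N x - conditional_count N 0"
    by (rule nn_integral_FTC_Icc) (use x N in \<open>auto intro: conditional_count_DERIV conditional_density_nonneg\<close>)
  finally show ?thesis by (simp add: conditional_count_def)
qed

lemma conditional_count_nonneg:
  assumes "x \<ge> 0"
  shows "conditional_count N x \<ge> 0"
  unfolding conditional_count_def reduced_variance'_def using assms reduced_variance_ge[OF assms, of N]
  by (intro divide_nonneg_nonneg mult_nonneg_nonneg sum_nonneg) auto

text \<open>Once more the coefficient \<open>b 1\<close> is eliminated in favour of the position of a root.\<close>

lemma weighted_disc_root_count:
  assumes N: "N \<ge> 2" and x: "x \<ge> 0"
  shows "(\<integral>\<^sup>+b. ennreal ((cmod (b 1))^2) * of_nat (disc_root_count N x (b(0 := 0))) \<partial>gaussian_PiM {1..N})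
    = ennreal (1 + conditional_count N x)"
proof -
  let ?I = "{2..N}"
  let ?G = "gaussian_PiM ?I"
  let ?D = "{u. (cmod u)^2 \<le> x}"
  let ?G1 = "gaussian_PiM {1..N}"
  let ?n = "\<lambda>Q. size (filter_mset (\<lambda>u. (cmod u)^2 \<le> x) (proots Q))"
  have split: "{1..N} = insert 1 ?I" using N by auto
  define \<Theta> where "\<Theta> b u = ennreal ((cmod (poly (pderiv (reduced_poly N b)) u))^2 / N)
       * ennreal ((cmod (poly (reduced_poly N b) u))^2 / N * exp (- ((cmod (poly (reduced_poly N b) u))^2 / N)))" for b u
  let ?T = "\<lambda>b u. ennreal (1 / pi) * (indicator ?D u * \<Theta> b u)"
  let ?K = "\<lambda>b. \<integral>\<^sup>+u. ?T b u \<partial>lborel"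
  \<comment> \<open>The subtracted 1 is the root at 0, always in the disc. The truncated subtraction
    is exact almost surely, since \<open>b N \<noteq> 0\<close> excludes the zero
    polynomial.\<close>
  define f where "f b = ennreal ((cmod (b 1))^2) * of_nat (disc_root_count N x (b(0 := 0)) - 1)" for b
  have \<Theta>m: "(\<lambda>(b, u). \<Theta> b u) \<in> borel_measurable (?G \<Otimes>\<^sub>M lborel)"
    unfolding \<Theta>_def poly_reduced_poly poly_pderiv_reduced_poly split_beta by measurable
  have Dm: "?D \<in> sets borel"
  proof -
    have "closed ?D" by (intro closed_Collect_le continuous_intros)
    then show ?thesis by simp
  qed
  have fm: "f \<in> borel_measurable (gaussian_PiM (insert 1 ?I))"
    unfolding f_def
    by (intro borel_measurable_times_ennreal measurable_cmod_component
        measurable_compose[OF measurable_compose[OF measurable_fun_upd_const disc_root_count_measurable]]) simp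
  interpret G: prob_space ?G by (rule prob_space_PiM) (rule prob_space_std_cgauss)
  interpret GL: pair_sigma_finite ?G "lborel :: complex measure" by unfold_locales
  have sqN: "sqrt N > 0" using N by simp
  have inner: "(\<integral>\<^sup>+y. f (b(1 := y)) \<partial>std_cgauss)
      = ?K b"
    if b: "b \<in> space ?G" "b N \<noteq> 0" for b
  proof -
    define p where "p = smult (- 1 / of_real (sqrt N)) (reduced_poly N b)"
    have dp: "pderiv p \<noteq> 0"
      using pderiv_reduced_poly_nonzero[of N b] N b(2) sqN by (simp add: p_def pderiv_smult pderiv_minus)
    \<comment> \<open>On the fibre over \<open>y\<close> the eliminated coefficient
      \<open>b 1 = y\<close> equals \<open>poly p u\<close>, so its weight becomes
      \<open>(cmod (poly p u))^2\<close>.\<close>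
    define g where "g u = cgauss_density (poly p u) * ennreal ((cmod (poly p u))^2) * indicator ?D u" for u
    have pm: "poly p \<in> borel_measurable borel" by (intro borel_measurable_continuous_onI continuous_intros)
    have g: "g \<in> borel_measurable borel"
      unfolding g_def using pm Dm
      by (intro borel_measurable_times_ennreal measurable_compose[OF pm cgauss_density_measurable]) auto
    have Sum_meas: "(\<lambda>y. f (b(1 := y))) \<in> borel_measurable lborel"
    proof -
      have "(\<lambda>y. b(1 := y)) \<in> std_cgauss \<rightarrow>\<^sub>M gaussian_PiM (insert 1 ?I)"
        using b(1) by (intro measurable_component_update) auto
      from measurable_compose[OF this fm] show ?thesis by (simp cong: measurable_cong_sets)
    qed
    have key: "AE y in lborel. cgauss_density y * f (b(1 := y)) = (\<Sum>u\<in>{u. poly p u = y}. g u)"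
    proof -
      have "finite (poly p ` {u. poly (pderiv p) u = 0})"
        using dp by (intro finite_imageI poly_roots_finite)
      then have "AE y in lborel. y \<notin> poly p ` {u. poly (pderiv p) u = 0}"
        by (intro AE_not_in finite_imp_null_set_lborel)
      then show ?thesis
      proof eventually_elim
        fix y assume y: "y \<notin> poly p ` {u. poly (pderiv p) u = 0}"
        let ?R = "{u\<in>{u. poly p u = y}. (cmod u)^2 \<le> x}"
        define Q where "Q = [:bw_weight N 1 * y:] + reduced_poly N b"
        have Qp: "Q = smult (of_real (sqrt N)) ([:y:] - p)"
          using sqN by (simp add: Q_def p_def bw_weight_1[simplified] smult_add_right)
        have root: "poly Q u = 0 \<longleftrightarrow> poly p u = y" for u
          using sqN by (auto simp: Qp)
        have der: "pderiv Q = - smult (of_real (sqrt N)) (pderiv p)"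
          by (simp add: Qp pderiv_smult pderiv_diff pderiv_pCons)
        have Q0: "Q \<noteq> 0" using der dp sqN by auto
        have "poly (pderiv Q) u \<noteq> 0" if "poly Q u = 0" for u
          using that y sqN unfolding root der by auto
        then have "proots Q = mset_set {u. poly p u = y}"
          using proots_simple[OF Q0] by (simp add: root)
        moreover have fin: "finite {u. poly p u = y}"
          using poly_roots_finite[OF Q0] by (simp add: root)
        ultimately have "?n Q = card ?R"
          by simp
        moreover have "disc_root_count N x ((b(1 := y))(0 := 0)) = 1 + ?n Q"
        proof (rule disc_root_count_root_zero)
          have "reduced_poly N (b(1 := y)) = reduced_poly N b"
            unfolding reduced_poly_def by (intro sum.cong) auto
          then show "Q = [:bw_weight N 1 * (b(1 := y)) 1:] + reduced_poly N (b(1 := y))"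
            by (simp add: Q_def)
        qed (use N x Q0 in auto)
        ultimately have "f (b(1 := y)) = ennreal ((cmod y)^2) * of_nat (card ?R)"
          by (simp add: f_def)
        moreover have "(of_nat (card ?R) :: ennreal) = (\<Sum>u\<in>{u. poly p u = y}. indicator ?D u)"
          using fin by (simp add: sum.If_cases indicator_def Int_def of_bool_def)
        moreover have "(\<Sum>u\<in>{u. poly p u = y}. g u) = cgauss_density y * ennreal ((cmod y)^2) * (\<Sum>u\<in>{u. poly p u = y}. indicator ?D u)"
          unfolding sum_distrib_left by (intro sum.cong) (auto simp: g_def)
        ultimately show "cgauss_density y * f (b(1 := y)) = (\<Sum>u\<in>{u. poly p u = y}. g u)"
          by (simp only: mult.assoc)
      qed
    qed
    have gp: "(\<integral>\<^sup>+y. (\<Sum>u\<in>{u. poly p u = y}. g u) \<partial>lborel)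
        = ?K b"
    proof -
      have "(\<integral>\<^sup>+y. (\<Sum>u\<in>{u. poly p u = y}. g u) \<partial>lborel) = (\<integral>\<^sup>+u. g u * ennreal ((cmod (poly (pderiv p) u))^2) \<partial>lborel)"
        by (rule nn_integral_poly_preimages[OF dp g])
      also have "\<dots> = ?K b"
      proof (rule nn_integral_cong)
        fix u
        have 1: "(cmod (poly p u))^2 = (cmod (poly (reduced_poly N b) u))^2 / N"
          and 2: "(cmod (poly (pderiv p) u))^2 = (cmod (poly (pderiv (reduced_poly N b)) u))^2 / N"
          using N by (simp_all add: p_def pderiv_smult pderiv_minus norm_mult norm_divide power_mult_distrib power_divide)
        have 3: "cgauss_density z = ennreal (1 / pi) * ennreal (exp (- (cmod z)\<^sup>2))" for z
          by (simp add: cgauss_density_def ennreal_mult[symmetric])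
        have 4: "ennreal (c * exp d) = ennreal c * ennreal (exp d)" if "c \<ge> 0" for c d
          using that by (simp add: ennreal_mult)
        show "g u * ennreal ((cmod (poly (pderiv p) u))^2) = ?T b u"
          unfolding g_def \<Theta>_def 3 1 2 by (subst 4) (simp_all add: mult_ac)
      qed
      finally show ?thesis .
    qed
    have "(\<integral>\<^sup>+y. f (b(1 := y)) \<partial>std_cgauss) = (\<integral>\<^sup>+y. cgauss_density y * f (b(1 := y)) \<partial>lborel)"
      unfolding std_cgauss_eq using Sum_meas by (subst nn_integral_density) auto
    also have "\<dots> = (\<integral>\<^sup>+y. (\<Sum>u\<in>{u. poly p u = y}. g u) \<partial>lborel)"
      by (rule nn_integral_cong_AE[OF key])
    finally show ?thesis unfolding gp .
  qed
  have "(\<integral>\<^sup>+b. f b \<partial>?G1) = (\<integral>\<^sup>+b. (\<integral>\<^sup>+y. f (b(1 := y)) \<partial>std_cgauss) \<partial>?G)"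
    unfolding split by (rule gauss_product.product_nn_integral_insert[OF _ _ fm]) auto
  also have "\<dots> = (\<integral>\<^sup>+b. ?K b \<partial>?G)"
  proof (rule nn_integral_cong_AE)
    have "AE b in ?G. b N \<noteq> 0" using N by (intro AE_PiM_std_cgauss_nonzero) auto
    with AE_space show "AE b in ?G. (\<integral>\<^sup>+y. f (b(1 := y)) \<partial>std_cgauss)
        = ?K b"
      by eventually_elim (rule inner)
  qed
  also have "\<dots>
      = (\<integral>\<^sup>+u. (\<integral>\<^sup>+b. ?T b u \<partial>?G) \<partial>lborel)"
    by (rule GL.Fubini'[symmetric]) (use \<Theta>m Dm in \<open>unfold split_beta, measurable\<close>)
  also have "\<dots> = (\<integral>\<^sup>+u. ennreal (1 / pi) * (indicator ?D u * ennreal (conditional_density N ((cmod u)^2))) \<partial>lborel)"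
  proof (rule nn_integral_cong_AE)
    show "AE u in lborel. (\<integral>\<^sup>+b. ?T b u \<partial>?G)
        = ennreal (1 / pi) * (indicator ?D u * ennreal (conditional_density N ((cmod u)^2)))"
      using AE_lborel_singleton[of "0 :: complex"]
    proof eventually_elim
      fix u :: complex assume u: "u \<noteq> 0"
      have "(\<lambda>b. (b, u)) \<in> ?G \<rightarrow>\<^sub>M (?G \<Otimes>\<^sub>M lborel)" by measurable
      from measurable_compose[OF this \<Theta>m]
      have "(\<integral>\<^sup>+b. ?T b u \<partial>?G)
          = ennreal (1 / pi) * (indicator ?D u * (\<integral>\<^sup>+b. \<Theta> b u \<partial>?G))"
        by (simp add: nn_integral_cmult)
      then show "(\<integral>\<^sup>+b. ?T b u \<partial>?G)
          = ennreal (1 / pi) * (indicator ?D u * ennreal (conditional_density N ((cmod u)^2)))"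
        unfolding \<Theta>_def gaussian_reduced_poly(1)[OF N u] .
    qed
  qed
  also have "\<dots> = ennreal (conditional_count N x)"
    using N x by (intro nn_integral_conditional_density) auto
  finally have J: "(\<integral>\<^sup>+b. f b \<partial>?G1) = ennreal (conditional_count N x)" .
  have "(\<integral>\<^sup>+b. ennreal ((cmod (b 1))^2) * of_nat (disc_root_count N x (b(0 := 0))) \<partial>?G1)
      = (\<integral>\<^sup>+b. ennreal ((cmod (b 1))^2) + f b \<partial>?G1)"
  proof (rule nn_integral_cong_AE)
    have "AE b in ?G1. b N \<noteq> 0" using N by (intro AE_PiM_std_cgauss_nonzero) auto
    then show "AE b in ?G1.
        ennreal ((cmod (b 1))^2) * of_nat (disc_root_count N x (b(0 := 0))) = ennreal ((cmod (b 1))^2) + f b"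
    proof eventually_elim
      fix b :: "nat \<Rightarrow> complex" assume b: "b N \<noteq> 0"
      define Q where "Q = [:bw_weight N 1 * b 1:] + reduced_poly N b"
      have "pderiv Q = pderiv (reduced_poly N b)" by (simp add: Q_def pderiv_add pderiv_pCons)
      then have "Q \<noteq> 0" using pderiv_reduced_poly_nonzero[of N b] N b by auto
      then have "disc_root_count N x (b(0 := 0)) = Suc (?n Q)"
        using disc_root_count_root_zero[of N x Q b] N x by (simp add: Q_def)
      then show "ennreal ((cmod (b 1))^2) * of_nat (disc_root_count N x (b(0 := 0))) = ennreal ((cmod (b 1))^2) + f b"
        by (simp add: f_def distrib_left)
    qed
  qed
  also have "\<dots> = (\<integral>\<^sup>+b. ennreal ((cmod (b 1))^2) \<partial>?G1) + (\<integral>\<^sup>+b. f b \<partial>?G1)"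
  proof (rule nn_integral_add)
    show "(\<lambda>b. ennreal ((cmod (b 1))^2)) \<in> borel_measurable (?G1)"
      by (rule measurable_cmod_component)
    show "f \<in> borel_measurable (?G1)" using fm unfolding split .
  qed
  also have "\<dots> = 1 + ennreal (conditional_count N x)"
    unfolding J using N by (subst nn_integral_std_cgauss_component) auto
  also have "\<dots> = ennreal (1 + conditional_count N x)"
    using conditional_count_nonneg[OF x, of N] by (subst ennreal_plus) auto
  finally show ?thesis .
qed

section \<open>Pairs of close roots\<close>

text \<open>The ordered index pairs split into the diagonal, present because
  \<open>t \<ge> 0\<close>, and two triangles exchanged by symmetry of the distance. Counting
  indices handles repeated roots correctly.\<close>

lemma card_close_pairs:
  assumes t: "t \<ge> 0"
  shows "(\<Sum>w\<in>#mset xs. size (filter_mset (\<lambda>z. dist (stereo w) (stereo z) \<le> t) (mset xs))) = length xs + 2 * pair_count t xs"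
proof -
  let ?n = "length xs"
  let ?P = "\<lambda>i j. dist (stereo (xs ! i)) (stereo (xs ! j)) \<le> t"
  define U where "U = {(i, j). i < j \<and> j < ?n \<and> ?P i j}"
  define L where "L = {(i, j). j < i \<and> i < ?n \<and> ?P i j}"
  define D where "D = (\<lambda>i. (i, i)) ` {..<?n}"
  have fin: "finite U" "finite L" "finite D"
    by (rule finite_subset[of _ "{..<?n} \<times> {..<?n}"]; auto simp: U_def L_def D_def)+
  have xs: "xs = map ((!) xs) [0..<?n]" by (rule map_nth[symmetric])
  have inner: "size (filter_mset (\<lambda>z. dist (stereo w) (stereo z) \<le> t) (mset xs))
      = card {j\<in>{..<?n}. dist (stereo w) (stereo (xs ! j)) \<le> t}" for w
    by (subst xs) (rule size_filter_mset_map)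
  have "(\<Sum>w\<in>#mset xs. size (filter_mset (\<lambda>z. dist (stereo w) (stereo z) \<le> t) (mset xs)))
      = (\<Sum>i<?n. card {j\<in>{..<?n}. ?P i j})"
    unfolding inner
    by (simp add: sum_mset_sum_list sum_list_sum_nth atLeast0LessThan flip: mset_map)
  also have "\<dots> = card (SIGMA i:{..<?n}. {j\<in>{..<?n}. ?P i j})"
    by (rule card_SigmaI[symmetric]) auto
  also have "(SIGMA i:{..<?n}. {j\<in>{..<?n}. ?P i j}) = D \<union> (U \<union> L)"
    using t by (auto simp: D_def U_def L_def)
  also have "card \<dots> = card D + (card U + card L)"
  proof -
    have "D \<inter> (U \<union> L) = {}" "U \<inter> L = {}" by (auto simp: D_def U_def L_def)
    then show ?thesis using fin by (simp add: card_Un_disjoint)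
  qed
  also have "card D = ?n" unfolding D_def by (subst card_image) (auto simp: inj_on_def)
  also have "card L = card U"
  proof -
    have "L = prod.swap ` U" by (auto simp: L_def U_def dist_commute image_iff)
    then show ?thesis by (simp add: card_image)
  qed
  finally show ?thesis by (simp add: pair_count_def U_def)
qed

definition multiset_pair_count :: "real \<Rightarrow> complex multiset \<Rightarrow> nat" where
  "multiset_pair_count t A = pair_count t (SOME xs. mset xs = A)"

text \<open>The left-hand side of \<open>card_close_pairs\<close> depends only on the multiset,
  hence so does the pair count; this makes the arbitrary ordering in \<open>G_zeros\<close>
  harmless.\<close>

lemma multiset_pair_count_mset:
  assumes "t \<ge> 0"
  shows "multiset_pair_count t (mset xs) = pair_count t xs"
proof -
  define ys where "ys = (SOME ys. mset ys = mset xs)"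
  have "mset ys = mset xs" unfolding ys_def by (rule someI[of _ xs]) simp
  then have "length ys + 2 * pair_count t ys = length xs + 2 * pair_count t xs"
    using card_close_pairs[OF assms, of ys] card_close_pairs[OF assms, of xs] by simp
  moreover have "length ys = length xs" using \<open>mset ys = mset xs\<close> by (rule mset_eq_length)
  ultimately show ?thesis by (simp add: multiset_pair_count_def ys_def)
qed

lemma sum_close_pairs:
  assumes "t \<ge> 0"
  shows "(\<Sum>w\<in>#A. size (filter_mset (\<lambda>z. dist (stereo w) (stereo z) \<le> t) A)) = size A + 2 * multiset_pair_count t A"
proof -
  obtain xs where "A = mset xs" using ex_mset by metis
  then show ?thesis using card_close_pairs[OF assms, of xs] multiset_pair_count_mset[OF assms, of xs] by simp
qed

lemma G_zeros_eq: "G_zeros N t a = multiset_pair_count t (proots (elliptic_poly N a))"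
  by (simp add: G_zeros_def multiset_pair_count_def)

lemma continuous_on_stereo: "continuous_on S stereo"
proof -
  have "1 + (cmod z)^2 \<noteq> 0" for z using one_plus_cmod_pos[of z] by simp
  then show ?thesis
    unfolding stereo_def by (intro continuous_intros) auto
qed

lemma G_zeros_measurable:
  assumes "t \<ge> 0"
  shows "G_zeros N t \<in> coef_measure N \<rightarrow>\<^sub>M count_space UNIV"
  unfolding G_zeros_eq[abs_def]
proof (rule weighted_proots_functional_measurable)
  fix d k
  have "closed {z :: nat \<Rightarrow> complex. dist (stereo (z i)) (stereo (z j)) \<le> t}" for i j
    by (intro closed_Collect_le continuous_intros
        continuous_on_compose2[OF continuous_on_stereo continuous_on_product_coordinates]) auto
  then have "closed {z :: nat \<Rightarrow> complex. k \<le> card {x\<in>{x. fst x < snd x \<and> snd x < d}.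
      dist (stereo (z (fst x))) (stereo (z (snd x))) \<le> t}}"
    by (intro closed_le_card_Collect finite_subset[of "{x. fst x < snd x \<and> snd x < d}" "{..<d} \<times> {..<d}"]) auto
  moreover have "multiset_pair_count t (mset (map z [0..<d]))
      = card {x\<in>{x. fst x < snd x \<and> snd x < d}. dist (stereo (z (fst x))) (stereo (z (snd x))) \<le> t}" for z
    unfolding multiset_pair_count_mset[OF assms] pair_count_def by (intro arg_cong[where f=card]) auto
  ultimately show "closed {z :: nat \<Rightarrow> complex. k \<le> multiset_pair_count t (mset (map z [0..<d]))}"
    by (simp only:)
  show "(\<lambda>x. x i) \<in> borel_measurable (coef_measure N)" for i
    unfolding coef_measure_def by (rule borel_measurable_PiM_component) simp
qed

lemma prob_space_coef_measure: "prob_space (coef_measure N)"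
  unfolding coef_measure_def by (rule prob_space_PiM) (rule prob_space_std_cgauss)

text \<open>Valid for every coefficient vector, degenerate ones included. It makes the case
  \<open>N = 1\<close> trivial and supplies integrability at \<open>t = 2\<close>.\<close>

lemma G_zeros_le:
  assumes "t \<ge> 0"
  shows "real (G_zeros N t a) \<le> real N * (real N - 1) / 2"
proof (cases "N = 0")
  case False
  define A where "A = proots (elliptic_poly N a)"
  have "size A \<le> degree (elliptic_poly N a)" unfolding A_def by (rule size_proots_le)
  also have "\<dots> \<le> N" by (rule degree_elliptic_poly_le)
  finally have n: "size A \<le> N" .
  have "size A + 2 * G_zeros N t a = (\<Sum>w\<in>#A. size (filter_mset (\<lambda>z. dist (stereo w) (stereo z) \<le> t) A))"
    using sum_close_pairs[OF assms, of A] by (simp add: G_zeros_eq A_def)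
  also have "\<dots> \<le> (\<Sum>w\<in>#A. size A)" by (intro sum_mset_mono size_filter_mset_lesseq)
  also have "\<dots> = size A * size A" by simp
  finally have "real (size A + 2 * G_zeros N t a) \<le> real (size A * size A)"
    by (simp only: of_nat_le_iff)
  then have "2 * real (G_zeros N t a) \<le> real (size A) * (real (size A) - 1)" by (simp add: algebra_simps)
  also have "\<dots> \<le> real N * (real N - 1)"
  proof (cases "size A = 0")
    case False
    then have "1 \<le> size A" by linarith
    then show ?thesis using n by (intro mult_mono) auto
  next
    case True
    have "1 \<le> real N" using \<open>N \<noteq> 0\<close> by simp
    then show ?thesis using True by simp
  qed
  finally show ?thesis by simp
next
  case True
  have "degree (elliptic_poly N a) = 0" using True by (simp add: elliptic_poly_def monom_0)
  then have "proots (elliptic_poly N a) = {#}"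
    using size_proots_le[of "elliptic_poly N a"] by simp
  then have "length (SOME xs. mset xs = proots (elliptic_poly N a)) = 0" by simp
  then show ?thesis using True by (simp add: G_zeros_def pair_count_def)
qed

text \<open>\<open>expectation_sum_over_roots\<close> is applied with \<open>C\<close> the root
  count in the rotated disc. The sum over roots has mean
  \<open>N * (1 + conditional_count N x)\<close>; removing the diagonal \<open>N\<close> and halving
  leaves the claim.\<close>

lemma nn_integral_G_zeros:
  assumes N: "N \<ge> 1" and t: "0 \<le> t" "t < 2"
  shows "(\<integral>\<^sup>+a. of_nat (G_zeros N t a) \<partial>coef_measure N)
    = ennreal (real N / 2 * conditional_count N (t^2 / (4 - t^2)))"
proof (cases "N = 1")
  case True
  then have "G_zeros N t a = 0" for a using G_zeros_le[OF t(1), of N a] by simp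
  then show ?thesis using True by (simp add: conditional_count_def reduced_variance'_def)
next
  case False
  then have N2: "N \<ge> 2" using N by simp
  define x where "x = t^2 / (4 - t^2)"
  have "4 - t^2 > 0" using t power_strict_mono[of t 2 2] by simp
  then have x: "x \<ge> 0" by (simp add: x_def)
  define S where "S a = (of_nat (N + 2 * G_zeros N t a) :: ennreal)" for a
  have Gm: "(\<lambda>a. of_nat (G_zeros N t a) :: ennreal) \<in> borel_measurable (coef_measure N)"
    using measurable_compose[OF G_zeros_measurable[OF t(1), of N], of of_nat borel] by simp
  have Cm: "(\<lambda>b. of_nat (disc_root_count N x b) :: ennreal) \<in> borel_measurable borel"
    using measurable_compose[OF disc_root_count_measurable[of N x], of of_nat borel] by simp
  have "(\<integral>\<^sup>+a. S a \<partial>coef_measure N)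
    = (\<integral>\<^sup>+w. ennreal (1 / (pi * (1 + (cmod w)^2)^2)) \<partial>lborel)
      * (of_nat N * (\<integral>\<^sup>+b. ennreal ((cmod (b 1))^2) * of_nat (disc_root_count N x (b(0 := 0))) \<partial>gaussian_PiM {1..N}))"
  proof (rule expectation_sum_over_roots[OF N Cm])
    show "S \<in> borel_measurable (coef_measure N)"
      unfolding S_def using measurable_compose[OF G_zeros_measurable[OF t(1), of N], of "\<lambda>n. of_nat (N + 2 * n) :: ennreal" borel] by simp
    show "of_nat (disc_root_count N x a) = (of_nat (disc_root_count N x b) :: ennreal)"
      if "\<And>n. n \<le> N \<Longrightarrow> a n = b n" for a b
      using disc_root_count_cong[of N a b x] that by simp
  next
    fix a :: "nat \<Rightarrow> complex"
    assume a: "a N \<noteq> 0"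
      and simple: "\<And>w. poly (elliptic_poly N a) w = 0 \<Longrightarrow> poly (pderiv (elliptic_poly N a)) w \<noteq> 0"
    let ?P = "elliptic_poly N a"
    note lc = coeff_elliptic_poly_top[of N a]
    note deg = degree_elliptic_poly[where a = a, OF a]
    have P0: "?P \<noteq> 0" using lc a by auto
    have "N + 2 * G_zeros N t a = (\<Sum>w\<in>#proots ?P. size (filter_mset (\<lambda>z. dist (stereo w) (stereo z) \<le> t) (proots ?P)))"
      using sum_close_pairs[OF t(1), of "proots ?P"] by (simp add: G_zeros_eq size_proots_complex deg)
    also have "\<dots> = (\<Sum>w\<in>#proots ?P. disc_root_count N x (moebius N w a))"
      using size_filter_proots_moebius[where a = a, OF a t] by (simp add: disc_root_count_def x_def)
    also have "\<dots> = (\<Sum>w\<in>{w. poly ?P w = 0}. disc_root_count N x (moebius N w a))"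
      by (subst proots_simple[OF P0 simple]) (simp_all add: sum_unfold_sum_mset)
    finally show "S a = (\<Sum>w\<in>{w. poly ?P w = 0}. of_nat (disc_root_count N x (moebius N w a)))"
      unfolding S_def by simp
  qed
  also have "\<dots> = of_nat N * ennreal (1 + conditional_count N x)"
    using weighted_disc_root_count[OF N2 x] by (simp add: nn_integral_spherical_area del: fun_upd_apply)
  also have "\<dots> = of_nat N + ennreal (real N * conditional_count N x)"
    using conditional_count_nonneg[OF x, of N]
    by (simp add: distrib_left ennreal_of_nat_eq_real_of_nat ennreal_mult)
  finally have "(\<integral>\<^sup>+a. S a \<partial>coef_measure N) = of_nat N + ennreal (real N * conditional_count N x)" .
  moreover have "(\<integral>\<^sup>+a. S a \<partial>coef_measure N) = of_nat N + 2 * (\<integral>\<^sup>+a. of_nat (G_zeros N t a) \<partial>coef_measure N)"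
  proof -
    interpret prob_space "coef_measure N" by (rule prob_space_coef_measure)
    have "(\<integral>\<^sup>+a. S a \<partial>coef_measure N) = (\<integral>\<^sup>+a. of_nat N + 2 * of_nat (G_zeros N t a) \<partial>coef_measure N)"
      by (intro nn_integral_cong) (simp add: S_def)
    also have "\<dots> = (\<integral>\<^sup>+a. of_nat N \<partial>coef_measure N) + (\<integral>\<^sup>+a. 2 * of_nat (G_zeros N t a) \<partial>coef_measure N)"
      by (rule nn_integral_add) (use Gm in auto)
    also have "\<dots> = of_nat N + 2 * (\<integral>\<^sup>+a. of_nat (G_zeros N t a) \<partial>coef_measure N)"
      using Gm by (simp add: nn_integral_cmult emeasure_space_1)
    finally show ?thesis .
  qed
  ultimately have "2 * (\<integral>\<^sup>+a. of_nat (G_zeros N t a) \<partial>coef_measure N) = ennreal (real N * conditional_count N x)"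
    by (simp add: ennreal_add_left_cancel)
  also have "ennreal (real N * conditional_count N x) = 2 * ennreal (real N / 2 * conditional_count N x)"
    using conditional_count_nonneg[OF x, of N]
    by (simp add: ennreal_mult[symmetric] flip: ennreal_numeral)
  finally show ?thesis by (simp only: ennreal_mult_cancel_left x_def) simp
qed

lemma EG_eq_conditional_count:
  assumes N: "N \<ge> 1" and t: "0 \<le> t" "t < 2"
  shows "EG N t = real N / 2 * conditional_count N (t^2 / (4 - t^2))"
proof -
  have "4 - t^2 > 0" using t power_strict_mono[of t 2 2] by simp
  then have nn: "conditional_count N (t^2 / (4 - t^2)) \<ge> 0" by (intro conditional_count_nonneg) auto
  have "(\<lambda>a. real (G_zeros N t a)) \<in> borel_measurable (coef_measure N)"
    using measurable_compose[OF G_zeros_measurable[OF t(1), of N], of real borel] by simp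
  then have "EG N t = enn2real (\<integral>\<^sup>+a. ennreal (real (G_zeros N t a)) \<partial>coef_measure N)"
    unfolding EG_def by (intro integral_eq_nn_integral) auto
  then show ?thesis
    using nn_integral_G_zeros[OF assms] nn by (simp add: ennreal_of_nat_eq_real_of_nat)
qed

text \<open>At \<open>t = 2\<close> the disc would be the whole sphere and \<open>x\<close>
  infinite, so this endpoint uses the trivial count of all pairs.\<close>

lemma EG_two_le:
  assumes "N \<ge> 1"
  shows "EG N 2 \<le> real N * (real N - 1) / 2"
proof -
  interpret prob_space "coef_measure N" by (rule prob_space_coef_measure)
  have "(\<lambda>a. real (G_zeros N 2 a)) \<in> borel_measurable (coef_measure N)"
    using measurable_compose[OF G_zeros_measurable[of 2 N], of real borel] by simp
  then have "integrable (coef_measure N) (\<lambda>a. real (G_zeros N 2 a))"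
    using G_zeros_le[of 2 N] by (intro integrable_const_bound[where B = "real N * (real N - 1) / 2"]) auto
  then show ?thesis
    unfolding EG_def by (rule integral_le_const) (use G_zeros_le[of 2 N] in auto)
qed

section \<open>Estimates\<close>

lemma mult_reduced_variance:
  assumes "N \<ge> 1"
  shows "x * reduced_variance N x = (1 + x) ^ N - 1"
proof -
  have split: "{..N} = insert 0 (insert 1 {2..N})" using assms by auto
  have "(1 + x) ^ N = (\<Sum>n\<le>N. real (N choose n) * x ^ n)"
    using binomial_ring[of x 1 N] by (simp add: add.commute)
  also have "\<dots> = 1 + real N * x + (\<Sum>n\<in>{2..N}. real (N choose n) * x ^ n)"
    unfolding split by simp
  also have "(\<Sum>n\<in>{2..N}. real (N choose n) * x ^ n) = x * (\<Sum>n\<in>{2..N}. real (N choose n) * x ^ (n - 1))"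
    unfolding sum_distrib_left
  proof (intro sum.cong refl)
    fix n assume "n \<in> {2..N}"
    then have "x ^ n = x * x ^ (n - 1)" by (cases n) auto
    then show "real (N choose n) * x ^ n = x * (real (N choose n) * x ^ (n - 1))" by simp
  qed
  finally show ?thesis by (simp add: reduced_variance_def algebra_simps)
qed

text \<open>Both sides are derivatives of
  \<open>x * reduced_variance N x = (1 + x) ^ N - 1\<close>.\<close>

lemma mult_reduced_variance':
  assumes "N \<ge> 1"
  shows "reduced_variance N x + x * reduced_variance' N x = real N * (1 + x) ^ (N - 1)"
proof (rule DERIV_unique)
  show "((\<lambda>x. x * reduced_variance N x) has_real_derivative reduced_variance N x + x * reduced_variance' N x) (at x)"
    by (auto intro!: derivative_eq_intros reduced_variance_DERIV simp: mult.commute)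
  show "((\<lambda>x. x * reduced_variance N x) has_real_derivative real N * (1 + x) ^ (N - 1)) (at x)"
    unfolding mult_reduced_variance[OF assms] by (auto intro!: derivative_eq_intros)
qed

text \<open>Since \<open>1 + x = 4 / (4 - t^2)\<close>, one has
  \<open>x * reduced_variance N x = q\<close>; this and its derivative express every ingredient
  rationally in \<open>t^2\<close>, \<open>q\<close> and \<open>N\<close>.\<close>

lemma conditional_count_closed_form:
  assumes N: "N \<ge> 1" and t: "0 < t" "t < 2"
  defines "q \<equiv> (4 / (4 - t^2)) ^ N - 1"
  shows "real N / 2 * conditional_count N (t^2 / (4 - t^2)) = t^2 * N^2 / 8 - N / 2
      + t^2 * N^2 / (8 * (4 - t^2) * q) * (8 - t^2 - t^2 * N - t^2 * N / q)"
proof -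
  define u where "u = t^2"
  have u: "0 < u" "u < 4" using t power_strict_mono[of t 2 2] by (simp_all add: u_def)
  define x where "x = u / (4 - u)"
  define s where "s = reduced_variance N x"
  have x: "x > 0" using u by (simp add: x_def)
  have x1: "1 + x = 4 / (4 - u)" using u by (simp add: x_def field_simps)
  have sq: "x * s = q" unfolding s_def mult_reduced_variance[OF N] x1 q_def u_def ..
  have spos: "s > 0" unfolding s_def using x N by (intro reduced_variance_pos) auto
  have qpos: "q > 0" unfolding sq[symmetric] using x spos by simp
  have s: "s = q * (4 - u) / u" using sq u by (simp add: x_def field_simps)
  have "(1 + x) * (1 + x) ^ (N - 1) = q + 1"
    using N x1 by (simp add: q_def u_def power_eq_if)
  then have pw: "(1 + x) ^ (N - 1) = (q + 1) * (4 - u) / 4"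
    unfolding x1 using u by (simp add: field_simps)
  have s1: "x * reduced_variance' N x = N * ((q + 1) * (4 - u) / 4) - q * (4 - u) / u"
    using mult_reduced_variance'[OF N, of x] unfolding pw s_def[symmetric] s by simp
  have "real N / 2 * conditional_count N x
      = N / 2 * ((N * ((q + 1) * (4 - u) / 4) - q * (4 - u) / u) * (q * (4 - u) / u - N) / (q * (4 - u) / u)^2)"
    unfolding conditional_count_def s1 s_def[symmetric] s ..
  also have "\<dots> = u * N^2 / 8 - N / 2 + u * N^2 / (8 * (4 - u) * q) * (8 - u - u * N - u * N / q)"
  proof -
    define w where "w = 4 - u"
    have w: "w > 0" "u = 4 - w" using u by (auto simp: w_def)
    show ?thesis
      using u qpos w(1) unfolding w_def[symmetric]
      by (simp add: divide_simps power2_eq_square) (simp add: w_def algebra_simps)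
  qed
  finally show ?thesis unfolding x_def u_def by (simp only: of_nat_power)
qed

text \<open>\<open>(reduced_variance N x - N) / x\<close> written without a division; with
  \<open>reduced_variance'\<close> it forms the two nonnegative factors of
  \<open>conditional_count\<close>.\<close>

definition pair_ratio :: "nat \<Rightarrow> real \<Rightarrow> real" where
  "pair_ratio N x = (\<Sum>n\<in>{2..N}. real (N choose n) * x ^ (n - 2))"

lemma reduced_variance_eq_pair_ratio: "reduced_variance N x - real N = x * pair_ratio N x"
proof -
  have "x ^ (n - 1) = x * x ^ (n - 2)" if "n \<in> {2..N}" for n
  proof -
    have "n - 1 = Suc (n - 2)" using that by auto
    then show ?thesis by simp
  qed
  then have "(\<Sum>n\<in>{2..N}. real (N choose n) * x ^ (n - 1)) = (\<Sum>n\<in>{2..N}. x * (real (N choose n) * x ^ (n - 2)))"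
    by (intro sum.cong) auto
  then show ?thesis by (simp add: reduced_variance_def pair_ratio_def sum_distrib_left)
qed

text \<open>The mean of the two factors of \<open>conditional_count\<close> has a closed form, so the upper bound
  is the inequality between geometric and arithmetic mean.\<close>

lemma sum_of_factors:
  assumes "N \<ge> 1" "x > 0"
  shows "(1 + x) * (reduced_variance' N x + pair_ratio N x) = real N * reduced_variance N x - real N"
proof -
  have e: "(1 + x) * (1 + x) ^ (N - 1) = (1 + x) ^ N" using assms(1) by (simp add: power_eq_if)
  have "x * (reduced_variance' N x + pair_ratio N x) = real N * (1 + x) ^ (N - 1) - real N"
    using mult_reduced_variance'[OF assms(1), of x] reduced_variance_eq_pair_ratio[of N x]
    by (simp add: distrib_left)
  then have "x * ((1 + x) * (reduced_variance' N x + pair_ratio N x)) = (1 + x) * (real N * (1 + x) ^ (N - 1) - real N)"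
    by (subst mult.left_commute) (simp only:)
  also have "\<dots> = real N * ((1 + x) * (1 + x) ^ (N - 1)) - (1 + x) * real N"
    by (simp add: algebra_simps)
  also have "\<dots> = real N * (x * reduced_variance N x + 1) - (1 + x) * real N"
    unfolding e mult_reduced_variance[OF assms(1)] by simp
  also have "\<dots> = x * (real N * reduced_variance N x - real N)" by (simp add: algebra_simps)
  finally show ?thesis using assms(2) by simp
qed

lemma pair_ratio_nonneg: "x \<ge> 0 \<Longrightarrow> pair_ratio N x \<ge> 0"
  unfolding pair_ratio_def by (intro sum_nonneg) auto

lemma reduced_variance'_nonneg: "x \<ge> 0 \<Longrightarrow> reduced_variance' N x \<ge> 0"
  unfolding reduced_variance'_def by (intro sum_nonneg) auto

lemma conditional_count_eq_pair_ratio: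
  "conditional_count N x = x^2 * reduced_variance' N x * pair_ratio N x / (reduced_variance N x)^2"
  unfolding conditional_count_def reduced_variance_eq_pair_ratio by (simp add: power2_eq_square)

lemma conditional_count_le:
  assumes N: "N \<ge> 1" and x: "x \<ge> 0"
  shows "conditional_count N x \<le> (real N)^2 * x^2 / (4 * (1 + x)^2)"
proof (cases "x = 0")
  case False
  then have x: "x > 0" using x by simp
  define s where "s = reduced_variance N x"
  define a where "a = reduced_variance' N x"
  define b where "b = pair_ratio N x"
  have s: "s > 0" unfolding s_def using x N by (intro reduced_variance_pos) auto
  have ab: "a \<ge> 0" "b \<ge> 0" using x by (auto simp: a_def b_def intro: reduced_variance'_nonneg pair_ratio_nonneg)
  \<comment> \<open>The term \<open>- real N\<close> of \<open>sum_of_factors\<close> is discarded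
    here, so \<open>a + b\<close> is at most \<open>N * s / (1 + x)\<close>.\<close>
  have "(1 + x) * (a + b) \<le> N * s" using sum_of_factors[OF N x] by (simp add: a_def b_def s_def)
  then have "((1 + x) * (a + b))^2 \<le> (N * s)^2"
    using x ab by (intro power_mono) auto
  moreover have "4 * (a * b) \<le> (a + b)^2"
    using zero_le_power2[of "a - b"] by (simp add: power2_eq_square algebra_simps)
  then have "(1 + x)^2 * (4 * (a * b)) \<le> (1 + x)^2 * (a + b)^2"
    by (intro mult_left_mono) auto
  ultimately have "(1 + x)^2 * (4 * (a * b)) \<le> (real N)^2 * s^2"
    by (simp add: power_mult_distrib)
  then have "x^2 * ((1 + x)^2 * (4 * (a * b))) \<le> x^2 * ((real N)^2 * s^2)"
    by (intro mult_left_mono) auto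
  moreover have "conditional_count N x = x^2 * a * b / s^2"
    by (simp add: conditional_count_eq_pair_ratio a_def b_def s_def)
  ultimately show ?thesis
    using s x by (simp add: divide_le_eq pos_le_divide_eq) (simp add: field_simps)
qed (simp add: conditional_count_def)

lemma choose_two_le_sum:
  assumes "N \<ge> 2" "\<And>n. n \<in> {2..N} \<Longrightarrow> f n \<ge> 0" "f 2 = real (N choose 2)"
  shows "real N * (real N - 1) / 2 \<le> (\<Sum>n\<in>{2..N}. f n)"
proof -
  have "real (N choose 2) = real N * (real N - 1) / 2"
    using assms(1) by (simp add: choose_two real_of_nat_div of_nat_diff)
  then have "real N * (real N - 1) / 2 = f 2" using assms(3) by simp
  also have "\<dots> \<le> (\<Sum>n\<in>{2..N}. f n)" using assms by (intro member_le_sum) auto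
  finally show ?thesis .
qed

text \<open>Each of the two factors is at least its term \<open>n = 2\<close>, which is
  \<open>N choose 2\<close>, while \<open>reduced_variance N x \<le> N * exp (N * x)\<close>. All
  three estimates are sharp at \<open>x = 0\<close>, hence precise enough for the
  asymptotics.\<close>

lemma conditional_count_ge:
  assumes N: "N \<ge> 2" and x: "x \<ge> 0"
  shows "x^2 * (real N - 1)^2 / 4 * exp (- 2 * real N * x) \<le> conditional_count N x"
proof -
  have N1: "N \<ge> 1" using N by simp
  define s where "s = reduced_variance N x"
  define c where "c = real N * (real N - 1) / 2"
  have c: "c \<ge> 0" using N by (simp add: c_def)
  have s: "s > 0" unfolding s_def using x N by (intro reduced_variance_pos) auto
  have a: "c \<le> reduced_variance' N x"
    unfolding c_def reduced_variance'_def by (rule choose_two_le_sum) (use N x in auto)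
  have b: "c \<le> pair_ratio N x"
    unfolding c_def pair_ratio_def by (rule choose_two_le_sum) (use N x in auto)
  have "s \<le> N * (1 + x) ^ (N - 1)"
    using mult_reduced_variance'[OF N1, of x] x reduced_variance'_nonneg[OF x, of N]
    by (simp add: s_def) (smt (verit) mult_nonneg_nonneg)
  also have "\<dots> \<le> N * (1 + x) ^ N"
    using x by (intro mult_left_mono power_increasing) auto
  also have "\<dots> \<le> N * exp x ^ N"
    using x exp_ge_add_one_self[of x] by (intro mult_left_mono power_mono) auto
  also have "\<dots> = N * exp (N * x)" by (simp add: exp_of_nat_mult)
  finally have "s^2 \<le> (N * exp (N * x))^2" using s by (intro power_mono) auto
  also have "\<dots> = (real N)^2 * exp (2 * N * x)"
    by (simp add: power_mult_distrib power2_eq_square[of "exp _"] exp_add[symmetric])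
  finally have s2: "s^2 \<le> (real N)^2 * exp (2 * N * x)" .
  have "x^2 * (real N - 1)^2 / 4 * exp (- 2 * real N * x) = x^2 * (c * c) / ((real N)^2 * exp (2 * N * x))"
    using N by (simp add: c_def exp_minus field_simps power2_eq_square)
  also have "\<dots> \<le> x^2 * (c * c) / s^2"
    using s s2 c N by (intro divide_left_mono mult_pos_pos) auto
  also have "\<dots> \<le> x^2 * (reduced_variance' N x * pair_ratio N x) / s^2"
    using a b c by (intro divide_right_mono mult_left_mono mult_mono) auto
  finally show ?thesis
    by (simp add: conditional_count_eq_pair_ratio s_def mult.assoc)
qed

lemma EG_le:
  assumes N: "N \<ge> 1" and t: "0 \<le> t" "t \<le> 2"
  shows "EG N t \<le> real N ^ 3 * t ^ 4 / 128"
proof (cases "t = 2")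
  case True
  \<comment> \<open>At \<open>t = 2\<close> the target is \<open>N^3 / 8\<close>, and the gap to the
    number of all pairs is \<open>N * (N - 2)^2 / 8\<close>.\<close>
  have "(real N - 1) / 2 \<le> (real N)^2 / 8"
    using zero_le_power2[of "real N - 2"] by (simp add: power2_eq_square algebra_simps)
  then have "real N * ((real N - 1) / 2) \<le> real N * ((real N)^2 / 8)" by (intro mult_left_mono) auto
  then show ?thesis
    using EG_two_le[OF N] by (simp add: True power2_eq_square power3_eq_cube)
next
  case False
  then have t2: "t < 2" using t by simp
  define x where "x = t^2 / (4 - t^2)"
  have pos: "4 - t^2 > 0" using t t2 power_strict_mono[of t 2 2] by simp
  have x: "x \<ge> 0" using pos by (simp add: x_def)
  have "x / (1 + x) = t^2 / 4" using pos by (simp add: x_def field_simps)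
  then have "(x / (1 + x))^2 = (t^2 / 4)^2" by (rule arg_cong)
  then have "x^2 / (1 + x)^2 = t ^ 4 / 16" by (simp add: power_divide flip: power_mult)
  then have e: "real N / 2 * ((real N)^2 * x^2 / (4 * (1 + x)^2)) = real N ^ 3 * t ^ 4 / 128"
  proof -
    have "real N / 2 * ((real N)^2 * x^2 / (4 * (1 + x)^2)) = real N ^ 3 / 8 * (x^2 / (1 + x)^2)"
      by (simp add: power3_eq_cube power2_eq_square[of "real N"])
    then show ?thesis using \<open>x\<^sup>2 / (1 + x)^2 = t ^ 4 / 16\<close> by simp
  qed
  have "EG N t = real N / 2 * conditional_count N x"
    unfolding x_def by (rule EG_eq_conditional_count[OF N t(1) t2])
  also have "\<dots> \<le> real N / 2 * ((real N)^2 * x^2 / (4 * (1 + x)^2))"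
    by (intro mult_left_mono conditional_count_le[OF N x]) auto
  finally show ?thesis unfolding e .
qed

text \<open>For \<open>t \<le> 1\<close> one has \<open>t^2 / 4 \<le> x \<le> t^2 / 2\<close>: the
  first bound enters the main factor, the second only the exponential correction.\<close>

lemma EG_ge:
  assumes N: "N \<ge> 2" and t: "0 \<le> t" "t \<le> 1"
  shows "((real N - 1) / real N)^2 * exp (- (real N * t^2)) * (real N ^ 3 * t ^ 4 / 128) \<le> EG N t"
proof -
  define x where "x = t^2 / (4 - t^2)"
  have t1: "t^2 \<le> 1" using t by (simp add: power_le_one)
  have x: "x \<ge> 0" using t1 by (simp add: x_def)
  have x_ge: "t^2 / 4 \<le> x" unfolding x_def using t1 by (intro divide_left_mono) auto
  have "x \<le> t^2 / 2" unfolding x_def using t1 by (intro divide_left_mono) auto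
  then have "real N * (2 * x) \<le> real N * t^2" by (intro mult_left_mono) auto
  then have ex: "exp (- (real N * t^2)) \<le> exp (- 2 * real N * x)" by simp
  have "((real N - 1) / real N)^2 * exp (- (real N * t^2)) * (real N ^ 3 * t ^ 4 / 128)
      = real N / 2 * ((t^2 / 4)^2 * (real N - 1)^2 / 4 * exp (- (real N * t^2)))"
    using N by (simp add: power_divide power2_eq_square power3_eq_cube power4_eq_xxxx field_simps)
  also have "\<dots> \<le> real N / 2 * (x^2 * (real N - 1)^2 / 4 * exp (- 2 * real N * x))"
    using x_ge ex by (intro mult_left_mono mult_mono divide_right_mono mult_right_mono power_mono) auto
  also have "\<dots> \<le> real N / 2 * conditional_count N x"
    by (intro mult_left_mono conditional_count_ge[OF N x]) auto
  also have "\<dots> = EG N t"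
    unfolding x_def using N t by (intro EG_eq_conditional_count[symmetric]) auto
  finally show ?thesis .
qed

lemma EG_asymp_equiv:
  fixes tN :: "nat \<Rightarrow> real"
  assumes nn: "\<And>N. 0 \<le> tN N" and small: "tN \<in> o(\<lambda>N. 1 / sqrt (real N))"
  shows "(\<lambda>N. EG N (tN N)) \<sim>[at_top] (\<lambda>N. real N ^ 3 * tN N ^ 4 / 128)"
proof -
  have "(\<lambda>N. tN N / (1 / sqrt (real N))) \<longlonglongrightarrow> 0"
    by (rule smalloD_tendsto[OF small])
  \<comment> \<open>Squaring gives \<open>N * t^2 \<longrightarrow> 0\<close>. This is the exponent
    in \<open>EG_ge\<close>, and it eventually forces \<open>t \<le> 1\<close>.\<close>
  then have "(\<lambda>N. (tN N * sqrt (real N))^2) \<longlonglongrightarrow> 0^2"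
    by (intro tendsto_power) simp
  then have lim: "(\<lambda>N. real N * (tN N)^2) \<longlonglongrightarrow> 0"
    by (simp add: power_mult_distrib mult.commute)
  define lower where "lower N = ((real N - 1) / real N)^2 * exp (- (real N * (tN N)^2))" for N
  have "(\<lambda>N. (real N - 1) / real N) \<longlonglongrightarrow> 1"
  proof (rule Lim_transform_eventually)
    show "(\<lambda>N. 1 - 1 / real N) \<longlonglongrightarrow> 1"
      using tendsto_diff[OF tendsto_const[of "1::real"] lim_1_over_n] by simp
    show "\<forall>\<^sub>F N in sequentially. 1 - 1 / real N = (real N - 1) / real N"
      using eventually_gt_at_top[of 0] by eventually_elim (simp add: diff_divide_distrib)
  qed
  then have "lower \<longlonglongrightarrow> 1^2 * exp (- 0)"
    unfolding lower_def by (intro tendsto_mult tendsto_power tendsto_exp tendsto_minus lim)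
  then have lower: "lower \<longlonglongrightarrow> 1" by simp
  \<comment> \<open>The quotient from the definition of asymptotic equivalence, where
    \<open>0 / 0\<close> counts as 1; this covers indices with \<open>tN N = 0\<close>.\<close>
  define ratio where "ratio N = (if EG N (tN N) = 0 \<and> real N ^ 3 * tN N ^ 4 / 128 = 0 then 1
      else EG N (tN N) / (real N ^ 3 * tN N ^ 4 / 128))" for N
  have ev: "\<forall>\<^sub>F N in sequentially. lower N \<le> ratio N \<and> ratio N \<le> 1"
    using eventually_ge_at_top[of 2] order_tendstoD(2)[OF lim zero_less_one]
  proof eventually_elim
    fix N :: nat assume N: "2 \<le> N" and small: "real N * (tN N)^2 < 1"
    have "1 * (tN N)^2 \<le> real N * (tN N)^2" using N by (intro mult_right_mono) auto
    then have "(tN N)^2 \<le> 1^2" using small by simp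
    then have t1: "tN N \<le> 1" by (rule power2_le_imp_le) simp
    have up: "EG N (tN N) \<le> real N ^ 3 * tN N ^ 4 / 128"
      using N nn[of N] t1 by (intro EG_le) auto
    have lo: "lower N * (real N ^ 3 * tN N ^ 4 / 128) \<le> EG N (tN N)"
      unfolding lower_def using N nn[of N] t1 by (intro EG_ge) auto
    show "lower N \<le> ratio N \<and> ratio N \<le> 1"
    proof (cases "tN N = 0")
      case True
      have "lower N \<le> 1 * 1"
        unfolding lower_def using N by (intro mult_mono power_le_one) auto
      then show ?thesis using True up lo by (simp add: ratio_def)
    next
      case False
      then have "real N ^ 3 * tN N ^ 4 / 128 > 0" using N by simp
      then show ?thesis using up lo False N by (simp add: ratio_def pos_le_divide_eq pos_divide_le_eq)
    qed
  qed
  have "ratio \<longlonglongrightarrow> 1"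
  proof (rule tendsto_sandwich[OF _ _ lower tendsto_const])
    show "\<forall>\<^sub>F N in sequentially. lower N \<le> ratio N" using ev by eventually_elim simp
    show "\<forall>\<^sub>F N in sequentially. ratio N \<le> 1" using ev by eventually_elim simp
  qed
  then show ?thesis unfolding asymp_equiv_def ratio_def .
qed

theorem theorem1p2:
  shows "(\<forall>N::nat. \<forall>t::real. N \<ge> 1 \<longrightarrow> 0 < t \<longrightarrow> t < 2 \<longrightarrow>
           (let q = (4 / (4 - t^2)) ^ N - 1 in
            EG N t = t^2 * N^2 / 8 - N / 2
              + t^2 * N^2 / (8 * (4 - t^2) * q) * (8 - t^2 - t^2 * N - t^2 * N / q)))
       \<and> (\<forall>tN :: nat \<Rightarrow> real. (\<forall>N. 0 \<le> tN N) \<longrightarrow> tN \<in> o(\<lambda>N. 1 / sqrt (real N)) \<longrightarrow>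
           (\<lambda>N. EG N (tN N)) \<sim>[at_top] (\<lambda>N. real N ^ 3 * tN N ^ 4 / 128))
       \<and> (\<forall>N::nat. \<forall>t::real. N \<ge> 1 \<longrightarrow> 0 \<le> t \<longrightarrow> t \<le> 2 \<longrightarrow>
           EG N t \<le> real N ^ 3 * t ^ 4 / 128)"
proof (intro conjI allI impI)
  fix N :: nat and t :: real assume N: "N \<ge> 1" and t: "0 < t" "t < 2"
  show "let q = (4 / (4 - t^2)) ^ N - 1 in
            EG N t = t^2 * N^2 / 8 - N / 2
              + t^2 * N^2 / (8 * (4 - t^2) * q) * (8 - t^2 - t^2 * N - t^2 * N / q)"
    unfolding Let_def EG_eq_conditional_count[OF N less_imp_le[OF t(1)] t(2)]
    using conditional_count_closed_form[OF N t] by (simp only: of_nat_power)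
next
  fix tN :: "nat \<Rightarrow> real" assume "\<forall>N. 0 \<le> tN N" "tN \<in> o(\<lambda>N. 1 / sqrt (real N))"
  then show "(\<lambda>N. EG N (tN N)) \<sim>[at_top] (\<lambda>N. real N ^ 3 * tN N ^ 4 / 128)"
    by (intro EG_asymp_equiv) auto
next
  fix N :: nat and t :: real assume "N \<ge> 1" "0 \<le> t" "t \<le> 2"
  then show "EG N t \<le> real N ^ 3 * t ^ 4 / 128" by (rule EG_le)
qed

end
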